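(* Given a program $\Pi$ without optimization rules, the dynamic programming algorithm $\mathcal{DP}_{\mathsf{INC}}$ runs in time $O\big(2^{2^{k+2}\cdot\ell^{k+1}}\cdot\|I(\Pi)\|\big)$, where $k$ is the treewidth of the incidence graph $I(\Pi)$ and $\ell=\max\big(\{3\}\cup\{\mathrm{bnd}(r): r \text{ is a weight rule in }\Pi\}\big)$.
   Context: **Programs.** Let $p\le q\le s$ be non-negative integers, $a_1,\dots,a_s$ distinct propositional atoms, $w,w_1,\dots,w_s$ non-negative integers. A *choice rule* is $\{a_1;\dots;a_p\}\leftarrow a_{p+1},\dots,a_q,\neg a_{q+1},\dots,\neg a_s$; a *disjunctive rule* is $a_1\vee\dots\vee a_p\leftarrow a_{p+1},\dots,a_q,\neg a_{q+1},\dots,\neg a_s$; a *weight rule* is $a_p\leftarrow w\leqslant\{a_{p+1}=w_{p+1},\dots,a_q=w_q,\neg a_{q+1}=w_{q+1},\dots,\neg a_s=w_s\}$ with $p\le 1$ (at most one head atom). For such a rule $r$ put $H_r=\{a_1,\dots,a_p\}$, $B_r^+=\{a_{p+1},\dots,a_q\}$, $B_r^-=\{a_{q+1},\dots,a_s\}$, $\mathrm{at}(r)=H_r\cup B_r^+\cup B_r^-$, and let $B_r=B_r^+\cup\{\neg b:b\in B_r^-\}$ be its body. For a weight rule, $\mathrm{wght}(r,a_i)=w_i$ for $p+1\le i\le s$, $\mathrm{wght}(r,a)=0$ for other atoms, $\mathrm{wght}(r,A)=\sum_{a\in A}\mathrm{wght}(r,a)$, and the bound is $\mathrm{bnd}(r)=w$.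 A program without optimization rules is a finite set $\Pi$ of choice, disjunctive and weight rules. **Satisfaction and reduct.** A set $M$ of atoms satisfies a disjunctive rule $r$ if $(H_r\cup B_r^-)\cap M\ne\emptyset$ or $B_r^+\not\subseteq M$; a weight rule $r$ if $H_r\cap M\neq\emptyset$ or $\mathrm{wght}(r,(M\cap B_r^+)\cup(B_r^-\setminus M))<\mathrm{bnd}(r)$; every set satisfies every choice rule. $M\models\Pi$ if $M$ satisfies all rules of $\Pi$. The reduct $r^M$ is: for a choice rule, $\{a\leftarrow B_r^+ : a\in H_r\cap M,\ B_r^-\cap M=\emptyset\}$; for a disjunctive rule, $\{H_r\leftarrow B_r^+\}$ if $B_r^-\cap M=\emptyset$, and $\emptyset$ otherwise; for a weight rule, $\{H_r\leftarrow w'\leqslant\{a=\mathrm{wght}(r,a): a\in B_r^+\}\}$ with $w'=\mathrm{bnd}(r)-\mathrm{wght}(r,B_r^-\setminus M)$. $\Pi^M=\bigcup_{r\in\Pi}r^M$. **Graphs.** $I(\Pi)$ is the bipartite graph whose vertices are the atoms and the rules of $\Pi$, with an edge between atom $a$ and rule $r$ iff $a\in\mathrm{at}(r)$. $\|G\|$ denotes the size of graph $G$. A tree decomposition of a graph is a pair $(T,\chi)$, $T$ a rooted tree and $\chi$ mapping nodes to sets of vertices (bags), such that every vertex and every edge is contained in some bag and, whenever $t_2$ lies on the path from $t_1$ to $t_3$, $\chi(t_1)\cap\chi(t_3)\subseteq\chi(t_2)$; its width is the maximum bag size minus one, and the treewidth is the minimum width over all tree decompositions. It is *nice* if bags of leaves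 and of the root are empty and every node $t$ is a *leaf* (no children), a *join* node (two children $t'\ne t''$, $\chi(t)=\chi(t')=\chi(t'')$), an *introduce* node (one child $t'$, $\chi(t')\subseteq\chi(t)$, $|\chi(t)|=|\chi(t')|+1$) or a *removal* node (one child $t'$, $\chi(t)\subseteq\chi(t')$, $|\chi(t')|=|\chi(t)|+1$). For a node $t$ of a tree decomposition of $I(\Pi)$, $\Pi_t=\Pi\cap\chi(t)$, and $\mathrm{at}_{\le t}$ is the set of atoms occurring in bags of the subtree rooted at $t$. **Rule-states.** A rule-state is a (partial) mapping $\sigma$ from rules to $\mathbb{N}_0\cup\{\infty\}$, viewed as a set of pairs. $\sigma\uplus\rho$ is the mapping defined on all rules on which $\sigma$ or $\rho$ is defined, with value the sum of the defined values. $\sigma_r^+=\sigma\cup\{(r,0)\}$; $\sigma_r^-$ is $\sigma$ with the pair for $r$ deleted. For a mapping $\dot{R}$ from rules to programs, $\mathrm{SatRules}(\dot R,M)$ is the mapping assigning $\infty$ to each $r$ with $M\models\dot R(r)$ (undefined elsewhere). $\mathrm{UpdtWgt}(\Pi_t,M,a)$ assigns to each weight rule $r\in\Pi_t$ the value $\mathrm{wght}(r,\{a\}\cap[(B_r^-\setminus M)\cup(B_r^+\cap M)])$. $\mathrm{UpdtWgtCh}(\Pi_t,M,C,a)$ assigns to each weight rule $r\in\Pi_t$ the value $\mathrm{wght}(r,\{a\}\cap[(B_r^-\setminus M)\cup(B_r^+\cap C)])$ and to each choice rule $r\in\Pi_t$ the value $|\{a\}\cap H_r\cap(M\setminus C)|$.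 **State-programs.** For $P\subseteq\Pi_t$ and a rule-state $\sigma$, $P^{(t,\sigma)}$ is obtained from $P\cup\{\leftarrow B_r: r\in P\text{ a choice rule},\ H_r\not\subseteq\mathrm{at}_{\le t}\}$ by (1) removing rules $r$ with $\sigma(r)=\infty$; (2) removing from every rule all literals $a,\neg a$ with $a\notin\chi(t)$; (3) giving each weight rule $r$ the new bound $\max\{0,\mathrm{bnd}(r)-\sigma(r)-\mathrm{wght}(r,\mathrm{at}(r)\setminus\mathrm{at}_{\le t})\}$. For a set $M$ of atoms, $P^{(t,\rho,M)}=[S^{(t,\rho)}]^M$ where $S=P\cup\{\leftarrow B_r: r\in P\text{ a choice rule},\ \rho(r)>0\}$. $\dot P^{(t,\sigma)}$ is the mapping $r\mapsto\{r\}^{(t,\sigma)}$ on $P$, and $\dot P^{(t,\rho,M)}$ is the mapping $r\mapsto\{r\}^{(t,\rho,M)}$ on $P$. Abbreviate $s_t(\sigma,M;P)=\sigma\uplus\mathrm{SatRules}(\dot P^{(t,\sigma)},M)$ and $s_t(\rho,M,C;P)=\rho\uplus\mathrm{SatRules}(\dot P^{(t,\rho,M)},C)$. **Algorithm $\mathcal{DP}_{\mathsf{INC}}$.** Traverse the nodes of a nice tree decomposition of $I(\Pi)$ in post-order and compute for each node $t$ a table $\tau_t$ of triples $\langle M,\sigma,\mathcal{C}\rangle$ ($M$ a set of atoms, $\sigma$ a rule-state, $\mathcal{C}$ a set of pairs $\langle C,\rho\rangle$ of a set of atoms and a rule-state) from the child table(s) $\tau'$ (and $\tau''$): - leaf: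 $\tau_t=\{\langle\emptyset,\emptyset,\emptyset\rangle\}$; - introduce atom $a$ (write $M^+=M\cup\{a\}$, $C^+=C\cup\{a\}$): for each $\langle M,\sigma,\mathcal{C}\rangle\in\tau'$, $\tau_t$ contains $\big\langle M^+,\ s_t(\sigma,M^+;\Pi_t),\ \{\langle M,s_t(\sigma,M^+,M;\Pi_t)\rangle\}\cup\{\langle C^+,s_t(\rho,M^+,C^+;\Pi_t)\rangle:\langle C,\rho\rangle\in\mathcal{C}\}\cup\{\langle C,s_t(\rho,M^+,C;\Pi_t)\rangle:\langle C,\rho\rangle\in\mathcal{C}\}\big\rangle$ and $\big\langle M,\ s_t(\sigma,M;\Pi_t),\ \{\langle C,s_t(\rho,M,C;\Pi_t)\rangle:\langle C,\rho\rangle\in\mathcal{C}\}\big\rangle$; - introduce rule $r$: $\tau_t=\big\{\langle M,\ s_t(\sigma_r^+,M;\{r\}),\ \{\langle C,s_t(\rho_r^+,M,C;\{r\})\rangle:\langle C,\rho\rangle\in\mathcal{C}\}\rangle:\langle M,\sigma,\mathcal{C}\rangle\in\tau'\big\}$; - remove atom $a$: $\tau_t=\big\{\langle M\setminus\{a\},\ \sigma\uplus\mathrm{UpdtWgt}(\Pi_t,M,a),\ \{\langle C\setminus\{a\},\rho\uplus\mathrm{UpdtWgtCh}(\Pi_t,M,C,a)\rangle:\langle C,\rho\rangle\in\mathcal{C}\}\rangle:\langle M,\sigma,\mathcal{C}\rangle\in\tau'\big\}$; - remove rule $r$: $\tau_t=\big\{\langle M,\sigma_r^-,\{\langle C,\rho_r^-\rangle:\langle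 C,\rho\rangle\in\mathcal{C},\rho(r)=\infty\}\rangle:\langle M,\sigma,\mathcal{C}\rangle\in\tau',\ \sigma(r)=\infty\big\}$; - join: $\tau_t=\big\{\langle M,\ \sigma'\uplus\sigma'',\ \{\langle C,\rho'\uplus\rho''\rangle:\langle C,\rho'\rangle\in\mathcal{C}',\langle C,\rho''\rangle\in\mathcal{C}''\}\cup\{\langle M,\rho\uplus\sigma''\rangle:\langle M,\rho\rangle\in\mathcal{C}'\}\cup\{\langle M,\sigma'\uplus\rho\rangle:\langle M,\rho\rangle\in\mathcal{C}''\}\rangle:\langle M,\sigma',\mathcal{C}'\rangle\in\tau',\langle M,\sigma'',\mathcal{C}''\rangle\in\tau''\big\}$.
   Formalization: Rule-state counters are stored truncated (at bnd(r) for weight rules, at 1 for choice rules), as the bound fails with exact sums; the nice tree decomposition is given, of minimum width with at most c(k+1)‖I(Π)‖ nodes (shown to exist), and the O-constant depends on c. *)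

theory Defs
  imports Main "HOL-Library.Extended_Nat" "HOL-Library.Sublist" "HOL-Library.Monad_Syntax"
begin

section \<open>Programs\<close>

datatype 'a rule =
    is_Choice: Choice (heads: "'a set") (pos: "'a set") (neg: "'a set")
  | is_Disj: Disj (heads: "'a set") (pos: "'a set") (neg: "'a set")
  | is_Weight: Weight (heads: "'a set") (pos: "'a set") (neg: "'a set") (wmap: "'a \<Rightarrow> nat") (bnd: nat)

fun wght :: "'a rule \<Rightarrow> 'a \<Rightarrow> nat" where
  "wght (Weight H P N w b) a = w a"
| "wght _ a = 0"

definition wght_set :: "'a rule \<Rightarrow> 'a set \<Rightarrow> nat" where
  "wght_set r A = (\<Sum>a\<in>A. wght r a)"

definition at_rule :: "'a rule \<Rightarrow> 'a set" where
  "at_rule r = heads r \<union> pos r \<union> neg r"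

text \<open>The atoms listed in a rule are pairwise distinct, hence the disjointness conditions. The last
  condition makes the representation of a weight rule unique.\<close>

definition wf_rule :: "'a rule \<Rightarrow> bool" where
  "wf_rule r \<longleftrightarrow>
     finite (at_rule r) \<and>
     heads r \<inter> pos r = {} \<and> heads r \<inter> neg r = {} \<and> pos r \<inter> neg r = {} \<and>
     (is_Weight r \<longrightarrow> card (heads r) \<le> 1) \<and>
     (\<forall>a. a \<notin> pos r \<union> neg r \<longrightarrow> wght r a = 0)"

definition program :: "'a rule set \<Rightarrow> bool" where
  "program \<Pi> \<longleftrightarrow> finite \<Pi> \<and> (\<forall>r\<in>\<Pi>. wf_rule r)"

fun sat_rule :: "'a set \<Rightarrow> 'a rule \<Rightarrow> bool" where
  "sat_rule M (Choice H P N) \<longleftrightarrow> True"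
| "sat_rule M (Disj H P N) \<longleftrightarrow> (H \<union> N) \<inter> M \<noteq> {} \<or> \<not> P \<subseteq> M"
| "sat_rule M (Weight H P N w b) \<longleftrightarrow>
     H \<inter> M \<noteq> {} \<or> wght_set (Weight H P N w b) ((M \<inter> P) \<union> (N - M)) < b"

definition sat :: "'a set \<Rightarrow> 'a rule set \<Rightarrow> bool" where
  "sat M \<Pi> \<longleftrightarrow> (\<forall>r\<in>\<Pi>. sat_rule M r)"

text \<open>In the weight case the new bound may be negative in the mathematics. It is truncated to 0 here,
  which is equivalent: no sum of weights is below a bound that is at most 0.\<close>

fun reduct_rule :: "'a set \<Rightarrow> 'a rule \<Rightarrow> 'a rule set" where
  "reduct_rule M (Choice H P N) = {Disj {a} P {} | a. a \<in> H \<inter> M \<and> N \<inter> M = {}}"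
| "reduct_rule M (Disj H P N) = (if N \<inter> M = {} then {Disj H P {}} else {})"
| "reduct_rule M (Weight H P N w b) =
     {Weight H P {} (\<lambda>a. if a \<in> P then w a else 0)
        (b - wght_set (Weight H P N w b) (N - M))}"

definition reduct :: "'a rule set \<Rightarrow> 'a set \<Rightarrow> 'a rule set" where
  "reduct \<Pi> M = (\<Union>r\<in>\<Pi>. reduct_rule M r)"


section \<open>Graphs and tree decompositions\<close>

datatype 'a vertex = Atom 'a | Rule "'a rule"

type_synonym 'v graph = "'v set \<times> 'v set set"

definition incidence_graph :: "'a rule set \<Rightarrow> 'a vertex graph" where
  "incidence_graph \<Pi> =
     (Atom ` (\<Union>r\<in>\<Pi>. at_rule r) \<union> Rule ` \<Pi>,
      {{Atom a, Rule r} | a r. r \<in> \<Pi> \<and> a \<in> at_rule r})"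

definition graph_size :: "'v graph \<Rightarrow> nat" where
  "graph_size G = card (fst G) + card (snd G)"

datatype 'b rtree = Node (label: 'b) (children: "'b rtree list")

lemma size_nth_rtree [termination_simp]:
  "i < length ts \<Longrightarrow> size (ts ! i) \<le> Suc (size_list size ts)"
  "i < length ts \<Longrightarrow> size (ts ! i) < Suc (size_list size ts)"
  by (auto intro!: le_SucI le_imp_less_Suc intro: size_list_estimation'[OF nth_mem])

text \<open>The nodes of a rooted tree are addressed by the list of child indices leading to them from the
  root.\<close>

fun positions :: "'b rtree \<Rightarrow> nat list set" where
  "positions (Node b ts) = insert [] (\<Union>i\<in>{..<length ts}. (#) i ` positions (ts ! i))"

fun subtree_at :: "'b rtree \<Rightarrow> nat list \<Rightarrow> 'b rtree" where
  "subtree_at t [] = t"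
| "subtree_at t (i # p) = subtree_at (children t ! i) p"

abbreviation label_at :: "'b rtree \<Rightarrow> nat list \<Rightarrow> 'b" where
  "label_at t p \<equiv> label (subtree_at t p)"

text \<open>\<open>q\<close> lies on the path from \<open>p1\<close> to \<open>p3\<close>: it is an ancestor of one of the two end points and not
  above their lowest common ancestor (nodes being ancestors of themselves).\<close>

definition on_path :: "nat list \<Rightarrow> nat list \<Rightarrow> nat list \<Rightarrow> bool" where
  "on_path p1 q p3 \<longleftrightarrow> prefix (longest_common_prefix p1 p3) q \<and> (prefix q p1 \<or> prefix q p3)"

definition tree_decomposition :: "'v graph \<Rightarrow> 'v set rtree \<Rightarrow> bool" where
  "tree_decomposition G T \<longleftrightarrow>
     (\<forall>p\<in>positions T. label_at T p \<subseteq> fst G) \<and>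
     (\<forall>v\<in>fst G. \<exists>p\<in>positions T. v \<in> label_at T p) \<and>
     (\<forall>e\<in>snd G. \<exists>p\<in>positions T. e \<subseteq> label_at T p) \<and>
     (\<forall>p1\<in>positions T. \<forall>p2\<in>positions T. \<forall>p3\<in>positions T.
        on_path p1 p2 p3 \<longrightarrow> label_at T p1 \<inter> label_at T p3 \<subseteq> label_at T p2)"

text \<open>Natural-number subtraction: the width is only meaningful for graphs with at least one vertex.\<close>

definition width :: "'v set rtree \<Rightarrow> nat" where
  "width T = Max {card (label_at T p) | p. p \<in> positions T} - 1"

definition treewidth :: "'v graph \<Rightarrow> nat" where
  "treewidth G = (LEAST k. \<exists>T. tree_decomposition G T \<and> width T = k)"

fun nice_node :: "'v set rtree \<Rightarrow> bool" where
  "nice_node (Node b []) \<longleftrightarrow> b = {}"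
| "nice_node (Node b [u]) \<longleftrightarrow>
     (label u \<subseteq> b \<and> card b = card (label u) + 1) \<or>
     (b \<subseteq> label u \<and> card (label u) = card b + 1)"
| "nice_node (Node b [u, v]) \<longleftrightarrow> b = label u \<and> b = label v"
| "nice_node _ \<longleftrightarrow> False"

definition nice :: "'v set rtree \<Rightarrow> bool" where
  "nice T \<longleftrightarrow> label T = {} \<and> (\<forall>p\<in>positions T. nice_node (subtree_at T p))"

definition atoms_at :: "'a vertex set rtree \<Rightarrow> 'a set" where
  "atoms_at t = {a. Atom a \<in> label t}"

definition rules_at :: "'a vertex set rtree \<Rightarrow> 'a rule set" where
  "rules_at t = {r. Rule r \<in> label t}"

definition atoms_below :: "'a vertex set rtree \<Rightarrow> 'a set" where
  "atoms_below t = {a. \<exists>p\<in>positions t. Atom a \<in> label_at t p}"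


section \<open>Rule-states and state-programs\<close>

type_synonym 'a rule_state = "'a rule \<rightharpoonup> enat"

definition uplus :: "'a rule_state \<Rightarrow> 'a rule_state \<Rightarrow> 'a rule_state"  (infixl "\<uplus>" 65) where
  "\<sigma> \<uplus> \<rho> = (\<lambda>r. case \<sigma> r of
      None \<Rightarrow> \<rho> r
    | Some m \<Rightarrow> (case \<rho> r of None \<Rightarrow> Some m | Some n \<Rightarrow> Some (m + n)))"

definition SatRules :: "('a rule \<rightharpoonup> 'a rule set) \<Rightarrow> 'a set \<Rightarrow> 'a rule_state" where
  "SatRules R M = (\<lambda>r. case R r of None \<Rightarrow> None | Some P \<Rightarrow> if sat M P then Some \<infinity> else None)"

definition UpdtWgt :: "'a rule set \<Rightarrow> 'a set \<Rightarrow> 'a \<Rightarrow> 'a rule_state" where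
  "UpdtWgt \<Pi>t M a = (\<lambda>r.
     if r \<in> \<Pi>t \<and> is_Weight r
     then Some (enat (wght_set r ({a} \<inter> ((neg r - M) \<union> (pos r \<inter> M)))))
     else None)"

definition UpdtWgtCh :: "'a rule set \<Rightarrow> 'a set \<Rightarrow> 'a set \<Rightarrow> 'a \<Rightarrow> 'a rule_state" where
  "UpdtWgtCh \<Pi>t M C a = (\<lambda>r.
     if r \<in> \<Pi>t \<and> is_Weight r
     then Some (enat (wght_set r ({a} \<inter> ((neg r - M) \<union> (pos r \<inter> C)))))
     else if r \<in> \<Pi>t \<and> is_Choice r
     then Some (enat (card ({a} \<inter> heads r \<inter> (M - C))))
     else None)"

definition constraint_of :: "'a rule \<Rightarrow> 'a rule" where
  "constraint_of r = Disj {} (pos r) (neg r)"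

fun restrict_rule :: "'a set \<Rightarrow> 'a rule \<Rightarrow> 'a rule" where
  "restrict_rule X (Choice H P N) = Choice (H \<inter> X) (P \<inter> X) (N \<inter> X)"
| "restrict_rule X (Disj H P N) = Disj (H \<inter> X) (P \<inter> X) (N \<inter> X)"
| "restrict_rule X (Weight H P N w b) =
     Weight (H \<inter> X) (P \<inter> X) (N \<inter> X) (\<lambda>a. if a \<in> X then w a else 0) b"

fun set_bound :: "nat \<Rightarrow> 'a rule \<Rightarrow> 'a rule" where
  "set_bound b (Weight H P N w b') = Weight H P N w b"
| "set_bound b r = r"

definition counter :: "'a rule_state \<Rightarrow> 'a rule \<Rightarrow> nat" where
  "counter \<sigma> r = (case \<sigma> r of Some (enat n) \<Rightarrow> n | _ \<Rightarrow> 0)"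

text \<open>Truncated subtraction renders \<open>max {0, \<dots>}\<close>. The new bound refers to the original rule, before
  the restriction to the bag.\<close>

definition state_program :: "'a vertex set rtree \<Rightarrow> 'a rule_state \<Rightarrow> 'a rule set \<Rightarrow> 'a rule set" where
  "state_program t \<sigma> P =
     (\<lambda>r. set_bound (bnd r - counter \<sigma> r - wght_set r (at_rule r - atoms_below t))
            (restrict_rule (atoms_at t) r)) `
     {r \<in> P \<union> {constraint_of r | r. r \<in> P \<and> is_Choice r \<and> \<not> heads r \<subseteq> atoms_below t}.
        \<sigma> r \<noteq> Some \<infinity>}"

definition state_program_reduct ::
  "'a vertex set rtree \<Rightarrow> 'a rule_state \<Rightarrow> 'a set \<Rightarrow> 'a rule set \<Rightarrow> 'a rule set" where
  "state_program_reduct t \<rho> M P =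
     reduct
       (state_program t \<rho>
         (P \<union> {constraint_of r | r. r \<in> P \<and> is_Choice r \<and> (\<exists>n. \<rho> r = Some n \<and> n > 0)}))
       M"

definition rs_update ::
  "'a vertex set rtree \<Rightarrow> 'a rule_state \<Rightarrow> 'a set \<Rightarrow> 'a rule set \<Rightarrow> 'a rule_state" where
  "rs_update t \<sigma> M P =
     \<sigma> \<uplus> SatRules (\<lambda>r. if r \<in> P then Some (state_program t \<sigma> {r}) else None) M"

definition rs_update_reduct ::
  "'a vertex set rtree \<Rightarrow> 'a rule_state \<Rightarrow> 'a set \<Rightarrow> 'a set \<Rightarrow> 'a rule set \<Rightarrow> 'a rule_state" where
  "rs_update_reduct t \<rho> M C P =
     \<rho> \<uplus> SatRules (\<lambda>r. if r \<in> P then Some (state_program_reduct t \<rho> M {r}) else None) C"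


section \<open>The tables\<close>

type_synonym 'a row = "'a set \<times> 'a rule_state \<times> ('a set \<times> 'a rule_state) set"

definition intro_atom :: "'a vertex set rtree \<Rightarrow> 'a \<Rightarrow> 'a row set \<Rightarrow> 'a row set" where
  "intro_atom t a \<tau> = (\<Union>(M, \<sigma>, CC)\<in>\<tau>.
     {(insert a M,
       rs_update t \<sigma> (insert a M) (rules_at t),
       {(M, rs_update_reduct t \<sigma> (insert a M) M (rules_at t))} \<union>
       {(insert a C, rs_update_reduct t \<rho> (insert a M) (insert a C) (rules_at t)) | C \<rho>.
          (C, \<rho>) \<in> CC} \<union>
       {(C, rs_update_reduct t \<rho> (insert a M) C (rules_at t)) | C \<rho>. (C, \<rho>) \<in> CC}),
      (M,
       rs_update t \<sigma> M (rules_at t),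
       {(C, rs_update_reduct t \<rho> M C (rules_at t)) | C \<rho>. (C, \<rho>) \<in> CC})})"

definition intro_rule :: "'a vertex set rtree \<Rightarrow> 'a rule \<Rightarrow> 'a row set \<Rightarrow> 'a row set" where
  "intro_rule t r \<tau> =
     {(M,
       rs_update t (\<sigma>(r \<mapsto> 0)) M {r},
       {(C, rs_update_reduct t (\<rho>(r \<mapsto> 0)) M C {r}) | C \<rho>. (C, \<rho>) \<in> CC}) | M \<sigma> CC.
      (M, \<sigma>, CC) \<in> \<tau>}"

definition remove_atom :: "'a vertex set rtree \<Rightarrow> 'a \<Rightarrow> 'a row set \<Rightarrow> 'a row set" where
  "remove_atom t a \<tau> =
     {(M - {a},
       \<sigma> \<uplus> UpdtWgt (rules_at t) M a,
       {(C - {a}, \<rho> \<uplus> UpdtWgtCh (rules_at t) M C a) | C \<rho>. (C, \<rho>) \<in> CC}) | M \<sigma> CC.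
      (M, \<sigma>, CC) \<in> \<tau>}"

definition remove_rule :: "'a rule \<Rightarrow> 'a row set \<Rightarrow> 'a row set" where
  "remove_rule r \<tau> =
     {(M, \<sigma>(r := None), {(C, \<rho>(r := None)) | C \<rho>. (C, \<rho>) \<in> CC \<and> \<rho> r = Some \<infinity>}) | M \<sigma> CC.
      (M, \<sigma>, CC) \<in> \<tau> \<and> \<sigma> r = Some \<infinity>}"

definition join_tables :: "'a row set \<Rightarrow> 'a row set \<Rightarrow> 'a row set" where
  "join_tables \<tau>' \<tau>'' =
     {(M,
       \<sigma>' \<uplus> \<sigma>'',
       {(C, \<rho>' \<uplus> \<rho>'') | C \<rho>' \<rho>''. (C, \<rho>') \<in> CC' \<and> (C, \<rho>'') \<in> CC''} \<union>
       {(M, \<rho> \<uplus> \<sigma>'') | \<rho>. (M, \<rho>) \<in> CC'} \<union>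
       {(M, \<sigma>' \<uplus> \<rho>) | \<rho>. (M, \<rho>) \<in> CC''}) | M \<sigma>' CC' \<sigma>'' CC''.
      (M, \<sigma>', CC') \<in> \<tau>' \<and> (M, \<sigma>'', CC'') \<in> \<tau>''}"

text \<open>On nodes that do not occur in nice tree decompositions the table is empty by convention.\<close>

fun dp_table :: "'a vertex set rtree \<Rightarrow> 'a row set" where
  "dp_table (Node b []) = {({}, Map.empty, {})}"
| "dp_table (Node b [u]) =
     (if label u \<subset> b
      then (case the_elem (b - label u) of
              Atom a \<Rightarrow> intro_atom (Node b [u]) a (dp_table u)
            | Rule r \<Rightarrow> intro_rule (Node b [u]) r (dp_table u))
      else (case the_elem (label u - b) of
              Atom a \<Rightarrow> remove_atom (Node b [u]) a (dp_table u)
            | Rule r \<Rightarrow> remove_rule r (dp_table u)))"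
| "dp_table (Node b [u, v]) = join_tables (dp_table u) (dp_table v)"
| "dp_table _ = {}"

fun dp_tables :: "'a vertex set rtree \<Rightarrow> 'a row set rtree" where
  "dp_tables (Node b ts) = Node (dp_table (Node b ts)) (map dp_tables ts)"

text \<open>Nothing in the tables depends on the exact value of a finite counter once it has reached the
  bound of a weight rule (the bound of the state-program is then 0), or 1 in the case of a choice rule
  (only positivity is tested). Storing larger values would make the number of rows depend on the
  weights and on the size of the rules, so counters are stored truncated.\<close>

fun cap :: "'a rule \<Rightarrow> nat" where
  "cap (Weight H P N w b) = b"
| "cap (Choice H P N) = 1"
| "cap (Disj H P N) = 0"

fun trunc_val :: "'a rule \<Rightarrow> enat \<Rightarrow> enat" where
  "trunc_val r (enat n) = enat (min n (cap r))"
| "trunc_val r \<infinity> = \<infinity>"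

definition trunc_state :: "'a rule_state \<Rightarrow> 'a rule_state" where
  "trunc_state \<sigma> = (\<lambda>r. map_option (trunc_val r) (\<sigma> r))"

definition trunc_row :: "'a row \<Rightarrow> 'a row" where
  "trunc_row = (\<lambda>(M, \<sigma>, CC). (M, trunc_state \<sigma>, (\<lambda>(C, \<rho>). (C, trunc_state \<rho>)) ` CC))"


section \<open>Computations with a step count\<close>

text \<open>A uniform-cost random access machine. One step is charged for each elementary operation
  (\<open>prim\<close>) and each unfolding of a list recursion. Elementary operations are: arithmetic and
  comparison of numbers, comparison of two atoms, rules or vertices (these are identifiers, as is the
  constraint \<open>constraint_of r\<close> belonging to a rule \<open>r\<close>), access to the input (kind and bound of
  a rule, the test whether an atom occurs in the head or in the body of a rule, the weight of
  an atom in a rule), building a pair or a cons cell, or a bounded combination of these.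
  Sets and rule-states are stored as lists without any indexing and are processed by linear
  search.\<close>

datatype 'x timed = Timed (val: 'x) (steps: nat)

definition ret :: "'x \<Rightarrow> 'x timed" where
  "ret x = Timed x 0"

definition bind_timed :: "'x timed \<Rightarrow> ('x \<Rightarrow> 'y timed) \<Rightarrow> 'y timed" where
  "bind_timed m f = Timed (val (f (val m))) (steps m + steps (f (val m)))"

adhoc_overloading Monad_Syntax.bind \<rightleftharpoons> bind_timed

definition step :: "'x timed \<Rightarrow> 'x timed" where
  "step m = Timed (val m) (Suc (steps m))"

definition prim :: "'x \<Rightarrow> 'x timed" where
  "prim x = step (ret x)"

fun map_t :: "('x \<Rightarrow> 'y timed) \<Rightarrow> 'x list \<Rightarrow> 'y list timed" where
  "map_t f [] = prim []"
| "map_t f (x # xs) = step (do { y \<leftarrow> f x; ys \<leftarrow> map_t f xs; ret (y # ys) })"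

fun filter_t :: "('x \<Rightarrow> bool timed) \<Rightarrow> 'x list \<Rightarrow> 'x list timed" where
  "filter_t f [] = prim []"
| "filter_t f (x # xs) =
     step (do { b \<leftarrow> f x; ys \<leftarrow> filter_t f xs; ret (if b then x # ys else ys) })"

fun append_t :: "'x list \<Rightarrow> 'x list \<Rightarrow> 'x list timed" where
  "append_t [] ys = prim ys"
| "append_t (x # xs) ys = step (do { zs \<leftarrow> append_t xs ys; ret (x # zs) })"

fun concat_t :: "'x list list \<Rightarrow> 'x list timed" where
  "concat_t [] = prim []"
| "concat_t (xs # xss) = step (do { ys \<leftarrow> concat_t xss; append_t xs ys })"

fun sum_t :: "('x \<Rightarrow> nat timed) \<Rightarrow> 'x list \<Rightarrow> nat timed" where
  "sum_t f [] = prim 0"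
| "sum_t f (x # xs) = step (do { m \<leftarrow> f x; n \<leftarrow> sum_t f xs; ret (m + n) })"

fun any_t :: "('x \<Rightarrow> bool timed) \<Rightarrow> 'x list \<Rightarrow> bool timed" where
  "any_t f [] = prim False"
| "any_t f (x # xs) = step (do { b \<leftarrow> f x; if b then ret True else any_t f xs })"

fun all_t :: "('x \<Rightarrow> bool timed) \<Rightarrow> 'x list \<Rightarrow> bool timed" where
  "all_t f [] = prim True"
| "all_t f (x # xs) = step (do { b \<leftarrow> f x; if b then all_t f xs else ret False })"

fun lookup_t :: "('k \<times> 'v) list \<Rightarrow> 'k \<Rightarrow> 'v option timed" where
  "lookup_t [] k = prim None"
| "lookup_t (x # xs) k = step (if fst x = k then ret (Some (snd x)) else lookup_t xs k)"

fun nub_t :: "('x \<Rightarrow> 'x \<Rightarrow> bool timed) \<Rightarrow> 'x list \<Rightarrow> 'x list timed" where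
  "nub_t eq [] = prim []"
| "nub_t eq (x # xs) =
     step (do { ys \<leftarrow> nub_t eq xs; b \<leftarrow> any_t (eq x) ys; ret (if b then ys else x # ys) })"

definition mem_t :: "'x \<Rightarrow> 'x list \<Rightarrow> bool timed" where
  "mem_t x ys = any_t (\<lambda>y. prim (x = y)) ys"

definition diff_t :: "'x list \<Rightarrow> 'x list \<Rightarrow> 'x list timed" where
  "diff_t xs ys = filter_t (\<lambda>x. do { b \<leftarrow> mem_t x ys; prim (\<not> b) }) xs"

definition set_eq_t :: "('x \<Rightarrow> 'x \<Rightarrow> bool timed) \<Rightarrow> 'x list \<Rightarrow> 'x list \<Rightarrow> bool timed" where
  "set_eq_t eq xs ys = do {
     b \<leftarrow> all_t (\<lambda>x. any_t (eq x) ys) xs;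
     c \<leftarrow> all_t (\<lambda>y. any_t (eq y) xs) ys;
     prim (b \<and> c) }"


section \<open>The algorithm\<close>

type_synonym 'a state_list = "('a rule \<times> enat) list"
type_synonym 'a cand_list = "('a list \<times> 'a state_list) list"
type_synonym 'a row_list = "('a list \<times> 'a state_list \<times> 'a cand_list) list"

text \<open>For each rule \<open>r\<close> of the bag of \<open>t\<close>: the weight of the atoms, and the number of the head atoms,
  of \<open>r\<close> that belong to \<open>atoms_below t\<close>. Maintained along the traversal; recomputing them at every
  node would require a scan of \<open>r\<close>.\<close>

type_synonym 'a seen = "('a rule \<times> nat \<times> nat) list"

definition atoms_eq_t :: "'a list \<Rightarrow> 'a list \<Rightarrow> bool timed" where
  "atoms_eq_t = set_eq_t (\<lambda>x y. prim (x = y))"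

definition state_eq_t :: "'a state_list \<Rightarrow> 'a state_list \<Rightarrow> bool timed" where
  "state_eq_t = set_eq_t (\<lambda>x y. prim (x = y))"

definition cand_eq_t :: "'a list \<times> 'a state_list \<Rightarrow> 'a list \<times> 'a state_list \<Rightarrow> bool timed" where
  "cand_eq_t = (\<lambda>(C, \<rho>) (C', \<rho>'). do {
     b \<leftarrow> atoms_eq_t C C';
     c \<leftarrow> state_eq_t \<rho> \<rho>';
     prim (b \<and> c) })"

definition row_eq_t ::
  "'a list \<times> 'a state_list \<times> 'a cand_list \<Rightarrow> 'a list \<times> 'a state_list \<times> 'a cand_list \<Rightarrow> bool timed" where
  "row_eq_t = (\<lambda>(M, \<sigma>, cs) (M', \<sigma>', cs'). do {
     b \<leftarrow> atoms_eq_t M M';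
     c \<leftarrow> state_eq_t \<sigma> \<sigma>';
     d \<leftarrow> set_eq_t cand_eq_t cs cs';
     prim (b \<and> c \<and> d) })"

fun split_bag_t :: "'a vertex list \<Rightarrow> ('a list \<times> 'a rule list) timed" where
  "split_bag_t [] = prim ([], [])"
| "split_bag_t (v # vs) = step (do {
     (X, R) \<leftarrow> split_bag_t vs;
     ret (case v of Atom a \<Rightarrow> (a # X, R) | Rule r \<Rightarrow> (X, r # R)) })"

text \<open>Preprocessing: the total weight and the number of head atoms of every rule are computed by one
  scan of each rule and written to an array.\<close>

type_synonym 'a totals = "'a rule \<Rightarrow> nat \<times> nat"

definition totals_t :: "'a rule set \<Rightarrow> 'a totals timed" where
  "totals_t \<Pi> = Timed (\<lambda>r. (wght_set r (at_rule r), card (heads r)))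
                      (\<Sum>r\<in>\<Pi>. Suc (card (at_rule r)))"

definition unseen_t :: "'a totals \<Rightarrow> 'a seen \<Rightarrow> 'a rule \<Rightarrow> (nat \<times> nat) timed" where
  "unseen_t tot seen r = do {
     e \<leftarrow> lookup_t seen r;
     prim (case e of None \<Rightarrow> tot r | Some (w, h) \<Rightarrow> (fst (tot r) - w, snd (tot r) - h)) }"

text \<open>With \<open>X\<close> the atoms of the bag: whether \<open>S\<close> and \<open>M\<close>, respectively \<open>S\<close> and the complement of
  \<open>M\<close>, meet inside \<open>X\<close>, and the weight of the atoms in these intersections.\<close>

definition hit_t :: "'a set \<Rightarrow> 'a list \<Rightarrow> 'a list \<Rightarrow> bool timed" where
  "hit_t S X M = any_t (\<lambda>a. do { b \<leftarrow> mem_t a M; prim (a \<in> S \<and> b) }) X"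

definition miss_t :: "'a set \<Rightarrow> 'a list \<Rightarrow> 'a list \<Rightarrow> bool timed" where
  "miss_t S X M = any_t (\<lambda>a. do { b \<leftarrow> mem_t a M; prim (a \<in> S \<and> \<not> b) }) X"

definition weigh_in_t :: "('a \<Rightarrow> nat) \<Rightarrow> 'a set \<Rightarrow> 'a list \<Rightarrow> 'a list \<Rightarrow> nat timed" where
  "weigh_in_t w S X M =
     sum_t (\<lambda>a. do { b \<leftarrow> mem_t a M; prim (if a \<in> S \<and> b then w a else 0) }) X"

definition weigh_out_t :: "('a \<Rightarrow> nat) \<Rightarrow> 'a set \<Rightarrow> 'a list \<Rightarrow> 'a list \<Rightarrow> nat timed" where
  "weigh_out_t w S X M =
     sum_t (\<lambda>a. do { b \<leftarrow> mem_t a M; prim (if a \<in> S \<and> \<not> b then w a else 0) }) X"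

definition counter_t :: "'a state_list \<Rightarrow> 'a rule \<Rightarrow> nat timed" where
  "counter_t \<sigma> r = do {
     v \<leftarrow> lookup_t \<sigma> r;
     prim (case v of Some (enat n) \<Rightarrow> n | _ \<Rightarrow> 0) }"

text \<open>Decide \<open>sat M (state_program t \<sigma> {r})\<close> and \<open>sat C (state_program_reduct t \<rho> M {r})\<close> for a rule
  whose value is not \<open>\<infinity>\<close>; otherwise the outcome is irrelevant, as the value remains \<open>\<infinity>\<close> anyway.\<close>

fun sat_state_t ::
  "'a totals \<Rightarrow> 'a seen \<Rightarrow> 'a list \<Rightarrow> 'a state_list \<Rightarrow> 'a list \<Rightarrow> 'a rule \<Rightarrow> bool timed" where
  "sat_state_t tot seen X \<sigma> M (Choice H P N) = do {
     (w, h) \<leftarrow> unseen_t tot seen (Choice H P N);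
     c \<leftarrow> lookup_t \<sigma> (constraint_of (Choice H P N));
     n \<leftarrow> hit_t N X M;
     p \<leftarrow> miss_t P X M;
     prim (h = 0 \<or> c = Some \<infinity> \<or> n \<or> p) }"
| "sat_state_t tot seen X \<sigma> M (Disj H P N) = do {
     h \<leftarrow> hit_t H X M;
     n \<leftarrow> hit_t N X M;
     p \<leftarrow> miss_t P X M;
     prim (h \<or> n \<or> p) }"
| "sat_state_t tot seen X \<sigma> M (Weight H P N wt b) = do {
     (w, _) \<leftarrow> unseen_t tot seen (Weight H P N wt b);
     k \<leftarrow> counter_t \<sigma> (Weight H P N wt b);
     h \<leftarrow> hit_t H X M;
     p \<leftarrow> weigh_in_t wt P X M;
     n \<leftarrow> weigh_out_t wt N X M;
     prim (h \<or> p + n < b - k - w) }"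

fun sat_reduct_t ::
  "'a totals \<Rightarrow> 'a seen \<Rightarrow> 'a list \<Rightarrow> 'a state_list \<Rightarrow> 'a list \<Rightarrow> 'a list \<Rightarrow> 'a rule \<Rightarrow> bool timed" where
  "sat_reduct_t tot seen X \<rho> M C (Choice H P N) = do {
     (w, h) \<leftarrow> unseen_t tot seen (Choice H P N);
     k \<leftarrow> counter_t \<rho> (Choice H P N);
     c \<leftarrow> lookup_t \<rho> (constraint_of (Choice H P N));
     n \<leftarrow> hit_t N X M;
     p \<leftarrow> miss_t P X C;
     MC \<leftarrow> diff_t M C;
     d \<leftarrow> hit_t H X MC;
     prim (n \<or> p \<or> \<not> d \<and> (h = 0 \<and> k = 0 \<or> c = Some \<infinity>)) }"
| "sat_reduct_t tot seen X \<rho> M C (Disj H P N) = do {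
     h \<leftarrow> hit_t H X C;
     n \<leftarrow> hit_t N X M;
     p \<leftarrow> miss_t P X C;
     prim (h \<or> n \<or> p) }"
| "sat_reduct_t tot seen X \<rho> M C (Weight H P N wt b) = do {
     (w, _) \<leftarrow> unseen_t tot seen (Weight H P N wt b);
     k \<leftarrow> counter_t \<rho> (Weight H P N wt b);
     h \<leftarrow> hit_t H X C;
     p \<leftarrow> weigh_in_t wt P X C;
     n \<leftarrow> weigh_out_t wt N X M;
     prim (h \<or> p + n < b - k - w) }"

definition mark_t :: "('a rule \<Rightarrow> bool timed) \<Rightarrow> 'a rule list \<Rightarrow> 'a state_list \<Rightarrow> 'a state_list timed" where
  "mark_t f R \<sigma> = map_t (\<lambda>(r, v). do {
     i \<leftarrow> mem_t r R;
     if i then do { b \<leftarrow> f r; prim (r, if b then \<infinity> else v) } else prim (r, v) }) \<sigma>"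

definition rs_update_t ::
  "'a totals \<Rightarrow> 'a seen \<Rightarrow> 'a list \<Rightarrow> 'a state_list \<Rightarrow> 'a list \<Rightarrow> 'a rule list \<Rightarrow> 'a state_list timed" where
  "rs_update_t tot seen X \<sigma> M R = mark_t (sat_state_t tot seen X \<sigma> M) R \<sigma>"

definition rs_update_reduct_t ::
  "'a totals \<Rightarrow> 'a seen \<Rightarrow> 'a list \<Rightarrow> 'a state_list \<Rightarrow> 'a list \<Rightarrow> 'a list \<Rightarrow> 'a rule list
     \<Rightarrow> 'a state_list timed" where
  "rs_update_reduct_t tot seen X \<rho> M C R = mark_t (sat_reduct_t tot seen X \<rho> M C) R \<rho>"

definition uplus_t :: "'a state_list \<Rightarrow> 'a state_list \<Rightarrow> 'a state_list timed" where
  "uplus_t \<sigma> \<rho> = do {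
     xs \<leftarrow> map_t (\<lambda>(r, v). do {
       u \<leftarrow> lookup_t \<rho> r;
       prim (r, case u of None \<Rightarrow> v | Some u \<Rightarrow> trunc_val r (v + u)) }) \<sigma>;
     ys \<leftarrow> filter_t (\<lambda>(r, v). do { u \<leftarrow> lookup_t \<sigma> r; prim (u = None) }) \<rho>;
     append_t xs ys }"

text \<open>The value of \<open>UpdtWgtCh\<close>, and of \<open>UpdtWgt\<close> in case \<open>inM = inC\<close>, where the two arguments say
  whether \<open>a\<close> belongs to the respective set of atoms.\<close>

fun contribution :: "'a \<Rightarrow> bool \<Rightarrow> bool \<Rightarrow> 'a rule \<Rightarrow> nat" where
  "contribution a inM inC (Weight H P N w b) =
     (if a \<in> N \<and> \<not> inM \<or> a \<in> P \<and> inC then w a else 0)"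
| "contribution a inM inC (Choice H P N) = (if a \<in> H \<and> inM \<and> \<not> inC then 1 else 0)"
| "contribution a inM inC (Disj H P N) = 0"

definition updt_t :: "'a \<Rightarrow> 'a list \<Rightarrow> 'a list \<Rightarrow> 'a state_list \<Rightarrow> 'a state_list timed" where
  "updt_t a M C \<sigma> = do {
     m \<leftarrow> mem_t a M;
     c \<leftarrow> mem_t a C;
     map_t (\<lambda>(r, v). prim (r, trunc_val r (v + enat (contribution a m c r)))) \<sigma> }"

definition delete_t :: "'x \<Rightarrow> 'x list \<Rightarrow> 'x list timed" where
  "delete_t x xs = filter_t (\<lambda>y. prim (y \<noteq> x)) xs"

definition delete_key_t :: "'k \<Rightarrow> ('k \<times> 'v) list \<Rightarrow> ('k \<times> 'v) list timed" where
  "delete_key_t k xs = filter_t (\<lambda>y. prim (fst y \<noteq> k)) xs"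

definition bag_weight_t :: "'a list \<Rightarrow> 'a rule \<Rightarrow> (nat \<times> nat) timed" where
  "bag_weight_t X r = do {
     w \<leftarrow> sum_t (\<lambda>a. prim (wght r a)) X;
     h \<leftarrow> sum_t (\<lambda>a. prim (if a \<in> heads r then 1 else 0)) X;
     prim (w, h) }"

definition intro_atom_t ::
  "'a totals \<Rightarrow> 'a list \<Rightarrow> 'a rule list \<Rightarrow> 'a \<Rightarrow> 'a seen \<times> 'a row_list
     \<Rightarrow> ('a seen \<times> 'a row_list) timed" where
  "intro_atom_t tot X R a = (\<lambda>(seen, \<tau>). do {
     seen \<leftarrow> map_t (\<lambda>(r, w, h).
       prim (r, w + wght r a, h + (if a \<in> heads r then 1 else 0))) seen;
     rss \<leftarrow> map_t (\<lambda>(M, \<sigma>, cs). do {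
       \<sigma>1 \<leftarrow> rs_update_t tot seen X \<sigma> (a # M) R;
       \<rho>0 \<leftarrow> rs_update_reduct_t tot seen X \<sigma> (a # M) M R;
       cs1 \<leftarrow> map_t (\<lambda>(C, \<rho>). do {
         \<rho> \<leftarrow> rs_update_reduct_t tot seen X \<rho> (a # M) (a # C) R;
         prim (a # C, \<rho>) }) cs;
       cs2 \<leftarrow> map_t (\<lambda>(C, \<rho>). do {
         \<rho> \<leftarrow> rs_update_reduct_t tot seen X \<rho> (a # M) C R;
         prim (C, \<rho>) }) cs;
       cs12 \<leftarrow> append_t cs1 cs2;
       cs3 \<leftarrow> nub_t cand_eq_t ((M, \<rho>0) # cs12);
       \<sigma>2 \<leftarrow> rs_update_t tot seen X \<sigma> M R;
       cs4 \<leftarrow> map_t (\<lambda>(C, \<rho>). do {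
         \<rho> \<leftarrow> rs_update_reduct_t tot seen X \<rho> M C R;
         prim (C, \<rho>) }) cs;
       cs5 \<leftarrow> nub_t cand_eq_t cs4;
       prim [(a # M, \<sigma>1, cs3), (M, \<sigma>2, cs5)] }) \<tau>;
     rs \<leftarrow> concat_t rss;
     rs \<leftarrow> nub_t row_eq_t rs;
     prim (seen, rs) })"

definition intro_rule_t ::
  "'a totals \<Rightarrow> 'a list \<Rightarrow> 'a rule \<Rightarrow> 'a seen \<times> 'a row_list \<Rightarrow> ('a seen \<times> 'a row_list) timed" where
  "intro_rule_t tot X r = (\<lambda>(seen, \<tau>). do {
     wh \<leftarrow> bag_weight_t X r;
     seen \<leftarrow> prim ((r, wh) # seen);
     rs \<leftarrow> map_t (\<lambda>(M, \<sigma>, cs). do {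
       \<sigma> \<leftarrow> rs_update_t tot seen X ((r, 0) # \<sigma>) M [r];
       cs \<leftarrow> map_t (\<lambda>(C, \<rho>). do {
         \<rho> \<leftarrow> rs_update_reduct_t tot seen X ((r, 0) # \<rho>) M C [r];
         prim (C, \<rho>) }) cs;
       cs \<leftarrow> nub_t cand_eq_t cs;
       prim (M, \<sigma>, cs) }) \<tau>;
     rs \<leftarrow> nub_t row_eq_t rs;
     prim (seen, rs) })"

definition remove_atom_t ::
  "'a \<Rightarrow> 'a seen \<times> 'a row_list \<Rightarrow> ('a seen \<times> 'a row_list) timed" where
  "remove_atom_t a = (\<lambda>(seen, \<tau>). do {
     rs \<leftarrow> map_t (\<lambda>(M, \<sigma>, cs). do {
       M' \<leftarrow> delete_t a M;
       \<sigma> \<leftarrow> updt_t a M M \<sigma>;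
       cs \<leftarrow> map_t (\<lambda>(C, \<rho>). do {
         C' \<leftarrow> delete_t a C;
         \<rho> \<leftarrow> updt_t a M C \<rho>;
         prim (C', \<rho>) }) cs;
       cs \<leftarrow> nub_t cand_eq_t cs;
       prim (M', \<sigma>, cs) }) \<tau>;
     rs \<leftarrow> nub_t row_eq_t rs;
     prim (seen, rs) })"

definition remove_rule_t ::
  "'a rule \<Rightarrow> 'a seen \<times> 'a row_list \<Rightarrow> ('a seen \<times> 'a row_list) timed" where
  "remove_rule_t r = (\<lambda>(seen, \<tau>). do {
     seen \<leftarrow> delete_key_t r seen;
     \<tau> \<leftarrow> filter_t (\<lambda>(M, \<sigma>, cs). do { v \<leftarrow> lookup_t \<sigma> r; prim (v = Some \<infinity>) }) \<tau>;
     rs \<leftarrow> map_t (\<lambda>(M, \<sigma>, cs). do {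
       \<sigma> \<leftarrow> delete_key_t r \<sigma>;
       cs \<leftarrow> filter_t (\<lambda>(C, \<rho>). do { v \<leftarrow> lookup_t \<rho> r; prim (v = Some \<infinity>) }) cs;
       cs \<leftarrow> map_t (\<lambda>(C, \<rho>). do { \<rho> \<leftarrow> delete_key_t r \<rho>; prim (C, \<rho>) }) cs;
       cs \<leftarrow> nub_t cand_eq_t cs;
       prim (M, \<sigma>, cs) }) \<tau>;
     rs \<leftarrow> nub_t row_eq_t rs;
     prim (seen, rs) })"

definition join_cands_t ::
  "'a list \<Rightarrow> 'a state_list \<Rightarrow> 'a cand_list \<Rightarrow> 'a state_list \<Rightarrow> 'a cand_list \<Rightarrow> 'a cand_list timed" where
  "join_cands_t M \<sigma>' cs' \<sigma>'' cs'' = do {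
     css1 \<leftarrow> map_t (\<lambda>(C', \<rho>'). do {
       css \<leftarrow> map_t (\<lambda>(C'', \<rho>''). do {
         b \<leftarrow> atoms_eq_t C' C'';
         if b then do { \<rho> \<leftarrow> uplus_t \<rho>' \<rho>''; prim [(C', \<rho>)] } else prim [] }) cs'';
       concat_t css }) cs';
     cs1 \<leftarrow> concat_t css1;
     css2 \<leftarrow> map_t (\<lambda>(C, \<rho>). do {
       b \<leftarrow> atoms_eq_t C M;
       if b then do { \<rho> \<leftarrow> uplus_t \<rho> \<sigma>''; prim [(M, \<rho>)] } else prim [] }) cs';
     cs2 \<leftarrow> concat_t css2;
     css3 \<leftarrow> map_t (\<lambda>(C, \<rho>). do {
       b \<leftarrow> atoms_eq_t C M;
       if b then do { \<rho> \<leftarrow> uplus_t \<sigma>' \<rho>; prim [(M, \<rho>)] } else prim [] }) cs'';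
     cs3 \<leftarrow> concat_t css3;
     cs \<leftarrow> concat_t [cs1, cs2, cs3];
     nub_t cand_eq_t cs }"

definition join_t ::
  "'a list \<Rightarrow> 'a seen \<times> 'a row_list \<Rightarrow> 'a seen \<times> 'a row_list \<Rightarrow> ('a seen \<times> 'a row_list) timed" where
  "join_t X = (\<lambda>(seen', \<tau>') (seen'', \<tau>''). do {
     seen \<leftarrow> map_t (\<lambda>(r, w', h'). do {
       e \<leftarrow> lookup_t seen'' r;
       (w, h) \<leftarrow> bag_weight_t X r;
       prim (case e of None \<Rightarrow> (r, w', h') | Some (w'', h'') \<Rightarrow> (r, w' + w'' - w, h' + h'' - h)) }) seen';
     rss \<leftarrow> map_t (\<lambda>(M', \<sigma>', cs'). do {
       rss \<leftarrow> map_t (\<lambda>(M'', \<sigma>'', cs''). do {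
         b \<leftarrow> atoms_eq_t M' M'';
         if b then do {
           \<sigma> \<leftarrow> uplus_t \<sigma>' \<sigma>'';
           cs \<leftarrow> join_cands_t M' \<sigma>' cs' \<sigma>'' cs'';
           prim [(M', \<sigma>, cs)] }
         else prim [] }) \<tau>'';
       concat_t rss }) \<tau>';
     rs \<leftarrow> concat_t rss;
     rs \<leftarrow> nub_t row_eq_t rs;
     prim (seen, rs) })"

fun dp_run :: "'a totals \<Rightarrow> 'a vertex list rtree \<Rightarrow> ('a seen \<times> 'a row_list) rtree timed" where
  "dp_run tot (Node b []) = prim (Node ([], [([], [], [])]) [])"
| "dp_run tot (Node b [u]) = do {
     S \<leftarrow> dp_run tot u;
     (X, R) \<leftarrow> split_bag_t b;
     new \<leftarrow> diff_t b (label u);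
     old \<leftarrow> diff_t (label u) b;
     s \<leftarrow> (case new of
              Atom a # _ \<Rightarrow> intro_atom_t tot X R a (label S)
            | Rule r # _ \<Rightarrow> intro_rule_t tot X r (label S)
            | [] \<Rightarrow> (case old of
                Atom a # _ \<Rightarrow> remove_atom_t a (label S)
              | Rule r # _ \<Rightarrow> remove_rule_t r (label S)
              | [] \<Rightarrow> ret (label S)));
     prim (Node s [S]) }"
| "dp_run tot (Node b [u, v]) = do {
     S' \<leftarrow> dp_run tot u;
     S'' \<leftarrow> dp_run tot v;
     (X, R) \<leftarrow> split_bag_t b;
     s \<leftarrow> join_t X (label S') (label S'');
     prim (Node s [S', S'']) }"
| "dp_run tot (Node b ts) = prim (Node ([], []) [])"

definition dp_inc :: "'a rule set \<Rightarrow> 'a vertex list rtree \<Rightarrow> ('a seen \<times> 'a row_list) rtree timed" where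
  "dp_inc \<Pi> T = do { tot \<leftarrow> totals_t \<Pi>; dp_run tot T }"

definition row_of :: "'a list \<times> 'a state_list \<times> 'a cand_list \<Rightarrow> 'a row" where
  "row_of = (\<lambda>(M, \<sigma>, cs). (set M, map_of \<sigma>, (\<lambda>(C, \<rho>). (set C, map_of \<rho>)) ` set cs))"

definition computed_tables :: "('a seen \<times> 'a row_list) rtree \<Rightarrow> 'a row set rtree" where
  "computed_tables = map_rtree (\<lambda>(seen, \<tau>). row_of ` set \<tau>)"


section \<open>Parameters of the running time\<close>

definition max_bound :: "'a rule set \<Rightarrow> nat" where
  "max_bound \<Pi> = Max ({3} \<union> {bnd r | r. r \<in> \<Pi> \<and> is_Weight r})"

text \<open>An input tree for the algorithm: a nice tree decomposition of the incidence graph of minimum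
  width, with bags given as lists.\<close>

definition optimal_nice_td :: "'a rule set \<Rightarrow> 'a vertex list rtree \<Rightarrow> bool" where
  "optimal_nice_td \<Pi> T \<longleftrightarrow>
     (\<forall>p\<in>positions T. distinct (label_at T p)) \<and>
     tree_decomposition (incidence_graph \<Pi>) (map_rtree set T) \<and>
     nice (map_rtree set T) \<and>
     width (map_rtree set T) = treewidth (incidence_graph \<Pi>)"

end

(*
  A small nice tree decomposition is obtained from an optimal one by recursion on the tree: a subtree
  without vertices outside the parent bag is dropped, any other subtree is connected to its parent by
  a chain of removal and introduce nodes, and siblings are merged by join nodes. Every kept subtree
  removes a vertex that is removed nowhere else, which pays for O(k) nodes.

  Every test made by the algorithm depends on a finite counter only through its truncation, and
  truncation commutes with all operations on rule-states. Hence each computed table is the truncation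
  of the corresponding mathematical table.

  With n = k + 1, a truncated rule-state has at most l + 2 values for each rule of the bag, so that a
  row has at most S = (l + 2)^n candidates and a table at most S * 2^S rows. A join node compares
  pairs of rows with the rows already found, which costs 2^(3 S) times a polynomial in S. This is
  O(2^(2 (2 l)^n)): for large n or l the exponent 2 (2 l)^n exceeds 3 S by a constant fraction of S,
  and the finitely many exceptions are absorbed by the constant factor.
*)

theory Submission
  imports Defs
begin

section \<open>Tree decompositions by structural recursion\<close>

text \<open>The exponent leaves little room. With \<open>S = (l + 2)^n\<close> it is
  \<open>3 * S\<close> that must fit under \<open>2 * (2 * l)^n\<close>. The ratio
  \<open>(l + 2) / (2 * l)\<close> is at most 5/6 precisely for \<open>l >= 3\<close>, while for
  \<open>l = 2\<close> it is 1 and no growth of \<open>n\<close> would help: this is the role of the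
  3 in \<open>max_bound\<close>. The 3 in \<open>3 * S\<close> is also as large as it may be. A join
  produces up to \<open>N^2\<close> rows, and only because each is compared with the at most
  \<open>N\<close> distinct rows kept so far is the cost \<open>N^3\<close> and not
  \<open>N^4\<close>. A second obstacle is that a rule may be far larger than a bag, so no node may
  scan it. When a rule is introduced, the weight of its atoms below the node is read off the bag
  alone. This is correct because every edge between an atom and a rule is covered, so no atom of the
  rule can have been removed before; hence the edge condition in \<open>good\<close>. The factor
  \<open>k + 1\<close> in the number of nodes is absorbed together with the polynomial in
  \<open>S\<close>. The two halves of the theorem meet at \<open>c = 13\<close>: the first provides
  inputs to which the second applies.\<close>

fun verts :: "'v set rtree \<Rightarrow> 'v set" where
  "verts (Node b ts) = b \<union> (\<Union>t\<in>set ts. verts t)"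

text \<open>The connectedness condition in a form that recurses. A vertex of the root bag that
  occurs in a child's subtree must be in the child's own bag, and whatever two siblings share must
  pass through the bag between them. \<open>conn_positions\<close> shows that this is the condition
  on paths.\<close>

fun conn :: "'v set rtree \<Rightarrow> bool" where
  "conn (Node b ts) \<longleftrightarrow>
     (\<forall>t\<in>set ts. conn t \<and> verts t \<inter> b \<subseteq> label t) \<and>
     (\<forall>i<length ts. \<forall>j<length ts. i \<noteq> j \<longrightarrow> verts (ts ! i) \<inter> verts (ts ! j) \<subseteq> b)"

text \<open>The predicate takes subtrees, not bags, because niceness of a node also depends on the
  bags of its children.\<close>

fun all_nodes :: "('b rtree \<Rightarrow> bool) \<Rightarrow> 'b rtree \<Rightarrow> bool" where
  "all_nodes Q (Node b ts) \<longleftrightarrow> Q (Node b ts) \<and> (\<forall>t\<in>set ts. all_nodes Q t)"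

fun nodes :: "'b rtree \<Rightarrow> nat" where
  "nodes (Node b ts) = Suc (\<Sum>t\<leftarrow>ts. nodes t)"

text \<open>Expressed through \<open>all_nodes\<close> so that \<open>all_nodes_positions\<close>
  translates it; \<open>covers_Node\<close> is the recursive equation used afterwards.\<close>

definition covers :: "'v set rtree \<Rightarrow> 'v set \<Rightarrow> bool" where
  "covers t e \<longleftrightarrow> \<not> all_nodes (\<lambda>s. \<not> e \<subseteq> label s) t"

lemma covers_Node: "covers (Node b ts) e \<longleftrightarrow> e \<subseteq> b \<or> (\<exists>t\<in>set ts. covers t e)"
  by (auto simp: covers_def)

lemma covers_verts: "covers t e \<Longrightarrow> e \<subseteq> verts t"
  by (induction t) (auto simp: covers_Node)

lemma label_verts: "label t \<subseteq> verts t"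
  by (cases t) auto

lemma ball_positions_Node:
  "(\<forall>p\<in>positions (Node b ts). Q p) \<longleftrightarrow> Q [] \<and> (\<forall>i<length ts. \<forall>p\<in>positions (ts ! i). Q (i # p))"
  by auto

text \<open>The bridge between addresses, in which decompositions are defined, and structural
  induction, in which everything below is proved.\<close>

lemma all_nodes_positions: "(\<forall>p\<in>positions t. Q (subtree_at t p)) \<longleftrightarrow> all_nodes Q t"
proof (induction t)
  case (Node b ts)
  show ?case
    unfolding ball_positions_Node using Node by (auto simp: all_set_conv_all_nth)
qed

lemma all_nodes_mono: "all_nodes Q t \<Longrightarrow> (\<And>s. Q s \<Longrightarrow> Q' s) \<Longrightarrow> all_nodes Q' t"
  by (induction t) auto

lemma all_nodes_conj: "all_nodes (\<lambda>s. Q s \<and> Q' s) t \<longleftrightarrow> all_nodes Q t \<and> all_nodes Q' t"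
  by (induction t) auto

lemma all_nodes_root: "all_nodes Q t \<Longrightarrow> Q t"
  by (cases t) auto

lemma all_nodes_labels_subset: "all_nodes (\<lambda>s. label s \<subseteq> V) t \<longleftrightarrow> verts t \<subseteq> V"
  by (induction t) auto

lemma covers_positions: "(\<exists>p\<in>positions t. e \<subseteq> label_at t p) \<longleftrightarrow> covers t e"
  using all_nodes_positions[of t "\<lambda>s. \<not> e \<subseteq> label s"] by (auto simp: covers_def)

lemma verts_positions: "v \<in> verts t \<longleftrightarrow> (\<exists>p\<in>positions t. v \<in> label_at t p)"
proof -
  have "v \<in> verts t \<longleftrightarrow> \<not> all_nodes (\<lambda>s. v \<notin> label s) t"
    by (induction t) auto
  then show ?thesis
    using all_nodes_positions[of t "\<lambda>s. v \<notin> label s"] by blast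
qed

lemma label_at_verts: "p \<in> positions t \<Longrightarrow> label_at t p \<subseteq> verts t"
  by (auto simp: verts_positions[of _ t])

lemma Cons_positions [simp]:
  "i # p \<in> positions (Node b ts) \<longleftrightarrow> i < length ts \<and> p \<in> positions (ts ! i)"
  by auto

lemma finite_positions: "finite (positions t)"
  by (induction t) auto

lemma card_positions: "card (positions t) = nodes t"
proof (induction t)
  case (Node b ts)
  have "card (\<Union>i\<in>{..<length ts}. (#) i ` positions (ts ! i))
      = (\<Sum>i<length ts. card ((#) i ` positions (ts ! i)))"
    by (rule card_UN_disjoint) (auto simp: finite_positions)
  also have "\<dots> = (\<Sum>i<length ts. nodes (ts ! i))"
    using Node by (intro sum.cong) (auto simp: card_image)
  also have "\<dots> = (\<Sum>t\<leftarrow>ts. nodes t)"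
    by (simp add: sum_list_sum_nth atLeast0LessThan)
  finally show ?case
    by (simp add: finite_positions card_insert_if image_iff)
qed

lemma Nil_positions [simp]: "[] \<in> positions t"
  by (cases t) auto

lemma positions_map: "positions (map_rtree f t) = positions t"
  by (induction t) auto

lemma all_nodes_map: "all_nodes Q (map_rtree f t) \<longleftrightarrow> all_nodes (\<lambda>s. Q (map_rtree f s)) t"
  by (induction t) auto

lemma label_map: "label (map_rtree f t) = f (label t)"
  by (cases t) auto

declare positions.simps [simp del]

section \<open>The path condition as a local condition on children\<close>

lemma on_path_Cons: "on_path (i # p1) (i # q) (i # p3) \<longleftrightarrow> on_path p1 q p3"
  by (simp add: on_path_def)

lemma on_path_Nil1: "on_path [] q p \<longleftrightarrow> prefix q p"
  by (auto simp: on_path_def)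

lemma on_path_Nil3: "on_path p q [] \<longleftrightarrow> prefix q p"
  by (cases p) (auto simp: on_path_def)

text \<open>A vertex common to the root bag and the node \<open>p\<close> is handed down one level
  at a time: it occurs in the child's subtree, hence in the child's bag, and that bag is the root
  bag for the rest of the address.\<close>

lemma conn_above:
  assumes "\<And>t. t \<in> set ts \<Longrightarrow> conn t" "\<And>t. t \<in> set ts \<Longrightarrow> verts t \<inter> b \<subseteq> label t"
  shows "p \<in> positions (Node b ts) \<Longrightarrow> prefix q p \<Longrightarrow>
    b \<inter> label_at (Node b ts) p \<subseteq> label_at (Node b ts) q"
  using assms
proof (induction p arbitrary: b ts q)
  case Nil
  then show ?case by auto
next
  case (Cons i p)
  show ?case
  proof (cases q)
    case Nil
    then show ?thesis by simp
  next
    case q: (Cons j q')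
    then have [simp]: "j = i" and q': "prefix q' p" using Cons.prems by auto
    have i: "i < length ts" "p \<in> positions (ts ! i)" using Cons.prems by auto
    then have m: "ts ! i \<in> set ts" by simp
    obtain b' ts' where t: "ts ! i = Node b' ts'" by (cases "ts ! i")
    have c: "conn (Node b' ts')" "verts (ts ! i) \<inter> b \<subseteq> b'"
      using Cons.prems(3)[OF m] Cons.prems(4)[OF m] by (simp_all add: t)
    have "b' \<inter> label_at (ts ! i) p \<subseteq> label_at (ts ! i) q'"
      unfolding t using i q' c(1) t by (intro Cons.IH) auto
    moreover have "label_at (ts ! i) p \<subseteq> verts (ts ! i)"
      using i label_at_verts by blast
    ultimately show ?thesis using q c by auto
  qed
qed

lemma conn_childD:
  assumes "conn (Node b ts)" "t \<in> set ts"
  shows "conn t" "verts t \<inter> b \<subseteq> label t"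
  using assms by simp_all

lemma conn_disjointD:
  assumes "conn (Node b ts)" "i < length ts" "j < length ts" "i \<noteq> j"
  shows "verts (ts ! i) \<inter> verts (ts ! j) \<subseteq> b"
  using assms by simp

lemma conn_NodeI:
  assumes "\<And>i. i < length ts \<Longrightarrow> conn (ts ! i)"
    and "\<And>i. i < length ts \<Longrightarrow> verts (ts ! i) \<inter> b \<subseteq> label (ts ! i)"
    and "\<And>i j. i < length ts \<Longrightarrow> j < length ts \<Longrightarrow> i \<noteq> j \<Longrightarrow> verts (ts ! i) \<inter> verts (ts ! j) \<subseteq> b"
  shows "conn (Node b ts)"
proof -
  have "\<forall>t\<in>set ts. conn t \<and> verts t \<inter> b \<subseteq> label t"
    using assms(1,2) by (metis in_set_conv_nth)
  then show ?thesis using assms(3) by simp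
qed

declare conn.simps [simp del]

text \<open>The clauses of \<open>conn\<close> are instances of the path condition: the path from
  the root through a child, and the path between two siblings through the root. Conversely, if the
  end points lie below different children, their common vertices are in the root bag and
  \<open>conn_above\<close> carries them down either branch; below the same child the induction
  hypothesis applies.\<close>

lemma conn_positions:
  "(\<forall>p1\<in>positions T. \<forall>p2\<in>positions T. \<forall>p3\<in>positions T.
      on_path p1 p2 p3 \<longrightarrow> label_at T p1 \<inter> label_at T p3 \<subseteq> label_at T p2) \<longleftrightarrow> conn T"
  (is "?P T \<longleftrightarrow> _")
proof (induction T)
  case (Node b ts)
  show ?case
  proof
    assume P: "?P (Node b ts)"
    have 1: "conn (ts ! i)" if i: "i < length ts" for i
    proof -
      have "?P (ts ! i)"
      proof (intro ballI impI)
        fix p1 p2 p3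
        assume "p1 \<in> positions (ts ! i)" "p2 \<in> positions (ts ! i)" "p3 \<in> positions (ts ! i)"
          "on_path p1 p2 p3"
        then show "label_at (ts ! i) p1 \<inter> label_at (ts ! i) p3 \<subseteq> label_at (ts ! i) p2"
          using P[rule_format, of "i # p1" "i # p2" "i # p3"] i by (simp add: on_path_Cons)
      qed
      then show ?thesis using Node i by auto
    qed
    have 2: "verts (ts ! i) \<inter> b \<subseteq> label (ts ! i)" if i: "i < length ts" for i
    proof
      fix v assume v: "v \<in> verts (ts ! i) \<inter> b"
      then obtain p where p: "p \<in> positions (ts ! i)" "v \<in> label_at (ts ! i) p"
        using verts_positions[of v "ts ! i"] by auto
      show "v \<in> label (ts ! i)"
        using P[rule_format, of "[]" "[i]" "i # p"] v p i
        by (auto simp: on_path_Nil1 Nil_positions)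
    qed
    have 3: "verts (ts ! i) \<inter> verts (ts ! j) \<subseteq> b" if i: "i < length ts" "j < length ts" "i \<noteq> j" for i j
    proof
      fix v assume v: "v \<in> verts (ts ! i) \<inter> verts (ts ! j)"
      then obtain p q where p: "p \<in> positions (ts ! i)" "v \<in> label_at (ts ! i) p"
        and q: "q \<in> positions (ts ! j)" "v \<in> label_at (ts ! j) q"
        using verts_positions[of v "ts ! i"] verts_positions[of v "ts ! j"] by blast
      show "v \<in> b"
        using P[rule_format, of "i # p" "[]" "j # q"] v p q i
        by (auto simp: on_path_def)
    qed
    show "conn (Node b ts)" using 1 2 3 by (rule conn_NodeI)
  next
    assume c: "conn (Node b ts)"
    have P: "?P (ts ! i)" if "i < length ts" for i
      using Node[OF nth_mem[OF that]] conn_childD(1)[OF c nth_mem[OF that]] by blast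
    have lv: "label_at (ts ! i) p \<subseteq> verts (ts ! i)" if "p \<in> positions (ts ! i)" for i p
      using that label_at_verts by blast
    have ab: "b \<inter> label_at (Node b ts) p \<subseteq> label_at (Node b ts) q"
      if "p \<in> positions (Node b ts)" "prefix q p" for p q
      using conn_above[OF conn_childD[OF c] that] by blast
    show "?P (Node b ts)"
    proof (intro ballI impI)
      fix p1 p2 p3
      assume p: "p1 \<in> positions (Node b ts)" "p2 \<in> positions (Node b ts)" "p3 \<in> positions (Node b ts)"
        and on: "on_path p1 p2 p3"
      show "label_at (Node b ts) p1 \<inter> label_at (Node b ts) p3 \<subseteq> label_at (Node b ts) p2"
      proof (cases "p1 = [] \<or> p3 = [] \<or> p2 = []")
        case True
        show ?thesis
        proof (cases "p1 = [] \<or> p3 = []")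
          case True
          then show ?thesis using ab[of p1 p2] ab[of p3 p2] p on
            by (auto simp: on_path_Nil1 on_path_Nil3)
        next
          case False
          then obtain i p1' j p3' where e: "p1 = i # p1'" "p3 = j # p3'" "p2 = []"
            using True by (cases p1; cases p3) auto
          then have "i \<noteq> j" using on by (auto simp: on_path_def)
          then have "verts (ts ! i) \<inter> verts (ts ! j) \<subseteq> b"
            using conn_disjointD[OF c] p e by simp
          then show ?thesis using lv[of p1' i] lv[of p3' j] p e by simp blast
        qed
      next
        case False
        then obtain i p1' j p3' k p2' where e: "p1 = i # p1'" "p3 = j # p3'" "p2 = k # p2'"
          by (cases p1; cases p2; cases p3) auto
        show ?thesis
        proof (cases "i = j")
          case True
          then have "k = i" using on e by (auto simp: on_path_def)
          then show ?thesis using P[of i, rule_format, of p1' p2' p3'] on p e True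
            by (simp add: on_path_Cons)
        next
          case False
          then have "verts (ts ! i) \<inter> verts (ts ! j) \<subseteq> b"
            using conn_disjointD[OF c] p e by simp
          then have "label_at (Node b ts) p1 \<inter> label_at (Node b ts) p3 \<subseteq> b"
            using lv[of p1' i] lv[of p3' j] p e by simp blast
          moreover have "prefix p2 p1 \<or> prefix p2 p3" using on by (auto simp: on_path_def)
          ultimately show ?thesis using ab[OF p(1), of p2] ab[OF p(3), of p2] by blast
        qed
      qed
    qed
  qed
qed

lemma conn_leaf [simp]: "conn (Node b [])"
  by (simp add: conn.simps)

lemma conn_single: "conn (Node b [t]) \<longleftrightarrow> conn t \<and> verts t \<inter> b \<subseteq> label t"
  by (auto simp: conn.simps)

lemma conn_join:
  assumes "conn t1" "conn t2" "verts t1 \<inter> b \<subseteq> label t1" "verts t2 \<inter> b \<subseteq> label t2"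
    "verts t1 \<inter> verts t2 \<subseteq> b"
  shows "conn (Node b [t1, t2])"
proof (rule conn_NodeI)
  fix i assume i: "i < length [t1, t2]"
  then have "i = 0 \<or> i = 1" by auto
  then show "conn ([t1, t2] ! i)" "verts ([t1, t2] ! i) \<inter> b \<subseteq> label ([t1, t2] ! i)"
    using assms by auto
  fix j assume "j < length [t1, t2]" "i \<noteq> j"
  with i have "i = 0 \<and> j = 1 \<or> i = 1 \<and> j = 0" by auto
  then show "verts ([t1, t2] ! i) \<inter> verts ([t1, t2] ! j) \<subseteq> b" using assms(5) by auto
qed

lemma tree_decomposition_iff:
  "tree_decomposition G T \<longleftrightarrow>
     verts T \<subseteq> fst G \<and> fst G \<subseteq> verts T \<and> (\<forall>e\<in>snd G. covers T e) \<and> conn T"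
proof -
  have "(\<forall>p\<in>positions T. label_at T p \<subseteq> fst G) \<longleftrightarrow> verts T \<subseteq> fst G"
    by (simp only: all_nodes_positions[of T "\<lambda>s. label s \<subseteq> fst G"] all_nodes_labels_subset)
  moreover have "(\<forall>v\<in>fst G. \<exists>p\<in>positions T. v \<in> label_at T p) \<longleftrightarrow> fst G \<subseteq> verts T"
    by (simp only: verts_positions[of _ T, symmetric] subset_iff Ball_def)
  ultimately show ?thesis
    by (simp only: tree_decomposition_def conn_positions covers_positions conj_assoc)
qed

lemma nice_iff: "nice T \<longleftrightarrow> label T = {} \<and> all_nodes nice_node T"
  by (simp add: nice_def all_nodes_positions)

section \<open>Small nice tree decompositions\<close>

definition bounded_bags :: "nat \<Rightarrow> 'v set rtree \<Rightarrow> bool" where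
  "bounded_bags w = all_nodes (\<lambda>s. finite (label s) \<and> card (label s) \<le> w)"

lemma width_le_iff:
  assumes "all_nodes (\<lambda>s. finite (label s)) T"
  shows "width T \<le> k \<longleftrightarrow> bounded_bags (Suc k) T"
proof -
  have "width T \<le> k \<longleftrightarrow> Max {card (label_at T p) | p. p \<in> positions T} \<le> Suc k"
    by (auto simp: width_def)
  also have "\<dots> \<longleftrightarrow> (\<forall>p\<in>positions T. card (label_at T p) \<le> Suc k)"
    using Nil_positions[of T] finite_positions[of T]
    by (subst Max_le_iff) (auto simp: setcompr_eq_image simp del: Nil_positions)
  also have "\<dots> \<longleftrightarrow> bounded_bags (Suc k) T"
    using assms all_nodes_positions[of T "\<lambda>s. card (label s) \<le> Suc k"]
    by (simp add: bounded_bags_def all_nodes_conj)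
  finally show ?thesis .
qed

section \<open>Chains of removal and introduce nodes, and their cost in nodes\<close>

definition nice_td :: "nat \<Rightarrow> 'v set rtree \<Rightarrow> bool" where
  "nice_td w t \<longleftrightarrow> conn t \<and> all_nodes nice_node t \<and> bounded_bags w t"

text \<open>The induction is over the set \<open>D\<close> of vertices removed so far. Each step
  puts one removal node on top of the tree already built, which gives the exact number of
  nodes.\<close>

lemma nice_td_remove:
  assumes "nice_td w t" "b \<subseteq> label t"
  shows "\<exists>t'. nice_td w t' \<and> label t' = b \<and> verts t' = verts t \<and>
    (\<forall>e. covers t e \<longrightarrow> covers t' e) \<and> nodes t' = nodes t + card (label t - b)"
proof -
  have "finite (label t)" using assms by (cases t) (auto simp: nice_td_def bounded_bags_def)
  then have fin: "finite (label t - b)" by simp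
  have "D \<subseteq> label t \<Longrightarrow> \<exists>t'. nice_td w t' \<and> label t' = label t - D \<and> verts t' = verts t \<and>
    (\<forall>e. covers t e \<longrightarrow> covers t' e) \<and> nodes t' = nodes t + card D" if "finite D" for D
    using that
  proof (induction D)
    case empty
    show ?case using assms by (intro exI[of _ t]) auto
  next
    case (insert x D)
    then obtain t' where t': "nice_td w t'" "label t' = label t - D" "verts t' = verts t"
      "\<forall>e. covers t e \<longrightarrow> covers t' e" "nodes t' = nodes t + card D" by auto
    have x: "x \<in> label t'" using insert t' by auto
    have f: "finite (label t')" "card (label t') \<le> w"
      using t' by (cases t', auto simp: nice_td_def bounded_bags_def)+
    then have c: "card (label t') = card (label t' - {x}) + 1"
      using x by (metis card_Suc_Diff1 Suc_eq_plus1)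
    let ?n = "Node (label t' - {x}) [t']"
    have "nice_td w ?n"
      using t' c f by (auto simp: nice_td_def bounded_bags_def conn_single)
    moreover have "verts ?n = verts t" using t' label_verts[of t'] by auto
    moreover have "\<forall>e. covers t e \<longrightarrow> covers ?n e" using t' by (auto simp: covers_Node)
    ultimately show ?case using t' insert
      by (intro exI[of _ ?n]) auto
  qed
  from this[OF fin] show ?thesis using assms by (auto simp: double_diff)
qed

text \<open>The last assumption protects connectedness: a vertex of \<open>b\<close> that occurs in
  \<open>t\<close> but no longer in its top bag would be introduced a second time.\<close>

lemma nice_td_introduce:
  assumes "nice_td w t" "label t \<subseteq> b" "finite b" "card b \<le> w" "b \<inter> verts t \<subseteq> label t"
  shows "\<exists>t'. nice_td w t' \<and> label t' = b \<and> verts t' = verts t \<union> b \<and>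
    (\<forall>e. covers t e \<longrightarrow> covers t' e) \<and> nodes t' = nodes t + card (b - label t)"
proof -
  have fin: "finite (b - label t)" using assms by simp
  have "D \<subseteq> b - label t \<Longrightarrow> \<exists>t'. nice_td w t' \<and> label t' = label t \<union> D \<and> verts t' = verts t \<union> D \<and>
    (\<forall>e. covers t e \<longrightarrow> covers t' e) \<and> nodes t' = nodes t + card D" if "finite D" for D
    using that
  proof (induction D)
    case empty
    show ?case using assms by (intro exI[of _ t]) auto
  next
    case (insert x D)
    then obtain t' where t': "nice_td w t'" "label t' = label t \<union> D" "verts t' = verts t \<union> D"
      "\<forall>e. covers t e \<longrightarrow> covers t' e" "nodes t' = nodes t + card D" by auto
    have x: "x \<notin> verts t'" using insert t' assms by auto
    then have x': "x \<notin> label t'" using label_verts[of t'] by auto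
    have f: "finite (label t')"
      using t' by (cases t', auto simp: nice_td_def bounded_bags_def)+
    have c: "card (insert x (label t')) = card (label t') + 1"
      using x' f by simp
    have "insert x (label t') \<subseteq> b" using t' insert assms by auto
    then have c': "card (insert x (label t')) \<le> w"
      using assms card_mono by (metis order_trans)
    let ?n = "Node (insert x (label t')) [t']"
    have "nice_td w ?n"
      using t' c f c' x by (auto simp: nice_td_def bounded_bags_def conn_single)
    moreover have "verts ?n = verts t \<union> insert x D" using t' label_verts[of t'] by auto
    moreover have "\<forall>e. covers t e \<longrightarrow> covers ?n e" using t' by (auto simp: covers_Node)
    ultimately show ?case using t' insert
      by (intro exI[of _ ?n]) auto
  qed
  from this[OF fin order_refl] obtain t' where "nice_td w t' \<and> label t' = label t \<union> (b - label t) \<and>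
    verts t' = verts t \<union> (b - label t) \<and>
    (\<forall>e. covers t e \<longrightarrow> covers t' e) \<and> nodes t' = nodes t + card (b - label t)" by blast
  moreover have "label t \<union> (b - label t) = b" "verts t \<union> (b - label t) = verts t \<union> b"
    using assms label_verts[of t] by auto
  ultimately show ?thesis by auto
qed

text \<open>The invariant of the recursion that makes a decomposition nice. The term \<open>w + 1\<close> pays for
  the join node that merges two subtrees over the same bag.\<close>

definition few_nodes :: "nat \<Rightarrow> 'v set rtree \<Rightarrow> bool" where
  "few_nodes w t \<longleftrightarrow> (if verts t \<subseteq> label t then nodes t \<le> card (label t) + 1
     else nodes t + w + 1 \<le> (5 * w + 5) * card (verts t - label t) + card (label t))"

lemma finite_verts: "bounded_bags w t \<Longrightarrow> finite (verts t)"
  by (induction t) (auto simp: bounded_bags_def)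

text \<open>Removing before introducing keeps all bags of the chain within size \<open>w\<close>. If
  nothing has to be removed, the introduce nodes are paid for by the growth of the top bag, the last
  summand of the invariant. Otherwise a vertex moves from the top bag to the removed ones and
  releases \<open>5 * w + 5\<close>.\<close>

lemma nice_td_change:
  assumes t: "nice_td w t" "few_nodes w t" and b: "finite b" "card b \<le> w" "b \<inter> verts t \<subseteq> label t"
    and n: "\<not> verts t \<subseteq> b"
  shows "\<exists>t'. nice_td w t' \<and> label t' = b \<and> verts t' = verts t \<union> b \<and>
    (\<forall>e. covers t e \<longrightarrow> covers t' e) \<and> few_nodes w t'"
proof -
  obtain t1 where t1: "nice_td w t1" "label t1 = label t \<inter> b" "verts t1 = verts t"
    "\<forall>e. covers t e \<longrightarrow> covers t1 e" "nodes t1 = nodes t + card (label t - label t \<inter> b)"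
    using nice_td_remove[OF t(1), of "label t \<inter> b"] by auto
  obtain t2 where t2: "nice_td w t2" "label t2 = b" "verts t2 = verts t1 \<union> b"
    "\<forall>e. covers t1 e \<longrightarrow> covers t2 e" "nodes t2 = nodes t1 + card (b - label t1)"
    using nice_td_introduce[OF t1(1), of b] t1 b by auto
  have fin: "finite (verts t)" using t by (auto simp: nice_td_def finite_verts)
  have lab: "finite (label t)" "card (label t) \<le> w"
    using t by (cases t, auto simp: nice_td_def bounded_bags_def)+
  have V: "verts t - b = (verts t - label t) \<union> (label t - b)"
    using b label_verts[of t] by auto
  have cV: "card (verts t - b) = card (verts t - label t) + card (label t - b)"
    unfolding V using fin lab by (intro card_Un_disjoint) auto
  have n2: "nodes t2 = nodes t + card (label t - b) + card (b - label t)"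
  proof -
    have "label t - label t \<inter> b = label t - b" "b - (label t \<inter> b) = b - label t" by auto
    then show ?thesis using t1 t2 by simp
  qed
  have nb: "card (b - label t) \<le> w" "card (label t - b) \<le> card (label t)"
    using b lab by (meson card_mono Diff_subset order_trans)+
  have "nodes t2 + w + 1 \<le> (5 * w + 5) * card (verts t - b) + card b"
  proof (cases "label t \<subseteq> b")
    case True
    then have e: "label t - b = {}" by auto
    then have "\<not> verts t \<subseteq> label t" using n True by auto
    then have "nodes t + w + 1 \<le> (5 * w + 5) * card (verts t - label t) + card (label t)"
      using t by (simp add: few_nodes_def)
    moreover have "card b = card (label t) + card (b - label t)"
      using b True lab by (simp add: card_Diff_subset card_mono)
    ultimately show ?thesis using n2 cV e by simp
  next
    case False
    then have "card (label t - b) \<ge> 1" using lab by (simp add: Suc_le_eq card_gt_0_iff)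
    \<comment> \<open>The released \<open>5 * w + 5\<close> has to cover at most \<open>w\<close>
      removals, at most \<open>w\<close> introductions, the reserve \<open>w + 1\<close> demanded of
      the result, and the \<open>w + 1\<close> in the bound on \<open>nodes t\<close> below, which
      holds in both branches of \<open>few_nodes\<close>: together \<open>4 * w + 2\<close>.\<close>
    then have 1: "(5 * w + 5) * card (verts t - b) \<ge> (5 * w + 5) * card (verts t - label t) + (5 * w + 5)"
      unfolding cV by (simp add: add_mult_distrib2)
    have "nodes t \<le> (5 * w + 5) * card (verts t - label t) + w + 1"
      using t lab by (auto simp: few_nodes_def split: if_splits)
    then show ?thesis using 1 nb lab n2 by linarith
  qed
  moreover have "verts t2 - b = verts t - b" using t1 t2 by auto
  moreover have "\<not> verts t2 \<subseteq> b" using t1 t2 n by auto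
  ultimately have "few_nodes w t2" using t2 by (simp add: few_nodes_def)
  then show ?thesis using t1 t2 by (intro exI[of _ t2]) auto
qed

lemma nice_td_leaf:
  assumes "finite b" "card b \<le> w"
  shows "\<exists>t'. nice_td w t' \<and> label t' = b \<and> verts t' = b \<and> few_nodes w t'"
proof -
  have "nice_td w (Node {} [])" by (simp add: nice_td_def bounded_bags_def)
  from nice_td_introduce[OF this, of b] assms obtain t' where
    "nice_td w t'" "label t' = b" "verts t' = b" "nodes t' = 1 + card b" by auto
  then show ?thesis by (auto simp: few_nodes_def)
qed

text \<open>Adding the two invariants counts both \<open>card b\<close> and the reserve
  \<open>w + 1\<close> twice. The surplus reserve pays for the second \<open>card b\<close>, which
  is at most \<open>w\<close>, and for the join node itself.\<close>

lemma nice_td_join: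
  assumes t: "nice_td w t1" "nice_td w t2" "label t1 = b" "label t2 = b" "verts t1 \<inter> verts t2 \<subseteq> b"
    "few_nodes w t1" "few_nodes w t2" "\<not> verts t1 \<subseteq> b" "\<not> verts t2 \<subseteq> b"
  shows "nice_td w (Node b [t1, t2])" "few_nodes w (Node b [t1, t2])"
proof -
  have "conn (Node b [t1, t2])"
    using t by (intro conn_join) (auto simp: nice_td_def)
  then show "nice_td w (Node b [t1, t2])"
    using t all_nodes_root[of _ t1] by (auto simp: nice_td_def bounded_bags_def)
  have fin: "finite (verts t1)" "finite (verts t2)" "card b \<le> w"
    using t all_nodes_root[of _ t1] by (auto simp: nice_td_def finite_verts bounded_bags_def)
  have "card (verts t1 \<union> verts t2 - b) = card (verts t1 - b) + card (verts t2 - b)"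
    unfolding Un_Diff using t fin by (intro card_Un_disjoint) auto
  moreover have "verts (Node b [t1, t2]) = verts t1 \<union> verts t2"
    using t label_verts[of t1] by auto
  ultimately show "few_nodes w (Node b [t1, t2])"
    using t fin by (simp add: few_nodes_def add_mult_distrib2 del: verts.simps)
qed

lemma conn_ConsD:
  assumes "conn (Node b (t # ts))"
  shows "conn t" "verts t \<inter> b \<subseteq> label t" "conn (Node b ts)" "verts t \<inter> (\<Union>u\<in>set ts. verts u) \<subseteq> b"
proof -
  show "conn t" "verts t \<inter> b \<subseteq> label t" using conn_childD[OF assms, of t] by auto
  have "verts (ts ! i) \<inter> verts (ts ! j) \<subseteq> b" if "i < length ts" "j < length ts" "i \<noteq> j" for i j
    using conn_disjointD[OF assms, of "Suc i" "Suc j"] that by simp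
  then show "conn (Node b ts)"
    using conn_childD[OF assms] by (intro conn_NodeI) auto
  have "verts t \<inter> verts (ts ! j) \<subseteq> b" if "j < length ts" for j
    using conn_disjointD[OF assms, of 0 "Suc j"] that by simp
  then have "verts t \<inter> verts u \<subseteq> b" if "u \<in> set ts" for u
    using that by (metis in_set_conv_nth)
  then show "verts t \<inter> (\<Union>u\<in>set ts. verts u) \<subseteq> b" by blast
qed

text \<open>Nested induction, over the tree and over the list of children: \<open>Node b ts\<close>
  is treated as a tree of its own, to which one more child is joined, so a node of any degree
  becomes a cascade of binary joins. Dropping a subtree whose vertices lie in \<open>b\<close> loses
  no covered edge, since such an edge is contained in \<open>b\<close>. When both sides are kept,
  both have vertices outside \<open>b\<close>, as \<open>nice_td_join\<close> requires.\<close>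

lemma ex_nice_td:
  assumes "conn t" "bounded_bags w t"
  shows "\<exists>t'. nice_td w t' \<and> label t' = label t \<and> verts t' = verts t \<and>
    (\<forall>e. covers t e \<longrightarrow> covers t' e) \<and> few_nodes w t'"
  using assms
proof (induction t)
  case (Node b ts)
  have b: "finite b" "card b \<le> w" using Node.prems by (auto simp: bounded_bags_def)
  show ?case using Node
  proof (induction ts)
    case Nil
    from nice_td_leaf[OF b] obtain t' where
      t': "nice_td w t'" "label t' = b" "verts t' = b" "few_nodes w t'" by auto
    moreover have "covers t' e" if "e \<subseteq> b" for e
      using t' that by (cases t') (auto simp: covers_Node)
    ultimately show ?case by (intro exI[of _ t']) (auto simp: covers_Node)
  next
    case (Cons t ts)
    have c: "conn t" "verts t \<inter> b \<subseteq> label t" "conn (Node b ts)"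
      "verts t \<inter> (\<Union>u\<in>set ts. verts u) \<subseteq> b"
      using conn_ConsD[OF Cons.prems(2)] by auto
    have bb: "bounded_bags w t" "bounded_bags w (Node b ts)"
      using Cons.prems(3) by (simp_all add: bounded_bags_def)
    have "\<exists>t'. nice_td w t' \<and> label t' = b \<and> verts t' = verts (Node b ts) \<and>
      (\<forall>e. covers (Node b ts) e \<longrightarrow> covers t' e) \<and> few_nodes w t'"
      using Cons.IH[OF Cons.prems(1) c(3) bb(2)] by simp
    then obtain t2 where t2: "nice_td w t2" "label t2 = b" "verts t2 = verts (Node b ts)"
      "\<forall>e. covers (Node b ts) e \<longrightarrow> covers t2 e" "few_nodes w t2"
      by blast
    obtain t0 where t0: "nice_td w t0" "label t0 = label t" "verts t0 = verts t"
      "\<forall>e. covers t e \<longrightarrow> covers t0 e" "few_nodes w t0"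
      using Cons.prems(1)[of t] c bb by auto
    have cov2: "covers t2 e" if "e \<subseteq> b" for e using t2 that by (auto simp: covers_Node)
    have disj: "verts t \<inter> verts (Node b ts) \<subseteq> b"
      using c(4) by auto
    show ?case
    proof (cases "verts t \<subseteq> b")
      case True
      then show ?thesis using t2 cov2
        by (intro exI[of _ t2]) (auto simp: covers_Node dest!: covers_verts)
    next
      case False
      have "b \<inter> verts t0 \<subseteq> label t0" using t0 c(2) by auto
      from nice_td_change[OF t0(1,5) b this] False t0 obtain t1 where
        t1: "nice_td w t1" "label t1 = b" "verts t1 = verts t \<union> b"
        "\<forall>e. covers t0 e \<longrightarrow> covers t1 e" "few_nodes w t1" by auto
      show ?thesis
      proof (cases "verts (Node b ts) \<subseteq> b")
        case True
        have cov1: "covers t1 e" if "e \<subseteq> b" for e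
          using t1 that by (cases t1) (auto simp: covers_Node)
        have "covers t1 e" if "covers (Node b (t # ts)) e" for e
        proof (cases "covers t e")
          case True
          then show ?thesis using t0 t1 by simp
        next
          case False
          then have "covers (Node b ts) e" using that by (auto simp: covers_Node)
          from cov1[OF order_trans[OF covers_verts[OF this] True]] show ?thesis .
        qed
        moreover have "verts t1 = verts (Node b (t # ts))" using t1 True by auto
        ultimately show ?thesis using t1 by (intro exI[of _ t1]) simp
      next
        case F: False
        have "nice_td w (Node b [t1, t2])" "few_nodes w (Node b [t1, t2])"
          using t1 t2 disj False F by (intro nice_td_join; simp; blast)+
        then show ?thesis using t1 t2 t0
          by (intro exI[of _ "Node b [t1, t2]"]) (auto simp: covers_Node)
      qed
    qed
  qed
qed

text \<open>The single bag of all vertices is a decomposition, so the \<open>LEAST\<close> in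
  \<open>treewidth\<close> ranges over a nonempty set and is attained.\<close>

lemma ex_tree_decomposition:
  assumes "\<Union> (snd G) \<subseteq> fst G"
  shows "\<exists>T. tree_decomposition G T \<and> width T = treewidth G"
proof -
  have "tree_decomposition G (Node (fst G) [])"
    using assms by (auto simp: tree_decomposition_iff covers_Node)
  then have "\<exists>k T. tree_decomposition G T \<and> width T = k" by blast
  then show ?thesis unfolding treewidth_def by (rule LeastI_ex)
qed

lemma ex_small_nice_tree_decomposition:
  assumes G: "finite (fst G)" "fst G \<noteq> {}" "\<Union> (snd G) \<subseteq> fst G"
  shows "\<exists>T. tree_decomposition G T \<and> nice T \<and> width T = treewidth G \<and>
    card (positions T) \<le> 13 * (treewidth G + 1) * card (fst G)"
proof -
  define w where "w = Suc (treewidth G)"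
  obtain T where T: "tree_decomposition G T" "width T = treewidth G"
    using ex_tree_decomposition[OF G(3)] by blast
  then have V: "verts T = fst G" and c: "conn T" and e: "\<forall>e\<in>snd G. covers T e"
    by (auto simp: tree_decomposition_iff)
  have fin: "all_nodes (\<lambda>s. finite (label s)) T'" if "verts T' = fst G" for T'
    using all_nodes_labels_subset[of "fst G" T'] G(1) that
    by (auto elim!: all_nodes_mono intro: finite_subset)
  have "bounded_bags w T"
    using width_le_iff[OF fin[OF V], of "treewidth G"] T by (simp add: w_def)
  from ex_nice_td[OF c this] obtain T1 where T1: "nice_td w T1" "label T1 = label T"
    "verts T1 = fst G" "\<forall>e. covers T e \<longrightarrow> covers T1 e" "few_nodes w T1"
    using V by auto
  \<comment> \<open>The construction preserves the old root bag; a final chain of removals empties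
    it, as \<open>nice\<close> demands.\<close>
  obtain T2 where T2: "nice_td w T2" "label T2 = {}" "verts T2 = fst G"
    "\<forall>e. covers T1 e \<longrightarrow> covers T2 e" "nodes T2 = nodes T1 + card (label T1)"
    using nice_td_remove[OF T1(1), of "{}"] T1 by auto
  have td: "tree_decomposition G T2"
    using T2 T1 e by (auto simp: tree_decomposition_iff nice_td_def)
  have "width T2 \<le> treewidth G"
    using width_le_iff[OF fin[OF T2(3)]] T2 by (simp add: w_def nice_td_def)
  moreover have "treewidth G \<le> width T2"
    unfolding treewidth_def by (rule Least_le) (use td in blast)
  moreover have "nodes T2 \<le> 13 * w * card (fst G)"
  proof -
    have lab: "finite (label T1)" "card (label T1) \<le> w"
      using T1(1) by (cases T1, auto simp: nice_td_def bounded_bags_def)+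
    have "nodes T1 \<le> (5 * w + 5) * card (verts T1 - label T1) + w + 1"
      using T1(5) lab by (auto simp: few_nodes_def split: if_splits)
    also have "card (verts T1 - label T1) \<le> card (fst G)"
      using T1 G by (intro card_mono) auto
    finally have "nodes T2 \<le> (5 * w + 5) * card (fst G) + (2 * w + 1) * 1"
      using T2 lab by simp
    also have "\<dots> \<le> (5 * w + 5) * card (fst G) + (2 * w + 1) * card (fst G)"
      using G by (intro add_mono mult_left_mono) (auto simp: Suc_le_eq card_gt_0_iff)
    also have "\<dots> = (7 * w + 6) * card (fst G)" by (simp add: algebra_simps)
    \<comment> \<open>Here \<open>w >= 1\<close> turns \<open>7 * w + 6\<close> into
      \<open>13 * w\<close>, the origin of the 13.\<close>
    also have "\<dots> \<le> 13 * w * card (fst G)" by (intro mult_right_mono) (auto simp: w_def)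
    finally show ?thesis .
  qed
  ultimately show ?thesis
    using td T2 by (intro exI[of _ T2]) (auto simp: nice_iff nice_td_def card_positions w_def)
qed

lemma ex_optimal_nice_td:
  assumes "program \<Pi>" "\<Pi> \<noteq> {}"
  shows "\<exists>T. optimal_nice_td \<Pi> T \<and> card (positions T) \<le>
    13 * (treewidth (incidence_graph \<Pi>) + 1) * graph_size (incidence_graph \<Pi>)"
proof -
  let ?G = "incidence_graph \<Pi>"
  have G: "finite (fst ?G)" "fst ?G \<noteq> {}" "\<Union> (snd ?G) \<subseteq> fst ?G"
    using assms by (auto simp: incidence_graph_def program_def wf_rule_def)
  obtain T where T: "tree_decomposition ?G T" "nice T" "width T = treewidth ?G"
    "card (positions T) \<le> 13 * (treewidth ?G + 1) * card (fst ?G)"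
    using ex_small_nice_tree_decomposition[OF G] by auto
  \<comment> \<open>The algorithm reads bags as lists; an arbitrary distinct enumeration of each bag
    is chosen.\<close>
  define f :: "'a vertex set \<Rightarrow> 'a vertex list" where "f = (\<lambda>S. SOME xs. set xs = S \<and> distinct xs)"
  have f: "set (f S) = S \<and> distinct (f S)" if "finite S" for S
    unfolding f_def by (rule someI_ex) (use finite_distinct_list[OF that] in blast)
  have fin: "all_nodes (\<lambda>s. finite (label s)) T"
    using all_nodes_labels_subset[of "fst ?G" T] G(1) T(1)
    by (auto simp: tree_decomposition_iff elim!: all_nodes_mono intro: finite_subset)
  have eq: "map_rtree set (map_rtree f T) = T"
    using fin by (induction T) (auto simp: f rtree.map_comp intro!: map_idI)
  have "all_nodes (\<lambda>s. distinct (label s)) (map_rtree f T)"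
    unfolding all_nodes_map label_map using fin by (rule all_nodes_mono) (simp add: f)
  then have "optimal_nice_td \<Pi> (map_rtree f T)"
    using T all_nodes_positions[of "map_rtree f T" "\<lambda>s. distinct (label s)"]
    by (simp add: optimal_nice_td_def eq)
  moreover have "13 * (treewidth ?G + 1) * card (fst ?G) \<le> 13 * (treewidth ?G + 1) * graph_size ?G"
    by (intro mult_left_mono) (auto simp: graph_size_def)
  ultimately show ?thesis
    using order_trans[OF T(4)] by (intro exI[of _ "map_rtree f T"]) (simp add: positions_map)
qed

section \<open>Timed computations\<close>

lemma val_ret [simp]: "val (ret x) = x" and steps_ret [simp]: "steps (ret x) = 0"
  by (simp_all add: ret_def)

lemma val_step [simp]: "val (step m) = val m" and steps_step [simp]: "steps (step m) = Suc (steps m)"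
  by (simp_all add: step_def)

lemma val_prim [simp]: "val (prim x) = x" and steps_prim [simp]: "steps (prim x) = 1"
  by (simp_all add: prim_def)

lemma val_bind [simp]: "val (bind_timed m f) = val (f (val m))"
  and steps_bind [simp]: "steps (bind_timed m f) = steps m + steps (f (val m))"
  by (simp_all add: bind_timed_def)

lemma val_if: "val (if b then x else y) = (if b then val x else val y)"
  and steps_if: "steps (if b then x else y) = (if b then steps x else steps y)"
  by simp_all

lemma val_map_t [simp]: "val (map_t f xs) = map (\<lambda>x. val (f x)) xs"
  by (induction xs) auto

lemma val_filter_t [simp]: "val (filter_t f xs) = filter (\<lambda>x. val (f x)) xs"
  by (induction xs) auto

lemma val_append_t [simp]: "val (append_t xs ys) = xs @ ys"
  by (induction xs) auto

lemma val_concat_t [simp]: "val (concat_t xss) = concat xss"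
  by (induction xss) auto

lemma val_sum_t [simp]: "val (sum_t f xs) = (\<Sum>x\<leftarrow>xs. val (f x))"
  by (induction xs) auto

lemma val_any_t [simp]: "val (any_t f xs) \<longleftrightarrow> (\<exists>x\<in>set xs. val (f x))"
  by (induction xs) auto

lemma val_all_t [simp]: "val (all_t f xs) \<longleftrightarrow> (\<forall>x\<in>set xs. val (f x))"
  by (induction xs) auto

lemma val_lookup_t [simp]: "val (lookup_t xs k) = map_of xs k"
  by (induction xs) auto

lemma val_mem_t [simp]: "val (mem_t x xs) \<longleftrightarrow> x \<in> set xs"
  by (auto simp: mem_t_def)

lemma val_diff_t [simp]: "val (diff_t xs ys) = filter (\<lambda>x. x \<notin> set ys) xs"
  by (simp add: diff_t_def)

lemma steps_map_t:
  "(\<And>x. x \<in> set xs \<Longrightarrow> steps (f x) \<le> B) \<Longrightarrow> steps (map_t f xs) \<le> length xs * (B + 1) + 1"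
  by (induction xs) (auto, fastforce)

lemma steps_filter_t:
  "(\<And>x. x \<in> set xs \<Longrightarrow> steps (f x) \<le> B) \<Longrightarrow> steps (filter_t f xs) \<le> length xs * (B + 1) + 1"
  by (induction xs) (auto, fastforce)

lemma steps_sum_t:
  "(\<And>x. x \<in> set xs \<Longrightarrow> steps (f x) \<le> B) \<Longrightarrow> steps (sum_t f xs) \<le> length xs * (B + 1) + 1"
  by (induction xs) (auto, fastforce)

lemma steps_any_t:
  "(\<And>x. x \<in> set xs \<Longrightarrow> steps (f x) \<le> B) \<Longrightarrow> steps (any_t f xs) \<le> length xs * (B + 1) + 1"
  by (induction xs) (auto, fastforce+)

lemma steps_all_t:
  "(\<And>x. x \<in> set xs \<Longrightarrow> steps (f x) \<le> B) \<Longrightarrow> steps (all_t f xs) \<le> length xs * (B + 1) + 1"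
  by (induction xs) (auto, fastforce+)

lemma steps_append_t: "steps (append_t xs ys) = length xs + 1"
  by (induction xs) auto

lemma steps_concat_t:
  "(\<And>xs. xs \<in> set xss \<Longrightarrow> length xs \<le> B) \<Longrightarrow> steps (concat_t xss) \<le> length xss * (B + 2) + 1"
  by (induction xss) (auto simp: steps_append_t, fastforce)

lemma steps_lookup_t: "steps (lookup_t xs k) \<le> length xs + 1"
  by (induction xs) auto

lemma steps_mem_t: "steps (mem_t x xs) \<le> length xs * 2 + 1"
  unfolding mem_t_def by (rule order_trans[OF steps_any_t[where B = 1]]) auto

lemma steps_diff_t: "steps (diff_t xs ys) \<le> length xs * (length ys * 2 + 3) + 1"
  unfolding diff_t_def using steps_mem_t[of _ ys]
  by (intro order_trans[OF steps_filter_t[where B = "length ys * 2 + 2"]]) (auto simp: algebra_simps)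

lemma length_concat_le:
  "(\<And>xs. xs \<in> set xss \<Longrightarrow> length xs \<le> B) \<Longrightarrow> length (concat xss) \<le> length xss * B"
  by (induction xss) (auto simp: add_mono)

lemma set_nub_t_subset: "set (val (nub_t eq xs)) \<subseteq> set xs"
  by (induction xs) auto

text \<open>Here \<open>f\<close> is the abstraction from a list representation to the object it
  denotes. The test \<open>eq\<close> is only assumed to decide equality of abstractions on the
  entries of \<open>xs\<close>, because the tests of the algorithm are correct for well-formed
  representations only.\<close>

lemma
  assumes "\<And>x y. x \<in> set xs \<Longrightarrow> y \<in> set xs \<Longrightarrow> val (eq x y) \<longleftrightarrow> f x = f y"
  shows distinct_nub_t: "distinct (map f (val (nub_t eq xs)))"
    and image_nub_t: "f ` set (val (nub_t eq xs)) = f ` set xs"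
proof -
  have "distinct (map f (val (nub_t eq xs))) \<and> f ` set (val (nub_t eq xs)) = f ` set xs"
    using assms
  proof (induction xs)
    case (Cons x xs)
    then have IH: "distinct (map f (val (nub_t eq xs)))" "f ` set (val (nub_t eq xs)) = f ` set xs"
      by auto
    have "val (any_t (eq x) (val (nub_t eq xs))) \<longleftrightarrow> f x \<in> f ` set (val (nub_t eq xs))"
      using Cons.prems set_nub_t_subset[of eq xs] by auto
    then show ?case using IH by auto
  qed simp
  then show "distinct (map f (val (nub_t eq xs)))" "f ` set (val (nub_t eq xs)) = f ` set xs" by auto
qed

text \<open>An entry is compared only with the representatives already kept. So the cost is the
  length of the input times the length of the result, and a bound on the number of distinct entries
  enters as one factor.\<close>

lemma steps_nub_t:
  assumes "\<And>x y. x \<in> set xs \<Longrightarrow> y \<in> set xs \<Longrightarrow> steps (eq x y) \<le> B"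
    and "length (val (nub_t eq xs)) \<le> L"
  shows "steps (nub_t eq xs) \<le> length xs * (L * (B + 1) + 2) + 1"
  using assms
proof (induction xs)
  case (Cons x xs)
  let ?ys = "val (nub_t eq xs)"
  have L: "length ?ys \<le> L" using Cons.prems(2) by (auto split: if_splits)
  have "steps (any_t (eq x) ?ys) \<le> length ?ys * (B + 1) + 1"
    using Cons.prems(1) set_nub_t_subset[of eq xs] by (intro steps_any_t) auto
  also have "\<dots> \<le> L * (B + 1) + 1" using mult_le_mono1[OF L, of "B + 1"] by simp
  finally show ?case using Cons.IH[OF Cons.prems(1) L] by simp
qed simp

lemma val_set_eq_t:
  assumes "\<And>x y. x \<in> set xs \<Longrightarrow> y \<in> set ys \<Longrightarrow> val (eq x y) \<longleftrightarrow> f x = f y"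
    and "\<And>x y. x \<in> set xs \<Longrightarrow> y \<in> set ys \<Longrightarrow> val (eq y x) \<longleftrightarrow> f x = f y"
  shows "val (set_eq_t eq xs ys) \<longleftrightarrow> f ` set xs = f ` set ys"
proof -
  have "val (set_eq_t eq xs ys) \<longleftrightarrow>
    (\<forall>x\<in>set xs. \<exists>y\<in>set ys. f x = f y) \<and> (\<forall>y\<in>set ys. \<exists>x\<in>set xs. f x = f y)"
    using assms by (simp add: set_eq_t_def)
  also have "\<dots> \<longleftrightarrow> f ` set xs = f ` set ys"
    by (simp add: set_eq_iff image_iff) metis
  finally show ?thesis .
qed

lemma steps_set_eq_t:
  assumes "\<And>x y. x \<in> set xs \<Longrightarrow> y \<in> set ys \<Longrightarrow> steps (eq x y) \<le> B \<and> steps (eq y x) \<le> B"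
    and "length xs \<le> L" "length ys \<le> L"
  shows "steps (set_eq_t eq xs ys) \<le> 2 * (L * (L * (B + 1) + 2)) + 3"
proof -
  have 1: "steps (all_t (\<lambda>x. any_t (eq x) vs) us) \<le> L * (L * (B + 1) + 2) + 1"
    if us: "\<And>x y. x \<in> set us \<Longrightarrow> y \<in> set vs \<Longrightarrow> steps (eq x y) \<le> B" "length us \<le> L" "length vs \<le> L"
    for us vs
  proof -
    have "steps (any_t (eq x) vs) \<le> L * (B + 1) + 1" if x: "x \<in> set us" for x
    proof -
      have "steps (any_t (eq x) vs) \<le> length vs * (B + 1) + 1"
        using us(1)[OF x] by (intro steps_any_t)
      also have "\<dots> \<le> L * (B + 1) + 1" using mult_le_mono1[OF us(3), of "B + 1"] by simp
      finally show ?thesis .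
    qed
    then have "steps (all_t (\<lambda>x. any_t (eq x) vs) us) \<le> length us * ((L * (B + 1) + 1) + 1) + 1"
      by (intro steps_all_t)
    also have "\<dots> \<le> L * (L * (B + 1) + 2) + 1"
      using mult_le_mono1[OF us(2), of "L * (B + 1) + 2"] by simp
    finally show ?thesis .
  qed
  have "steps (all_t (\<lambda>x. any_t (eq x) ys) xs) \<le> L * (L * (B + 1) + 2) + 1"
    "steps (all_t (\<lambda>x. any_t (eq x) xs) ys) \<le> L * (L * (B + 1) + 2) + 1"
    using assms by (intro 1; blast)+
  then show ?thesis by (simp add: set_eq_t_def)
qed

section \<open>Truncated rule-states\<close>

lemma trunc_val_le: "trunc_val r v = v \<longleftrightarrow> v = \<infinity> \<or> (\<exists>n\<le>cap r. v = enat n)"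
  by (cases v) auto

lemma trunc_val_eq_infinity [simp]: "trunc_val r v = \<infinity> \<longleftrightarrow> v = \<infinity>"
  by (cases v) auto

lemma trunc_val_idem [simp]: "trunc_val r (trunc_val r v) = trunc_val r v"
  by (cases v) auto

lemma trunc_val_zero [simp]: "trunc_val r 0 = 0"
  by (simp add: zero_enat_def)

text \<open>Truncation is a congruence for addition: capping a summand early does not change the
  capped sum. This is what allows counters to saturate.\<close>

lemma trunc_val_add [simp]:
  "trunc_val r (v + trunc_val r w) = trunc_val r (v + w)"
  "trunc_val r (trunc_val r v + w) = trunc_val r (v + w)"
  by (cases v; cases w; simp)+

text \<open>The keys are exactly the rules of the bag. This makes \<open>uplus_t\<close> an
  entrywise operation and allows states to be counted.\<close>

definition state_ok :: "'a rule set \<Rightarrow> 'a state_list \<Rightarrow> bool" where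
  "state_ok R s \<longleftrightarrow> distinct (map fst s) \<and> fst ` set s = R \<and> (\<forall>(r, v)\<in>set s. trunc_val r v = v)"

text \<open>The simulation relation: the list is truncated, while \<open>\<sigma>\<close> is an
  exact rule-state of the mathematical algorithm, so truncation never has to be built into the
  specification.\<close>

definition represents :: "'a state_list \<Rightarrow> 'a rule_state \<Rightarrow> bool" where
  "represents s \<sigma> \<longleftrightarrow> map_of s = trunc_state \<sigma>"

lemma state_ok_dom: "state_ok R s \<Longrightarrow> dom (map_of s) = R"
  by (simp add: state_ok_def dom_map_of_conv_image_fst)

lemma represents_dom: "state_ok R s \<Longrightarrow> represents s \<sigma> \<Longrightarrow> dom \<sigma> = R"
  by (drule state_ok_dom) (auto simp: represents_def trunc_state_def dom_def)

lemma represents_infinity: "represents s \<sigma> \<Longrightarrow> map_of s r = Some \<infinity> \<longleftrightarrow> \<sigma> r = Some \<infinity>"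
  by (simp add: represents_def trunc_state_def)

lemma represents_iff: "represents s \<sigma> \<longleftrightarrow> (\<forall>r. map_of s r = map_option (trunc_val r) (\<sigma> r))"
  by (auto simp: represents_def trunc_state_def)

lemma map_of_map_key: "map_of (map (\<lambda>(k, v). (k, g k v)) xs) k = map_option (g k) (map_of xs k)"
  by (induction xs) auto

lemma state_ok_map:
  assumes "state_ok R s" "\<And>r v. (r, v) \<in> set s \<Longrightarrow> trunc_val r (g r v) = g r v"
  shows "state_ok R (map (\<lambda>(r, v). (r, g r v)) s)"
proof -
  have 1: "map fst (map (\<lambda>(r, v). (r, g r v)) s) = map fst s" by (induction s) auto
  then have 2: "fst ` set (map (\<lambda>(r, v). (r, g r v)) s) = fst ` set s"
    by (metis list.set_map)
  have "\<forall>(r, v)\<in>set (map (\<lambda>(r, v). (r, g r v)) s). trunc_val r v = v"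
    using assms(2) by auto
  then show ?thesis using assms(1) unfolding state_ok_def 1 2 by blast
qed

lemma val_mark_t:
  "val (mark_t f R s) = map (\<lambda>(r, v). (r, if r \<in> set R \<and> val (f r) then \<infinity> else v)) s"
  by (simp add: mark_t_def split_def val_if)

lemma state_ok_mark: "state_ok R s \<Longrightarrow> state_ok R (val (mark_t f R' s))"
  unfolding val_mark_t by (rule state_ok_map) (auto simp: state_ok_def)

text \<open>The test has to be right only at rules whose value is finite: at the others the sum is
  infinity whatever is added, and \<open>mark_t\<close> leaves infinity whatever the test
  says.\<close>

lemma represents_mark:
  assumes s: "state_ok R s" "represents s \<sigma>" and sub: "set R' \<subseteq> R"
    and f: "\<And>r. r \<in> set R' \<Longrightarrow> \<sigma> r \<noteq> Some \<infinity> \<Longrightarrow> val (f r) \<longleftrightarrow> sat M (F r)"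
  shows "represents (val (mark_t f R' s)) (\<sigma> \<uplus> SatRules (\<lambda>r. if r \<in> set R' then Some (F r) else None) M)"
proof -
  have dom: "dom \<sigma> = R" using represents_dom[OF s] .
  have "map_of (val (mark_t f R' s)) r =
      map_option (trunc_val r) ((\<sigma> \<uplus> SatRules (\<lambda>r. if r \<in> set R' then Some (F r) else None) M) r)" for r
  proof (cases "\<sigma> r")
    case None
    then have "r \<notin> set R'" using dom sub by auto
    then show ?thesis using None s(2)
      by (simp add: val_mark_t map_of_map_key uplus_def SatRules_def represents_iff)
  next
    case (Some v)
    then have "map_of s r = Some (trunc_val r v)" using s(2) by (simp add: represents_iff)
    then show ?thesis using Some f[of r]
      by (cases "v = \<infinity>") (auto simp: val_mark_t map_of_map_key uplus_def SatRules_def)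
  qed
  then show "represents (val (mark_t f R' s))
    (\<sigma> \<uplus> SatRules (\<lambda>r. if r \<in> set R' then Some (F r) else None) M)"
    by (simp add: represents_iff)
qed

text \<open>Both states have the same keys, so the part of \<open>uplus_t\<close> that appends the
  remaining entries of the second state contributes nothing.\<close>

lemma val_uplus_t:
  assumes "state_ok R s" "state_ok R s'"
  shows "val (uplus_t s s') = map (\<lambda>(r, v). (r, case map_of s' r of None \<Rightarrow> v | Some u \<Rightarrow> trunc_val r (v + u))) s"
proof -
  have "fst ` set s' = fst ` set s" using assms by (simp add: state_ok_def)
  then have "r \<in> fst ` set s" if "(r, v) \<in> set s'" for r v
    using that by (metis fst_conv image_eqI)
  then have "filter (\<lambda>(r, v). map_of s r = None) s' = []"
    by (auto simp: filter_empty_conv map_of_eq_None_iff)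
  then show ?thesis by (simp add: uplus_t_def split_def)
qed

lemma state_ok_uplus:
  assumes "state_ok R s" "state_ok R s'"
  shows "state_ok R (val (uplus_t s s'))"
  unfolding val_uplus_t[OF assms] using assms(1)
  by (intro state_ok_map) (auto simp: state_ok_def split: option.split)

lemma represents_uplus:
  assumes "state_ok R s" "state_ok R s'" "represents s \<sigma>" "represents s' \<sigma>'"
  shows "represents (val (uplus_t s s')) (\<sigma> \<uplus> \<sigma>')"
proof -
  have dom: "dom \<sigma> = R" "dom \<sigma>' = R" using assms by (auto simp: represents_dom)
  have "map_of (val (uplus_t s s')) r = map_option (trunc_val r) ((\<sigma> \<uplus> \<sigma>') r)" for r
    unfolding val_uplus_t[OF assms(1,2)] map_of_map_key
    using assms(3,4) dom by (auto simp: represents_iff uplus_def split: option.splits)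
  then show ?thesis by (simp add: represents_iff)
qed

lemma val_updt_t: "val (updt_t a M C s) =
    map (\<lambda>(r, v). (r, trunc_val r (v + enat (contribution a (a \<in> set M) (a \<in> set C) r)))) s"
  by (simp add: updt_t_def split_def)

lemma state_ok_updt: "state_ok R s \<Longrightarrow> state_ok R (val (updt_t a M C s))"
  unfolding val_updt_t by (intro state_ok_map) auto

text \<open>An undefined value of \<open>U\<close> is read as 0: the mathematical update leaves some
  rules out, whereas the algorithm adds a contribution of 0 to them.\<close>

lemma represents_updt:
  assumes "state_ok R s" "represents s \<sigma>"
    and "\<And>r. r \<in> R \<Longrightarrow> (case U r of None \<Rightarrow> 0 | Some u \<Rightarrow> u) = enat (contribution a (a \<in> set M) (a \<in> set C) r)"
    and "\<And>r. r \<notin> R \<Longrightarrow> U r = None"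
  shows "represents (val (updt_t a M C s)) (\<sigma> \<uplus> U)"
proof -
  have dom: "dom \<sigma> = R" using represents_dom[OF assms(1,2)] .
  have "map_of (val (updt_t a M C s)) r = map_option (trunc_val r) ((\<sigma> \<uplus> U) r)" for r
  proof (cases "r \<in> R")
    case True
    then show ?thesis unfolding val_updt_t map_of_map_key
      using assms(2) assms(3)[OF True, symmetric] dom
      by (auto simp: represents_iff uplus_def split: option.splits)
  next
    case False
    then have "\<sigma> r = None" "U r = None" using dom assms(4) by auto
    then show ?thesis unfolding val_updt_t map_of_map_key using assms(2) by (simp add: represents_iff uplus_def)
  qed
  then show "represents (val (updt_t a M C s)) (\<sigma> \<uplus> U)" by (simp add: represents_iff)
qed

lemma val_delete_t: "val (delete_t x xs) = filter (\<lambda>y. y \<noteq> x) xs"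
  by (simp add: delete_t_def)

lemma val_delete_key_t: "val (delete_key_t k xs) = filter (\<lambda>y. fst y \<noteq> k) xs"
  by (simp add: delete_key_t_def)

lemma map_of_delete_key: "map_of (filter (\<lambda>y. fst y \<noteq> k) xs) = (map_of xs)(k := None)"
  by (induction xs) auto

lemma state_ok_delete: "state_ok R s \<Longrightarrow> state_ok (R - {r}) (val (delete_key_t r s))"
  by (auto simp: state_ok_def val_delete_key_t distinct_map_filter)

lemma represents_delete: "represents s \<sigma> \<Longrightarrow> represents (val (delete_key_t r s)) (\<sigma>(r := None))"
  by (auto simp: represents_iff val_delete_key_t map_of_delete_key)

lemma state_ok_Cons: "state_ok R s \<Longrightarrow> r \<notin> R \<Longrightarrow> state_ok (insert r R) ((r, 0) # s)"
  by (auto simp: state_ok_def)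

lemma represents_Cons: "represents s \<sigma> \<Longrightarrow> represents ((r, 0) # s) (\<sigma>(r \<mapsto> 0))"
  by (auto simp: represents_iff)

section \<open>Satisfaction tests\<close>

lemma val_hit_t [simp]: "val (hit_t S X M) \<longleftrightarrow> S \<inter> set X \<inter> set M \<noteq> {}"
  by (auto simp: hit_t_def)

lemma val_miss_t [simp]: "val (miss_t S X M) \<longleftrightarrow> \<not> S \<inter> set X \<subseteq> set M"
  by (auto simp: miss_t_def)

lemma val_weigh_in_t: "distinct X \<Longrightarrow> val (weigh_in_t w S X M) = sum w (S \<inter> set X \<inter> set M)"
proof -
  assume "distinct X"
  then have "val (weigh_in_t w S X M) = (\<Sum>a\<in>set X. if a \<in> S \<and> a \<in> set M then w a else 0)"
    by (simp add: weigh_in_t_def sum_list_distinct_conv_sum_set)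
  also have "\<dots> = sum w {a \<in> set X. a \<in> S \<and> a \<in> set M}"
    by (simp add: sum.inter_filter)
  also have "{a \<in> set X. a \<in> S \<and> a \<in> set M} = S \<inter> set X \<inter> set M" by auto
  finally show ?thesis .
qed

lemma val_weigh_out_t: "distinct X \<Longrightarrow> val (weigh_out_t w S X M) = sum w (S \<inter> set X - set M)"
proof -
  assume "distinct X"
  then have "val (weigh_out_t w S X M) = (\<Sum>a\<in>set X. if a \<in> S \<and> a \<notin> set M then w a else 0)"
    by (simp add: weigh_out_t_def sum_list_distinct_conv_sum_set)
  also have "\<dots> = sum w {a \<in> set X. a \<in> S \<and> a \<notin> set M}"
    by (simp add: sum.inter_filter)
  also have "{a \<in> set X. a \<in> S \<and> a \<notin> set M} = S \<inter> set X - set M" by auto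
  finally show ?thesis .
qed

definition totals :: "'a totals" where
  "totals = (\<lambda>r. (wght_set r (at_rule r), card (heads r)))"

definition seen_val :: "'a set \<Rightarrow> 'a rule \<Rightarrow> nat \<times> nat" where
  "seen_val B r = (wght_set r B, card (heads r \<inter> B))"

lemma wght_outside: "wf_rule r \<Longrightarrow> a \<notin> at_rule r \<Longrightarrow> wght r a = 0"
  by (auto simp: wf_rule_def at_rule_def)

lemma wght_set_Int: "wf_rule r \<Longrightarrow> finite B \<Longrightarrow> wght_set r B = wght_set r (at_rule r \<inter> B)"
  unfolding wght_set_def by (rule sum.mono_neutral_right) (auto dest: wght_outside)

lemma finite_heads: "wf_rule r \<Longrightarrow> finite (heads r)"
  by (simp add: wf_rule_def at_rule_def)

text \<open>Total minus seen part is the part outside \<open>B\<close>. The atoms of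
  \<open>B\<close> that do not occur in \<open>r\<close> do no harm, as \<open>wf_rule\<close> gives
  them weight 0.\<close>

lemma val_unseen_t:
  assumes "wf_rule r" "finite B" "map_of seen r = Some (seen_val B r)"
  shows "val (unseen_t totals seen r) = (wght_set r (at_rule r - B), card (heads r - B))"
proof -
  have f: "finite (at_rule r)" using assms by (simp add: wf_rule_def)
  have "wght_set r (at_rule r) = wght_set r (at_rule r \<inter> B) + wght_set r (at_rule r - B)"
    unfolding wght_set_def using f by (metis sum.Int_Diff)
  moreover have "card (heads r) = card (heads r \<inter> B) + card (heads r - B)"
    using finite_heads[OF assms(1)] by (metis card_Int_Diff)
  ultimately show ?thesis
    using assms wght_set_Int[OF assms(1,2)] by (simp add: unseen_t_def totals_def seen_val_def)
qed

lemma val_counter_t: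
  "represents s \<sigma> \<Longrightarrow> val (counter_t s r) = min (counter \<sigma> r) (cap r)"
  by (cases "\<sigma> r") (auto simp: counter_t_def represents_iff counter_def split: enat.split)

lemma sum_restrict: "A \<subseteq> X \<Longrightarrow> (\<Sum>a\<in>A. if a \<in> X then w a else 0) = sum w A"
  by (rule sum.cong) auto

lemma val_sat_state_t:
  assumes wf: "wf_rule r" and fin: "finite (atoms_below t)"
    and seen: "map_of seen r = Some (seen_val (atoms_below t) r)"
    and X: "distinct X" "set X = atoms_at t" and s: "represents s \<sigma>" and r: "\<sigma> r \<noteq> Some \<infinity>"
  shows "val (sat_state_t totals seen X s M r) \<longleftrightarrow> sat (set M) (state_program t \<sigma> {r})"
proof (cases r)
  case (Choice H P N)
  note u = val_unseen_t[OF wf fin seen]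
  have h: "snd (val (unseen_t totals seen r)) = 0 \<longleftrightarrow> heads r \<subseteq> atoms_below t"
    using u finite_heads[OF wf] by auto
  have c: "map_of s (constraint_of r) = Some \<infinity> \<longleftrightarrow> \<sigma> (constraint_of r) = Some \<infinity>"
    using represents_infinity[OF s] .
  \<comment> \<open>The choice rule itself is satisfied by every set. Only the added constraint can
    fail, and it is present if some head atom has not been seen and its own value is not
    infinity.\<close>
  have "val (sat_state_t totals seen X s M r) \<longleftrightarrow> heads r \<subseteq> atoms_below t \<or>
      \<sigma> (constraint_of r) = Some \<infinity> \<or> N \<inter> set X \<inter> set M \<noteq> {} \<or> \<not> P \<inter> set X \<subseteq> set M"
    using h c unfolding Choice by (auto simp: split_def)
  also have "\<dots> \<longleftrightarrow> sat (set M) (state_program t \<sigma> {r})"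
    using r X(2) unfolding Choice
    by (auto simp: sat_def state_program_def constraint_of_def)
  finally show ?thesis .
next
  case (Disj H P N)
  then show ?thesis using r X(2) by (auto simp: sat_def state_program_def)
next
  case (Weight H P N w b)
  note u = val_unseen_t[OF wf fin seen]
  have dis: "P \<inter> N = {}" using wf Weight by (simp add: wf_rule_def)
  let ?X = "atoms_at t"
  let ?c = "b - counter \<sigma> r - wght_set r (at_rule r - atoms_below t)"
  have sp: "state_program t \<sigma> {r} =
      {Weight (H \<inter> ?X) (P \<inter> ?X) (N \<inter> ?X) (\<lambda>a. if a \<in> ?X then w a else 0) ?c}"
    using r unfolding Weight by (auto simp: state_program_def)
  have "wght_set (Weight (H \<inter> ?X) (P \<inter> ?X) (N \<inter> ?X) (\<lambda>a. if a \<in> ?X then w a else 0) ?c)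
      (set M \<inter> (P \<inter> ?X) \<union> (N \<inter> ?X - set M)) = sum w (set M \<inter> (P \<inter> ?X) \<union> (N \<inter> ?X - set M))"
    unfolding wght_set_def wght.simps by (rule sum_restrict) auto
  also have "\<dots> = sum w (P \<inter> ?X \<inter> set M) + sum w (N \<inter> ?X - set M)"
  proof -
    have "finite (atoms_at t)" using X(2) by (metis finite_set)
    then show ?thesis using dis by (subst sum.union_disjoint) (auto simp: Int_ac)
  qed
  finally have sum: "wght_set (Weight (H \<inter> ?X) (P \<inter> ?X) (N \<inter> ?X) (\<lambda>a. if a \<in> ?X then w a else 0) ?c)
      (set M \<inter> (P \<inter> ?X) \<union> (N \<inter> ?X - set M)) = sum w (P \<inter> ?X \<inter> set M) + sum w (N \<inter> ?X - set M)" .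
  \<comment> \<open>The one place where a weight counter is read. Subtraction stops at 0, so capping
    the counter at \<open>b\<close> does not alter the new bound.\<close>
  have "b - min (counter \<sigma> r) b - x = b - counter \<sigma> r - x" for x by (simp add: min_def)
  then have "val (sat_state_t totals seen X s M r) \<longleftrightarrow> H \<inter> ?X \<inter> set M \<noteq> {} \<or>
      sum w (P \<inter> ?X \<inter> set M) + sum w (N \<inter> ?X - set M) < ?c"
    using u val_counter_t[OF s, of r] unfolding Weight
    by (simp add: split_def X(2) val_weigh_in_t[OF X(1)] val_weigh_out_t[OF X(1)] del: diff_diff_left)
  then show ?thesis unfolding sp sat_def by (simp add: sum del: diff_diff_left)
qed

text \<open>For a choice rule the reduct consists of one rule per head atom in \<open>M\<close>,
  plus possibly the constraint with the same positive body. All of them hold if \<open>N\<close>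
  meets \<open>M\<close> or \<open>P\<close> is not contained in \<open>C\<close>; otherwise
  \<open>C\<close> must contain the head atoms in \<open>M\<close>, and the constraint must be
  absent.\<close>

lemma val_sat_reduct_t:
  assumes wf: "wf_rule r" and fin: "finite (atoms_below t)"
    and seen: "map_of seen r = Some (seen_val (atoms_below t) r)"
    and X: "distinct X" "set X = atoms_at t" and s: "represents s \<sigma>" and r: "\<sigma> r \<noteq> Some \<infinity>"
    and dom: "r \<in> dom \<sigma>"
  shows "val (sat_reduct_t totals seen X s M C r) \<longleftrightarrow>
    sat (set C) (state_program_reduct t \<sigma> (set M) {r})"
proof (cases r)
  case (Choice H P N)
  note u = val_unseen_t[OF wf fin seen]
  let ?X = "atoms_at t"
  obtain n where n: "\<sigma> r = Some (enat n)" using r dom by (metis domD not_enat_eq)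
  have h: "snd (val (unseen_t totals seen r)) = 0 \<longleftrightarrow> heads r \<subseteq> atoms_below t"
    using u finite_heads[OF wf] by auto
  have k: "val (counter_t s r) = 0 \<longleftrightarrow> n = 0"
    using val_counter_t[OF s, of r] n Choice by (auto simp: counter_def)
  have c: "map_of s (constraint_of r) = Some \<infinity> \<longleftrightarrow> \<sigma> (constraint_of r) = Some \<infinity>"
    using represents_infinity[OF s] .
  \<comment> \<open>The constraint survives into the state-program. It is requested from two sides,
    by an unseen head atom or by a positive counter, and it is deleted if its own value is
    infinity.\<close>
  define Q where "Q \<longleftrightarrow> (\<not> heads r \<subseteq> atoms_below t \<or> n > 0) \<and> \<sigma> (constraint_of r) \<noteq> Some \<infinity>"
  have "val (sat_reduct_t totals seen X s M C r) \<longleftrightarrow> N \<inter> ?X \<inter> set M \<noteq> {} \<or> \<not> P \<inter> ?X \<subseteq> set C \<or>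
      H \<inter> ?X \<inter> set M \<subseteq> set C \<and> \<not> Q"
    using h c k unfolding Choice Q_def by (auto simp: split_def X(2))
  also have "\<dots> \<longleftrightarrow> sat (set C) (state_program_reduct t \<sigma> (set M) {r})"
  proof -
    let ?c = "constraint_of r"
    let ?E = "{constraint_of r' |r'. r' \<in> {r} \<and> is_Choice r' \<and> (\<exists>n. \<sigma> r' = Some n \<and> 0 < n)}"
    \<comment> \<open>The constraint added for a positive counter is passed to
      \<open>state_program\<close>, which adds constraints itself. Not being a choice rule, it does
      not trigger another one.\<close>
    have "\<not> is_Choice ?c" by (simp add: constraint_of_def)
    moreover have E: "?E = (if n > 0 then {?c} else {})"
      using n by (auto simp: Choice zero_enat_def)
    ultimately have "{constraint_of r' |r'. r' \<in> {r} \<union> ?E \<and> is_Choice r' \<and> \<not> heads r' \<subseteq> atoms_below t} =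
        (if \<not> heads r \<subseteq> atoms_below t then {?c} else {})"
      unfolding E by (auto simp: Choice intro!: exI[of _ "Choice H P N"])
    then have "{r' \<in> ({r} \<union> ?E) \<union> {constraint_of r' |r'. r' \<in> {r} \<union> ?E \<and> is_Choice r' \<and> \<not> heads r' \<subseteq> atoms_below t}.
        \<sigma> r' \<noteq> Some \<infinity>} = (if Q then {r, ?c} else {r})"
      unfolding E Q_def using r by auto
    then have "state_program t \<sigma> ({r} \<union> {constraint_of r' |r'. r' \<in> {r} \<and> is_Choice r' \<and> (\<exists>n. \<sigma> r' = Some n \<and> 0 < n)}) =
       (if Q then {Choice (H \<inter> ?X) (P \<inter> ?X) (N \<inter> ?X), Disj {} (P \<inter> ?X) (N \<inter> ?X)}
        else {Choice (H \<inter> ?X) (P \<inter> ?X) (N \<inter> ?X)})"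
      unfolding state_program_def by (simp add: constraint_of_def Choice)
    then show ?thesis unfolding state_program_reduct_def reduct_def sat_def by auto
  qed
  finally show ?thesis .
next
  case (Disj H P N)
  then show ?thesis using r X(2)
    by (auto simp: sat_def state_program_reduct_def reduct_def state_program_def)
next
  case (Weight H P N w b)
  note u = val_unseen_t[OF wf fin seen]
  let ?X = "atoms_at t"
  let ?w = "\<lambda>a. if a \<in> ?X then w a else 0"
  let ?c = "b - counter \<sigma> r - wght_set r (at_rule r - atoms_below t)"
  let ?r = "Weight (H \<inter> ?X) (P \<inter> ?X) (N \<inter> ?X) ?w ?c"
  have "{r} \<union> {constraint_of r' |r'. r' \<in> {r} \<and> is_Choice r' \<and> (\<exists>n. \<sigma> r' = Some n \<and> 0 < n)} = {r}"
    unfolding Weight by auto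
  then have sp: "state_program_reduct t \<sigma> (set M) {r} = reduct_rule (set M) ?r"
    using r unfolding state_program_reduct_def Weight
    by (auto simp: reduct_def state_program_def)
  have n: "wght_set ?r (N \<inter> ?X - set M) = sum w (N \<inter> ?X - set M)"
    unfolding wght_set_def wght.simps by (rule sum_restrict) auto
  have p: "(\<Sum>a\<in>set C \<inter> (P \<inter> ?X). if a \<in> P \<inter> ?X then ?w a else 0) = sum w (P \<inter> ?X \<inter> set C)"
    by (rule sum.cong) auto
  have "b - min (counter \<sigma> r) b - x = b - counter \<sigma> r - x" for x by (simp add: min_def)
  then have "val (sat_reduct_t totals seen X s M C r) \<longleftrightarrow> H \<inter> ?X \<inter> set C \<noteq> {} \<or>
      sum w (P \<inter> ?X \<inter> set C) + sum w (N \<inter> ?X - set M) < ?c"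
    using u val_counter_t[OF s, of r] unfolding Weight
    by (simp add: split_def X(2) val_weigh_in_t[OF X(1)] val_weigh_out_t[OF X(1)] del: diff_diff_left)
  \<comment> \<open>The reduct moves the weight of the negative part into the bound;
    \<open>p + n < c\<close> and \<open>p < c - n\<close> agree for natural numbers with truncated
    subtraction.\<close>
  also have "\<dots> \<longleftrightarrow> sat (set C) (reduct_rule (set M) ?r)"
    unfolding sat_def reduct_rule.simps n
    using p by (auto simp: wght_set_def less_diff_conv)
  finally show ?thesis unfolding sp .
qed

section \<open>Candidates and rows\<close>

definition cand_of :: "'a list \<times> 'a state_list \<Rightarrow> 'a set \<times> 'a rule_state" where
  "cand_of = (\<lambda>(C, \<rho>). (set C, map_of \<rho>))"

definition trunc_cand :: "'a set \<times> 'a rule_state \<Rightarrow> 'a set \<times> 'a rule_state" where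
  "trunc_cand = (\<lambda>(C, \<rho>). (C, trunc_state \<rho>))"

lemma row_of_simp: "row_of (M, s, cs) = (set M, map_of s, cand_of ` set cs)"
  by (simp add: row_of_def cand_of_def)

lemma trunc_row_simp: "trunc_row (M, \<sigma>, CC) = (M, trunc_state \<sigma>, trunc_cand ` CC)"
  by (simp add: trunc_row_def trunc_cand_def)

lemma cand_sim_iff: "cand_of (C, s) = trunc_cand (C', \<rho>) \<longleftrightarrow> set C = C' \<and> represents s \<rho>"
  by (simp add: cand_of_def trunc_cand_def represents_def)

lemma row_sim_iff: "row_of (M, s, cs) = trunc_row (M', \<sigma>, CC) \<longleftrightarrow>
  set M = M' \<and> represents s \<sigma> \<and> cand_of ` set cs = trunc_cand ` CC"
  by (simp add: row_of_simp trunc_row_simp represents_def)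

text \<open>Tables are compared through two maps, \<open>h\<close> abstracting from lists and
  \<open>k\<close> truncating the mathematical side, and neither is injective. Equality of images
  survives an operation if its two versions send every pair with equal images to a pair with equal
  images.\<close>

lemma image_sim:
  assumes "h ` X = k ` Y" "\<And>x y. x \<in> X \<Longrightarrow> y \<in> Y \<Longrightarrow> h x = k y \<Longrightarrow> h' (f x) = k' (g y)"
  shows "h' ` f ` X = k' ` g ` Y"
proof (intro equalityI subsetI)
  fix z assume "z \<in> h' ` f ` X"
  then obtain x where x: "x \<in> X" "z = h' (f x)" by blast
  then have "h x \<in> k ` Y" using assms(1) by blast
  then show "z \<in> k' ` g ` Y" using x assms(2) by auto
next
  fix z assume "z \<in> k' ` g ` Y"
  then obtain y where y: "y \<in> Y" "z = k' (g y)" by blast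
  then have "k y \<in> h ` X" using assms(1) by blast
  then obtain x where "x \<in> X" "h x = k y" by (metis imageE)
  then show "z \<in> h' ` f ` X" using y assms(2)[of x y] by (metis image_eqI)
qed

text \<open>The version for operations that turn one row into several rows or none, as introducing
  an atom and joining do.\<close>

lemma UN_sim:
  assumes "h ` X = k ` Y" "\<And>x y. x \<in> X \<Longrightarrow> y \<in> Y \<Longrightarrow> h x = k y \<Longrightarrow> h' ` F x = k' ` G y"
  shows "h' ` (\<Union>x\<in>X. F x) = k' ` (\<Union>y\<in>Y. G y)"
proof -
  have "(`) h' ` F ` X = (`) k' ` G ` Y"
    by (rule image_sim[OF assms(1)]) (rule assms(2))
  then have "(\<Union>x\<in>X. h' ` F x) = (\<Union>y\<in>Y. k' ` G y)" by (simp add: image_image)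
  then show ?thesis by (simp add: image_UN)
qed

definition cand_ok :: "'a set \<Rightarrow> 'a rule set \<Rightarrow> 'a list \<times> 'a state_list \<Rightarrow> bool" where
  "cand_ok A R = (\<lambda>(C, s). distinct C \<and> set C \<subseteq> A \<and> state_ok R s)"

text \<open>Duplicates are excluded modulo \<open>cand_of\<close>, because different lists can
  denote the same candidate. In this form the number of abstract candidates bounds the length of the
  list.\<close>

definition row_ok :: "'a set \<Rightarrow> 'a rule set \<Rightarrow> 'a list \<times> 'a state_list \<times> 'a cand_list \<Rightarrow> bool" where
  "row_ok A R = (\<lambda>(M, s, cs). distinct M \<and> set M \<subseteq> A \<and> state_ok R s \<and>
     (\<forall>c\<in>set cs. cand_ok A R c) \<and> distinct (map cand_of cs))"

definition table_ok :: "'a set \<Rightarrow> 'a rule set \<Rightarrow> 'a row_list \<Rightarrow> bool" where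
  "table_ok A R \<tau> \<longleftrightarrow> (\<forall>x\<in>set \<tau>. row_ok A R x) \<and> distinct (map row_of \<tau>)"

lemma val_atoms_eq_t [simp]: "val (atoms_eq_t C C') \<longleftrightarrow> set C = set C'"
  unfolding atoms_eq_t_def using val_set_eq_t[where f = id, of C C' "\<lambda>x y. prim (x = y)"] by auto

lemma val_state_eq_t:
  assumes "state_ok R s" "state_ok R s'"
  shows "val (state_eq_t s s') \<longleftrightarrow> map_of s = map_of s'"
proof -
  have "val (state_eq_t s s') \<longleftrightarrow> set s = set s'"
    unfolding state_eq_t_def using val_set_eq_t[where f = id, of s s' "\<lambda>x y. prim (x = y)"] by auto
  then show ?thesis using assms by (simp add: map_of_inject_set state_ok_def)
qed

lemma val_cand_eq_t:
  assumes "cand_ok A R x" "cand_ok A R y"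
  shows "val (cand_eq_t x y) \<longleftrightarrow> cand_of x = cand_of y"
  using assms by (auto simp: cand_eq_t_def cand_of_def cand_ok_def val_state_eq_t split: prod.splits)

lemma val_row_eq_t:
  assumes "row_ok A R x" "row_ok A R y"
  shows "val (row_eq_t x y) \<longleftrightarrow> row_of x = row_of y"
proof -
  obtain M s cs where x: "x = (M, s, cs)" by (cases x)
  obtain M' s' cs' where y: "y = (M', s', cs')" by (cases y)
  have "val (set_eq_t cand_eq_t cs cs') \<longleftrightarrow> cand_of ` set cs = cand_of ` set cs'"
    using assms by (intro val_set_eq_t) (auto simp: x y row_ok_def val_cand_eq_t)
  moreover have "val (state_eq_t s s') \<longleftrightarrow> map_of s = map_of s'"
    using assms by (intro val_state_eq_t) (auto simp: x y row_ok_def)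
  ultimately show ?thesis by (auto simp: x y row_eq_t_def row_of_simp)
qed

lemma nub_cands:
  assumes "\<And>c. c \<in> set cs \<Longrightarrow> cand_ok A R c"
  shows "distinct (map cand_of (val (nub_t cand_eq_t cs)))"
    "cand_of ` set (val (nub_t cand_eq_t cs)) = cand_of ` set cs"
    "\<And>c. c \<in> set (val (nub_t cand_eq_t cs)) \<Longrightarrow> cand_ok A R c"
proof -
  have eq: "val (cand_eq_t x y) \<longleftrightarrow> cand_of x = cand_of y" if "x \<in> set cs" "y \<in> set cs" for x y
    using val_cand_eq_t assms that by blast
  show "distinct (map cand_of (val (nub_t cand_eq_t cs)))" by (rule distinct_nub_t) (rule eq)
  show "cand_of ` set (val (nub_t cand_eq_t cs)) = cand_of ` set cs" by (rule image_nub_t) (rule eq)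
  show "\<And>c. c \<in> set (val (nub_t cand_eq_t cs)) \<Longrightarrow> cand_ok A R c"
    using set_nub_t_subset[of cand_eq_t cs] assms by auto
qed

lemma nub_rows:
  assumes "\<And>x. x \<in> set \<tau> \<Longrightarrow> row_ok A R x"
  shows "table_ok A R (val (nub_t row_eq_t \<tau>))"
    "row_of ` set (val (nub_t row_eq_t \<tau>)) = row_of ` set \<tau>"
proof -
  have eq: "val (row_eq_t x y) \<longleftrightarrow> row_of x = row_of y" if "x \<in> set \<tau>" "y \<in> set \<tau>" for x y
    using val_row_eq_t assms that by blast
  have "distinct (map row_of (val (nub_t row_eq_t \<tau>)))" by (rule distinct_nub_t) (rule eq)
  then show "table_ok A R (val (nub_t row_eq_t \<tau>))"
    using set_nub_t_subset[of row_eq_t \<tau>] assms unfolding table_ok_def by blast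
  show "row_of ` set (val (nub_t row_eq_t \<tau>)) = row_of ` set \<tau>" by (rule image_nub_t) (rule eq)
qed

definition seen_ok :: "'a set \<Rightarrow> 'a rule set \<Rightarrow> 'a seen \<Rightarrow> bool" where
  "seen_ok B R seen \<longleftrightarrow> distinct (map fst seen) \<and> fst ` set seen = R \<and>
     (\<forall>r\<in>R. map_of seen r = Some (seen_val B r))"

text \<open>Collects what the satisfaction tests rely on at a node. In particular
  \<open>seen\<close> counts all atoms below \<open>t\<close>, including one that \<open>t\<close>
  itself introduces.\<close>

locale node =
  fixes t :: "'a vertex set rtree" and X :: "'a list" and R :: "'a rule set" and seen :: "'a seen"
  assumes wf: "r \<in> R \<Longrightarrow> wf_rule r" and R: "R = rules_at t"
    and X: "distinct X" "set X = atoms_at t" and fin: "finite (atoms_below t)"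
    and seen: "seen_ok (atoms_below t) R seen"
begin

lemma represents_rs_update:
  assumes "state_ok R s" "represents s \<sigma>" "set R' \<subseteq> R"
  shows "represents (val (rs_update_t totals seen X s M R')) (rs_update t \<sigma> (set M) (set R'))"
proof -
  have "val (sat_state_t totals seen X s M r) \<longleftrightarrow> sat (set M) (state_program t \<sigma> {r})"
    if "r \<in> set R'" "\<sigma> r \<noteq> Some \<infinity>" for r
    using that assms seen X fin wf by (intro val_sat_state_t) (auto simp: seen_ok_def)
  from represents_mark[OF assms this] show ?thesis
    unfolding rs_update_t_def rs_update_def by auto
qed

lemma represents_rs_update_reduct:
  assumes "state_ok R s" "represents s \<sigma>" "set R' \<subseteq> R"
  shows "represents (val (rs_update_reduct_t totals seen X s M C R'))
    (rs_update_reduct t \<sigma> (set M) (set C) (set R'))"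
proof -
  have "val (sat_reduct_t totals seen X s M C r) \<longleftrightarrow> sat (set C) (state_program_reduct t \<sigma> (set M) {r})"
    if "r \<in> set R'" "\<sigma> r \<noteq> Some \<infinity>" for r
    using that assms seen X fin wf represents_dom[OF assms(1,2)]
    by (intro val_sat_reduct_t) (auto simp: seen_ok_def)
  from represents_mark[OF assms this] show ?thesis
    unfolding rs_update_reduct_t_def rs_update_reduct_def by auto
qed

end

lemma state_ok_rs_update: "state_ok R s \<Longrightarrow> state_ok R (val (rs_update_t tot seen X s M R'))"
  unfolding rs_update_t_def by (rule state_ok_mark)

lemma state_ok_rs_update_reduct: "state_ok R s \<Longrightarrow> state_ok R (val (rs_update_reduct_t tot seen X s M C R'))"
  unfolding rs_update_reduct_t_def by (rule state_ok_mark)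

section \<open>The row operations\<close>

text \<open>The share of one row in \<open>intro_atom\<close>, with comprehensions turned into
  images, so that \<open>UN_sim\<close> and \<open>image_sim\<close> apply. The other operations,
  and their timed versions, are cut up in the same way.\<close>

definition intro_row :: "'a vertex set rtree \<Rightarrow> 'a \<Rightarrow> 'a row \<Rightarrow> 'a row set" where
  "intro_row t a = (\<lambda>(M, \<sigma>, CC).
     {(insert a M,
       rs_update t \<sigma> (insert a M) (rules_at t),
       {(M, rs_update_reduct t \<sigma> (insert a M) M (rules_at t))} \<union>
       (\<lambda>(C, \<rho>). (insert a C, rs_update_reduct t \<rho> (insert a M) (insert a C) (rules_at t))) ` CC \<union>
       (\<lambda>(C, \<rho>). (C, rs_update_reduct t \<rho> (insert a M) C (rules_at t))) ` CC),
      (M,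
       rs_update t \<sigma> M (rules_at t),
       (\<lambda>(C, \<rho>). (C, rs_update_reduct t \<rho> M C (rules_at t))) ` CC)})"

lemma Collect_pairs_image: "{f x y | x y. (x, y) \<in> A} = (\<lambda>(x, y). f x y) ` A"
  by force

lemma intro_atom_UN: "intro_atom t a \<tau> = (\<Union>y\<in>\<tau>. intro_row t a y)"
  unfolding intro_atom_def intro_row_def Collect_pairs_image by simp

definition intro_row_t ::
  "'a totals \<Rightarrow> 'a seen \<Rightarrow> 'a list \<Rightarrow> 'a rule list \<Rightarrow> 'a \<Rightarrow> 'a list \<times> 'a state_list \<times> 'a cand_list
     \<Rightarrow> 'a row_list timed" where
  "intro_row_t tot seen X R a = (\<lambda>(M, \<sigma>, cs). do {
       \<sigma>1 \<leftarrow> rs_update_t tot seen X \<sigma> (a # M) R;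
       \<rho>0 \<leftarrow> rs_update_reduct_t tot seen X \<sigma> (a # M) M R;
       cs1 \<leftarrow> map_t (\<lambda>(C, \<rho>). do {
         \<rho> \<leftarrow> rs_update_reduct_t tot seen X \<rho> (a # M) (a # C) R;
         prim (a # C, \<rho>) }) cs;
       cs2 \<leftarrow> map_t (\<lambda>(C, \<rho>). do {
         \<rho> \<leftarrow> rs_update_reduct_t tot seen X \<rho> (a # M) C R;
         prim (C, \<rho>) }) cs;
       cs12 \<leftarrow> append_t cs1 cs2;
       cs3 \<leftarrow> nub_t cand_eq_t ((M, \<rho>0) # cs12);
       \<sigma>2 \<leftarrow> rs_update_t tot seen X \<sigma> M R;
       cs4 \<leftarrow> map_t (\<lambda>(C, \<rho>). do {
         \<rho> \<leftarrow> rs_update_reduct_t tot seen X \<rho> M C R;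
         prim (C, \<rho>) }) cs;
       cs5 \<leftarrow> nub_t cand_eq_t cs4;
       prim [(a # M, \<sigma>1, cs3), (M, \<sigma>2, cs5)] })"

lemma intro_atom_t_alt:
  "intro_atom_t tot X R a = (\<lambda>(seen, \<tau>). do {
     seen \<leftarrow> map_t (\<lambda>(r, w, h).
       prim (r, w + wght r a, h + (if a \<in> heads r then 1 else 0))) seen;
     rss \<leftarrow> map_t (intro_row_t tot seen X R a) \<tau>;
     rs \<leftarrow> concat_t rss;
     rs \<leftarrow> nub_t row_eq_t rs;
     prim (seen, rs) })"
  by (simp add: intro_atom_t_def intro_row_t_def)

lemma row_ok_nubI:
  assumes "distinct M" "set M \<subseteq> A" "state_ok R s" "\<And>c. c \<in> set cs \<Longrightarrow> cand_ok A R c"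
  shows "row_ok A R (M, s, val (nub_t cand_eq_t cs))"
  using assms nub_cands[OF assms(4)] by (simp add: row_ok_def)

text \<open>Well-formedness does not depend on the outcome of the tests, hence the arbitrary
  \<open>tot\<close> and \<open>seen\<close>; the step count reuses the lemma in this generality.
  Freshness of \<open>a\<close> keeps the extended lists distinct.\<close>

lemma row_ok_intro:
  assumes x: "row_ok A R x" and a: "a \<notin> A" and z: "z \<in> set (val (intro_row_t tot seen X R' a x))"
  shows "row_ok (insert a A) R z"
proof -
  obtain M s cs where xe: "x = (M, s, cs)" by (cases x)
  have M: "distinct M" "set M \<subseteq> A" "state_ok R s" "\<And>c. c \<in> set cs \<Longrightarrow> cand_ok A R c"
    using x(1) unfolding xe row_ok_def by auto
  define f1 where "f1 = (\<lambda>(C, \<rho>). (a # C, val (rs_update_reduct_t tot seen X \<rho> (a # M) (a # C) R')))"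
  define f2 where "f2 = (\<lambda>N (C, \<rho>). (C :: 'a list, val (rs_update_reduct_t tot seen X \<rho> N C R')))"
  have aM: "a \<notin> set M" using M a by auto
  have ok1: "cand_ok (insert a A) R (f1 c)" if "c \<in> set cs" for c
    using M(4)[OF that] a by (cases c) (auto simp: f1_def cand_ok_def state_ok_rs_update_reduct)
  have ok2: "cand_ok (insert a A) R (f2 N c)" if "c \<in> set cs" for c N
    using M(4)[OF that] by (cases c) (auto simp: f2_def cand_ok_def state_ok_rs_update_reduct)
  have ok0: "cand_ok (insert a A) R (M, val (rs_update_reduct_t tot seen X s (a # M) M R'))"
    using M by (auto simp: cand_ok_def state_ok_rs_update_reduct)
  let ?l1 = "(M, val (rs_update_reduct_t tot seen X s (a # M) M R')) # map f1 cs @ map (f2 (a # M)) cs"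
  let ?l2 = "map (f2 M) cs"
  have okl: "cand_ok (insert a A) R c" if "c \<in> set ?l1 \<or> c \<in> set ?l2" for c
    using that ok0 ok1 ok2 by auto
  have val: "val (intro_row_t tot seen X R' a x) =
    [(a # M, val (rs_update_t tot seen X s (a # M) R'), val (nub_t cand_eq_t ?l1)),
     (M, val (rs_update_t tot seen X s M R'), val (nub_t cand_eq_t ?l2))]"
    unfolding xe by (simp add: intro_row_t_def f1_def f2_def split_def)
  have "row_ok (insert a A) R (a # M, val (rs_update_t tot seen X s (a # M) R'), val (nub_t cand_eq_t ?l1))"
    by (rule row_ok_nubI[OF _ _ state_ok_rs_update[OF M(3)] okl[OF disjI1]]) (use M aM in auto)
  moreover have "row_ok (insert a A) R (M, val (rs_update_t tot seen X s M R'), val (nub_t cand_eq_t ?l2))"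
    by (rule row_ok_nubI[OF _ _ state_ok_rs_update[OF M(3)] okl[OF disjI2]]) (use M in auto)
  ultimately show ?thesis using z unfolding val by auto
qed

lemma (in node) row_of_intro_row_t:
  assumes x: "row_ok A R x" "row_of x = trunc_row y" and a: "a \<notin> A" and R': "set R' = R"
  shows "row_of ` set (val (intro_row_t totals seen X R' a x)) = trunc_row ` intro_row t a y"
proof -
  obtain M s cs where xe: "x = (M, s, cs)" by (cases x)
  obtain M' \<sigma> CC where ye: "y = (M', \<sigma>, CC)" by (cases y)
  have M: "distinct M" "set M \<subseteq> A" "state_ok R s" "\<And>c. c \<in> set cs \<Longrightarrow> cand_ok A R c"
    using x(1) unfolding xe row_ok_def by auto
  have sim: "M' = set M" "represents s \<sigma>" "cand_of ` set cs = trunc_cand ` CC"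
    using x(2) unfolding xe ye row_sim_iff by auto
  have sub: "set R' \<subseteq> R" using R' by simp
  have Rr: "rules_at t = set R'" using R R' by simp
  note u = represents_rs_update[OF _ _ sub] and v = represents_rs_update_reduct[OF _ _ sub]
  define f1 where "f1 = (\<lambda>(C, \<rho>). (a # C, val (rs_update_reduct_t totals seen X \<rho> (a # M) (a # C) R')))"
  define f2 where "f2 = (\<lambda>N (C, \<rho>). (C :: 'a list, val (rs_update_reduct_t totals seen X \<rho> N C R')))"
  have aM: "a \<notin> set M" using M a by auto
  have ok1: "cand_ok (insert a A) R (f1 c)" if "c \<in> set cs" for c
    using M(4)[OF that] a by (cases c) (auto simp: f1_def cand_ok_def state_ok_rs_update_reduct)
  have ok2: "cand_ok (insert a A) R (f2 N c)" if "c \<in> set cs" for c N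
    using M(4)[OF that] by (cases c) (auto simp: f2_def cand_ok_def state_ok_rs_update_reduct)
  have ok0: "cand_ok (insert a A) R (M, val (rs_update_reduct_t totals seen X s (a # M) M R'))"
    using M by (auto simp: cand_ok_def state_ok_rs_update_reduct)
  let ?l1 = "(M, val (rs_update_reduct_t totals seen X s (a # M) M R')) # map f1 cs @ map (f2 (a # M)) cs"
  let ?l2 = "map (f2 M) cs"
  have okl: "cand_ok (insert a A) R c" if "c \<in> set ?l1 \<or> c \<in> set ?l2" for c
    using that ok0 ok1 ok2 by auto
  have val: "val (intro_row_t totals seen X R' a x) =
    [(a # M, val (rs_update_t totals seen X s (a # M) R'), val (nub_t cand_eq_t ?l1)),
     (M, val (rs_update_t totals seen X s M R'), val (nub_t cand_eq_t ?l2))]"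
    unfolding xe by (simp add: intro_row_t_def f1_def f2_def split_def)
  have i1: "cand_of ` f1 ` set cs = trunc_cand ` (\<lambda>(C, \<rho>). (insert a C,
      rs_update_reduct t \<rho> (insert a M') (insert a C) (rules_at t))) ` CC"
  proof (rule image_sim[OF sim(3)])
    fix c d assume c: "c \<in> set cs" "d \<in> CC" "cand_of c = trunc_cand d"
    obtain C \<rho>' where ce: "c = (C, \<rho>')" by (cases c)
    obtain D \<rho> where de: "d = (D, \<rho>)" by (cases d)
    have "set C = D" "represents \<rho>' \<rho>" "state_ok R \<rho>'"
      using c(3) M(4)[OF c(1)] unfolding ce de cand_sim_iff by (auto simp: cand_ok_def)
    then show "cand_of (f1 c) = trunc_cand (case d of (C, \<rho>) \<Rightarrow> (insert a C,
        rs_update_reduct t \<rho> (insert a M') (insert a C) (rules_at t)))"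
      unfolding ce de f1_def using v[of \<rho>' \<rho> "a # M" "a # C"] by (simp add: cand_sim_iff Rr sim(1))
  qed
  have i2: "cand_of ` f2 N ` set cs = trunc_cand ` (\<lambda>(C, \<rho>). (C,
      rs_update_reduct t \<rho> (set N) C (rules_at t))) ` CC" for N
  proof (rule image_sim[OF sim(3)])
    fix c d assume c: "c \<in> set cs" "d \<in> CC" "cand_of c = trunc_cand d"
    obtain C \<rho>' where ce: "c = (C, \<rho>')" by (cases c)
    obtain D \<rho> where de: "d = (D, \<rho>)" by (cases d)
    have "set C = D" "represents \<rho>' \<rho>" "state_ok R \<rho>'"
      using c(3) M(4)[OF c(1)] unfolding ce de cand_sim_iff by (auto simp: cand_ok_def)
    then show "cand_of (f2 N c) = trunc_cand (case d of (C, \<rho>) \<Rightarrow> (C,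
        rs_update_reduct t \<rho> (set N) C (rules_at t)))"
      unfolding ce de f2_def using v[of \<rho>' \<rho> N C] by (simp add: cand_sim_iff Rr)
  qed
  \<comment> \<open>The candidate \<open>M\<close> of the row for \<open>M\<close> with
    \<open>a\<close> has no predecessor among the candidates; it starts from the state
    \<open>\<sigma>\<close> of the row itself.\<close>
  have i0: "cand_of (M, val (rs_update_reduct_t totals seen X s (a # M) M R')) =
      trunc_cand (M', rs_update_reduct t \<sigma> (insert a M') M' (rules_at t))"
    using v[OF M(3) sim(2), of "a # M" M] by (simp add: cand_sim_iff Rr sim(1))
  have n1: "cand_of ` set (val (nub_t cand_eq_t ?l1)) = cand_of ` set ?l1"
    by (rule nub_cands(2)[OF okl[OF disjI1]])
  have n2: "cand_of ` set (val (nub_t cand_eq_t ?l2)) = cand_of ` set ?l2"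
    by (rule nub_cands(2)[OF okl[OF disjI2]])
  have r1: "row_of (a # M, val (rs_update_t totals seen X s (a # M) R'), val (nub_t cand_eq_t ?l1)) =
    trunc_row (insert a M', rs_update t \<sigma> (insert a M') (rules_at t),
       {(M', rs_update_reduct t \<sigma> (insert a M') M' (rules_at t))} \<union>
       (\<lambda>(C, \<rho>). (insert a C, rs_update_reduct t \<rho> (insert a M') (insert a C) (rules_at t))) ` CC \<union>
       (\<lambda>(C, \<rho>). (C, rs_update_reduct t \<rho> (insert a M') C (rules_at t))) ` CC)"
    unfolding row_sim_iff n1
    using u[OF M(3) sim(2), of "a # M"] i0 i1 i2[of "a # M"]
    by (simp add: sim(1) Rr image_Un)
  have r2: "row_of (M, val (rs_update_t totals seen X s M R'), val (nub_t cand_eq_t ?l2)) =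
    trunc_row (M', rs_update t \<sigma> M' (rules_at t),
       (\<lambda>(C, \<rho>). (C, rs_update_reduct t \<rho> M' C (rules_at t))) ` CC)"
    unfolding row_sim_iff n2
    using u[OF M(3) sim(2), of M] i2[of M] by (simp add: sim(1) Rr)
  show "row_of ` set (val (intro_row_t totals seen X R' a x)) = trunc_row ` intro_row t a y"
    unfolding val ye intro_row_def using r1 r2 by simp
qed

text \<open>A selection is a union of singletons and empty sets, so \<open>UN_sim\<close> covers it.
  It is applied to the test for infinity, which truncation preserves.\<close>

lemma filter_sim:
  assumes "h ` X = k ` Y" "\<And>x y. x \<in> X \<Longrightarrow> y \<in> Y \<Longrightarrow> h x = k y \<Longrightarrow> P x \<longleftrightarrow> Q y"
  shows "h ` {x \<in> X. P x} = k ` {y \<in> Y. Q y}"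
proof -
  have "h ` (\<Union>x\<in>X. if P x then {x} else {}) = k ` (\<Union>y\<in>Y. if Q y then {y} else {})"
    using assms by (intro UN_sim[OF assms(1)]) auto
  moreover have "(\<Union>x\<in>X. if P x then {x} else {}) = {x \<in> X. P x}" "(\<Union>y\<in>Y. if Q y then {y} else {}) = {y \<in> Y. Q y}"
    by auto
  ultimately show ?thesis by simp
qed

lemma map_cands_sim:
  assumes "cand_of ` set cs = trunc_cand ` CC" "\<And>c. c \<in> set cs \<Longrightarrow> cand_ok A R c"
    and "\<And>C s D \<rho>. cand_ok A R (C, s) \<Longrightarrow> set C = D \<Longrightarrow> represents s \<rho> \<Longrightarrow>
      cand_of (f (C, s)) = trunc_cand (g (D, \<rho>))"
  shows "cand_of ` f ` set cs = trunc_cand ` g ` CC"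
proof (rule image_sim[OF assms(1)])
  fix c d assume c: "c \<in> set cs" "d \<in> CC" "cand_of c = trunc_cand d"
  obtain C s D \<rho> where e: "c = (C, s)" "d = (D, \<rho>)" by (cases c; cases d)
  show "cand_of (f c) = trunc_cand (g d)"
    using c(3) assms(2)[OF c(1)] unfolding e cand_sim_iff by (intro assms(3)) auto
qed

text \<open>The common shape of the three remaining unary operations: transform every candidate,
  then delete duplicates that the transformation may have created.\<close>

lemma nub_map_cands:
  assumes cs: "\<And>c. c \<in> set cs \<Longrightarrow> cand_ok A R c"
    and f: "\<And>c. cand_ok A R c \<Longrightarrow> cand_ok A' R' (f c)"
    and M: "distinct M" "set M \<subseteq> A'" "state_ok R' s"
  shows "row_ok A' R' (M, s, val (nub_t cand_eq_t (map f cs)))"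
    "row_of (M, s, val (nub_t cand_eq_t (map f cs))) = (set M, map_of s, cand_of ` f ` set cs)"
proof -
  have ok: "cand_ok A' R' c" if "c \<in> set (map f cs)" for c using that cs f by auto
  show "row_ok A' R' (M, s, val (nub_t cand_eq_t (map f cs)))"
    by (rule row_ok_nubI[OF M ok])
  show "row_of (M, s, val (nub_t cand_eq_t (map f cs))) = (set M, map_of s, cand_of ` f ` set cs)"
    using nub_cands(2)[of "map f cs" A' R', OF ok] by (simp add: row_of_simp)
qed

section \<open>Introducing a rule\<close>

definition intro_rule_row :: "'a vertex set rtree \<Rightarrow> 'a rule \<Rightarrow> 'a row \<Rightarrow> 'a row" where
  "intro_rule_row t r = (\<lambda>(M, \<sigma>, CC). (M, rs_update t (\<sigma>(r \<mapsto> 0)) M {r},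
     (\<lambda>(C, \<rho>). (C, rs_update_reduct t (\<rho>(r \<mapsto> 0)) M C {r})) ` CC))"

lemma intro_rule_image: "intro_rule t r \<tau> = intro_rule_row t r ` \<tau>"
  unfolding intro_rule_def intro_rule_row_def Collect_pairs_image by force

definition intro_rule_row_t ::
  "'a totals \<Rightarrow> 'a seen \<Rightarrow> 'a list \<Rightarrow> 'a rule \<Rightarrow> 'a list \<times> 'a state_list \<times> 'a cand_list
     \<Rightarrow> ('a list \<times> 'a state_list \<times> 'a cand_list) timed" where
  "intro_rule_row_t tot seen X r = (\<lambda>(M, \<sigma>, cs). do {
       \<sigma> \<leftarrow> rs_update_t tot seen X ((r, 0) # \<sigma>) M [r];
       cs \<leftarrow> map_t (\<lambda>(C, \<rho>). do {
         \<rho> \<leftarrow> rs_update_reduct_t tot seen X ((r, 0) # \<rho>) M C [r];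
         prim (C, \<rho>) }) cs;
       cs \<leftarrow> nub_t cand_eq_t cs;
       prim (M, \<sigma>, cs) })"

lemma intro_rule_t_alt:
  "intro_rule_t tot X r = (\<lambda>(seen, \<tau>). do {
     wh \<leftarrow> bag_weight_t X r;
     seen \<leftarrow> prim ((r, wh) # seen);
     rs \<leftarrow> map_t (intro_rule_row_t tot seen X r) \<tau>;
     rs \<leftarrow> nub_t row_eq_t rs;
     prim (seen, rs) })"
  by (simp add: intro_rule_t_def intro_rule_row_t_def)

lemma row_ok_intro_rule:
  assumes x: "row_ok A R x" and r: "r \<notin> R"
  shows "row_ok A (insert r R) (val (intro_rule_row_t tot seen X r x))"
proof -
  obtain M s cs where xe: "x = (M, s, cs)" by (cases x)
  define f where "f = (\<lambda>(C :: 'a list, \<rho>). (C, val (rs_update_reduct_t tot seen X ((r, 0) # \<rho>) M C [r])))"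
  have val: "val (intro_rule_row_t tot seen X r x) =
      (M, val (rs_update_t tot seen X ((r, 0) # s) M [r]), val (nub_t cand_eq_t (map f cs)))"
    unfolding xe by (simp add: intro_rule_row_t_def f_def split_def)
  show ?thesis unfolding val
    by (rule nub_map_cands(1)[where A = A and R = R])
      (use x r in \<open>auto simp: xe row_ok_def f_def cand_ok_def
        intro!: state_ok_rs_update state_ok_rs_update_reduct state_ok_Cons\<close>)
qed

lemma (in node) row_of_intro_rule_row_t:
  assumes x: "row_ok A R0 x" "row_of x = trunc_row y" and r: "r \<notin> R0" "R = insert r R0"
  shows "row_of (val (intro_rule_row_t totals seen X r x)) = trunc_row (intro_rule_row t r y)"
proof -
  obtain M s cs where xe: "x = (M, s, cs)" by (cases x)
  obtain M' \<sigma> CC where ye: "y = (M', \<sigma>, CC)" by (cases y)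
  have M: "distinct M" "set M \<subseteq> A" "state_ok R0 s" "\<And>c. c \<in> set cs \<Longrightarrow> cand_ok A R0 c"
    using x(1) unfolding xe row_ok_def by auto
  have sim: "set M = M'" "represents s \<sigma>" "cand_of ` set cs = trunc_cand ` CC"
    using x(2) unfolding xe ye row_sim_iff by auto
  define f where "f = (\<lambda>(C :: 'a list, \<rho>). (C, val (rs_update_reduct_t totals seen X ((r, 0) # \<rho>) M C [r])))"
  have val: "val (intro_rule_row_t totals seen X r x) =
      (M, val (rs_update_t totals seen X ((r, 0) # s) M [r]), val (nub_t cand_eq_t (map f cs)))"
    unfolding xe by (simp add: intro_rule_row_t_def f_def split_def)
  have sub: "set [r] \<subseteq> R" using r by simp
  have ok: "state_ok R ((r, 0) # \<rho>)" if "state_ok R0 \<rho>" for \<rho>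
    using state_ok_Cons[OF that r(1)] r(2) by simp
  have fok: "cand_ok A R (f c)" if "cand_ok A R0 c" for c
    using that ok by (cases c) (auto simp: f_def cand_ok_def intro!: state_ok_rs_update_reduct)
  have "cand_of ` f ` set cs =
      trunc_cand ` (\<lambda>(C, \<rho>). (C, rs_update_reduct t (\<rho>(r \<mapsto> 0)) (set M) C {r})) ` CC"
    using sim(3) M(4)
  proof (rule map_cands_sim)
    fix C s' D \<rho> assume c: "cand_ok A R0 (C, s')" "set C = D" "represents s' \<rho>"
    then have "state_ok R ((r, 0) # s')" using ok by (simp add: cand_ok_def)
    from represents_rs_update_reduct[OF this represents_Cons[OF c(3)] sub, of M C]
    show "cand_of (f (C, s')) = trunc_cand (case (D, \<rho>) of (C, \<rho>) \<Rightarrow>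
        (C, rs_update_reduct t (\<rho>(r \<mapsto> 0)) (set M) C {r}))"
      using c(2) by (simp add: f_def cand_sim_iff)
  qed
  moreover have "represents (val (rs_update_t totals seen X ((r, 0) # s) M [r])) (rs_update t (\<sigma>(r \<mapsto> 0)) (set M) {r})"
    using represents_rs_update[OF ok[OF M(3)] represents_Cons[OF sim(2)] sub, of M] by simp
  moreover have "row_of (M, val (rs_update_t totals seen X ((r, 0) # s) M [r]), val (nub_t cand_eq_t (map f cs))) =
      (set M, map_of (val (rs_update_t totals seen X ((r, 0) # s) M [r])), cand_of ` f ` set cs)"
    by (rule nub_map_cands(2)[OF M(4) fok]) (use M ok in \<open>auto intro: state_ok_rs_update\<close>)
  ultimately show ?thesis
    unfolding val ye intro_rule_row_def by (simp add: trunc_row_simp represents_def sim(1))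
qed

section \<open>Removing an atom\<close>

definition remove_atom_row :: "'a vertex set rtree \<Rightarrow> 'a \<Rightarrow> 'a row \<Rightarrow> 'a row" where
  "remove_atom_row t a = (\<lambda>(M, \<sigma>, CC). (M - {a}, \<sigma> \<uplus> UpdtWgt (rules_at t) M a,
     (\<lambda>(C, \<rho>). (C - {a}, \<rho> \<uplus> UpdtWgtCh (rules_at t) M C a)) ` CC))"

lemma remove_atom_image: "remove_atom t a \<tau> = remove_atom_row t a ` \<tau>"
  unfolding remove_atom_def remove_atom_row_def Collect_pairs_image by force

definition remove_atom_row_t ::
  "'a \<Rightarrow> 'a list \<times> 'a state_list \<times> 'a cand_list \<Rightarrow> ('a list \<times> 'a state_list \<times> 'a cand_list) timed" where
  "remove_atom_row_t a = (\<lambda>(M, \<sigma>, cs). do {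
       M' \<leftarrow> delete_t a M;
       \<sigma> \<leftarrow> updt_t a M M \<sigma>;
       cs \<leftarrow> map_t (\<lambda>(C, \<rho>). do {
         C' \<leftarrow> delete_t a C;
         \<rho> \<leftarrow> updt_t a M C \<rho>;
         prim (C', \<rho>) }) cs;
       cs \<leftarrow> nub_t cand_eq_t cs;
       prim (M', \<sigma>, cs) })"

lemma remove_atom_t_alt:
  "remove_atom_t a = (\<lambda>(seen, \<tau>). do {
     rs \<leftarrow> map_t (remove_atom_row_t a) \<tau>;
     rs \<leftarrow> nub_t row_eq_t rs;
     prim (seen, rs) })"
  by (simp add: remove_atom_t_def remove_atom_row_t_def)

lemma row_ok_remove_atom:
  assumes x: "row_ok A R x"
  shows "row_ok (A - {a}) R (val (remove_atom_row_t a x))"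
proof -
  obtain M s cs where xe: "x = (M, s, cs)" by (cases x)
  define f where "f = (\<lambda>(C, \<rho>). (filter (\<lambda>y. y \<noteq> a) C, val (updt_t a M C \<rho>)))"
  have val: "val (remove_atom_row_t a x) =
      (filter (\<lambda>y. y \<noteq> a) M, val (updt_t a M M s), val (nub_t cand_eq_t (map f cs)))"
    unfolding xe by (simp add: remove_atom_row_t_def f_def split_def val_delete_t)
  show ?thesis unfolding val
    by (rule nub_map_cands(1)[where A = A and R = R])
      (use x in \<open>auto simp: xe row_ok_def f_def cand_ok_def intro!: state_ok_updt\<close>)
qed

text \<open>With equal flags the choice case of \<open>contribution\<close> is 0, in agreement with
  \<open>UpdtWgt\<close> being undefined on choice rules. So one function serves the row and its
  candidates.\<close>

lemma UpdtWgt_contribution: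
  "(case UpdtWgt R M a r of None \<Rightarrow> 0 | Some u \<Rightarrow> u) = enat (contribution a (a \<in> M) (a \<in> M) r)"
  if "r \<in> R"
proof (cases r)
  case (Weight H P N w b)
  have "{a} \<inter> ((N - M) \<union> (P \<inter> M)) = (if a \<in> N \<and> a \<notin> M \<or> a \<in> P \<and> a \<in> M then {a} else {})" by auto
  then show ?thesis using that Weight by (simp add: UpdtWgt_def wght_set_def)
qed (auto simp: UpdtWgt_def zero_enat_def)

lemma UpdtWgtCh_contribution:
  "(case UpdtWgtCh R M C a r of None \<Rightarrow> 0 | Some u \<Rightarrow> u) = enat (contribution a (a \<in> M) (a \<in> C) r)"
  if "r \<in> R"
proof (cases r)
  case (Weight H P N w b)
  have "{a} \<inter> ((N - M) \<union> (P \<inter> C)) = (if a \<in> N \<and> a \<notin> M \<or> a \<in> P \<and> a \<in> C then {a} else {})" by auto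
  then show ?thesis using that Weight by (simp add: UpdtWgtCh_def wght_set_def)
next
  case (Choice H P N)
  have "{a} \<inter> H \<inter> (M - C) = (if a \<in> H \<and> a \<in> M \<and> a \<notin> C then {a} else {})" by auto
  then show ?thesis using that Choice by (simp add: UpdtWgtCh_def)
qed (auto simp: UpdtWgtCh_def zero_enat_def)

lemma row_of_remove_atom_row_t:
  assumes x: "row_ok A (rules_at t) x" "row_of x = trunc_row y"
  shows "row_of (val (remove_atom_row_t a x)) = trunc_row (remove_atom_row t a y)"
proof -
  let ?R = "rules_at t"
  obtain M s cs where xe: "x = (M, s, cs)" by (cases x)
  obtain M' \<sigma> CC where ye: "y = (M', \<sigma>, CC)" by (cases y)
  have M: "distinct M" "set M \<subseteq> A" "state_ok ?R s" "\<And>c. c \<in> set cs \<Longrightarrow> cand_ok A ?R c"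
    using x(1) unfolding xe row_ok_def by auto
  have sim: "set M = M'" "represents s \<sigma>" "cand_of ` set cs = trunc_cand ` CC"
    using x(2) unfolding xe ye row_sim_iff by auto
  define f where "f = (\<lambda>(C, \<rho>). (filter (\<lambda>y. y \<noteq> a) C, val (updt_t a M C \<rho>)))"
  have val: "val (remove_atom_row_t a x) =
      (filter (\<lambda>y. y \<noteq> a) M, val (updt_t a M M s), val (nub_t cand_eq_t (map f cs)))"
    unfolding xe by (simp add: remove_atom_row_t_def f_def split_def val_delete_t)
  have fok: "cand_ok A ?R (f c)" if "cand_ok A ?R c" for c
    using that by (cases c) (auto simp: f_def cand_ok_def intro!: state_ok_updt)
  have "cand_of ` f ` set cs =
      trunc_cand ` (\<lambda>(C, \<rho>). (C - {a}, \<rho> \<uplus> UpdtWgtCh ?R (set M) C a)) ` CC"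
    using sim(3) M(4)
  proof (rule map_cands_sim)
    fix C s' D \<rho> assume c: "cand_ok A ?R (C, s')" "set C = D" "represents s' \<rho>"
    then have "state_ok ?R s'" by (simp add: cand_ok_def)
    then have "represents (val (updt_t a M C s')) (\<rho> \<uplus> UpdtWgtCh ?R (set M) (set C) a)"
      by (rule represents_updt[OF _ c(3) UpdtWgtCh_contribution]) (auto simp: UpdtWgtCh_def)
    then show "cand_of (f (C, s')) = trunc_cand (case (D, \<rho>) of (C, \<rho>) \<Rightarrow>
        (C - {a}, \<rho> \<uplus> UpdtWgtCh ?R (set M) C a))"
      using c(2) by (auto simp: f_def cand_sim_iff)
  qed
  moreover have "represents (val (updt_t a M M s)) (\<sigma> \<uplus> UpdtWgt ?R (set M) a)"
    by (rule represents_updt[OF M(3) sim(2) UpdtWgt_contribution]) (auto simp: UpdtWgt_def)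
  moreover have "row_of (filter (\<lambda>y. y \<noteq> a) M, val (updt_t a M M s), val (nub_t cand_eq_t (map f cs))) =
      (set (filter (\<lambda>y. y \<noteq> a) M), map_of (val (updt_t a M M s)), cand_of ` f ` set cs)"
    by (rule nub_map_cands(2)[OF M(4) fok]) (use M in \<open>auto intro: state_ok_updt\<close>)
  moreover have "set (filter (\<lambda>y. y \<noteq> a) M) = M' - {a}" using sim(1) by auto
  ultimately show ?thesis
    unfolding val ye remove_atom_row_def by (simp add: trunc_row_simp represents_def sim(1))
qed

section \<open>Removing a rule\<close>

definition remove_rule_row :: "'a rule \<Rightarrow> 'a row \<Rightarrow> 'a row" where
  "remove_rule_row r = (\<lambda>(M, \<sigma>, CC). (M, \<sigma>(r := None),
     (\<lambda>(C, \<rho>). (C, \<rho>(r := None))) ` {c \<in> CC. snd c r = Some \<infinity>}))"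

lemma remove_rule_image:
  "remove_rule r \<tau> = remove_rule_row r ` {y \<in> \<tau>. fst (snd y) r = Some \<infinity>}"
proof -
  have "{(C, \<rho>(r := None)) | C \<rho>. (C, \<rho>) \<in> CC \<and> \<rho> r = Some \<infinity>} =
    (\<lambda>(C, \<rho>). (C, \<rho>(r := None))) ` {c \<in> CC. snd c r = Some \<infinity>}" for CC :: "('a set \<times> 'a rule_state) set"
    by force
  then show ?thesis unfolding remove_rule_def remove_rule_row_def by force
qed

definition remove_rule_row_t ::
  "'a rule \<Rightarrow> 'a list \<times> 'a state_list \<times> 'a cand_list \<Rightarrow> ('a list \<times> 'a state_list \<times> 'a cand_list) timed" where
  "remove_rule_row_t r = (\<lambda>(M, \<sigma>, cs). do {
       \<sigma> \<leftarrow> delete_key_t r \<sigma>;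
       cs \<leftarrow> filter_t (\<lambda>(C, \<rho>). do { v \<leftarrow> lookup_t \<rho> r; prim (v = Some \<infinity>) }) cs;
       cs \<leftarrow> map_t (\<lambda>(C, \<rho>). do { \<rho> \<leftarrow> delete_key_t r \<rho>; prim (C, \<rho>) }) cs;
       cs \<leftarrow> nub_t cand_eq_t cs;
       prim (M, \<sigma>, cs) })"

lemma remove_rule_t_alt:
  "remove_rule_t r = (\<lambda>(seen, \<tau>). do {
     seen \<leftarrow> delete_key_t r seen;
     \<tau> \<leftarrow> filter_t (\<lambda>(M, \<sigma>, cs). do { v \<leftarrow> lookup_t \<sigma> r; prim (v = Some \<infinity>) }) \<tau>;
     rs \<leftarrow> map_t (remove_rule_row_t r) \<tau>;
     rs \<leftarrow> nub_t row_eq_t rs;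
     prim (seen, rs) })"
  by (simp add: remove_rule_t_def remove_rule_row_t_def)

lemma val_remove_rule_row_t:
  "val (remove_rule_row_t r (M, s, cs)) = (M, val (delete_key_t r s), val (nub_t cand_eq_t
     (map (\<lambda>(C, \<rho>). (C, val (delete_key_t r \<rho>))) (filter (\<lambda>c. map_of (snd c) r = Some \<infinity>) cs))))"
  by (simp add: remove_rule_row_t_def split_def)

lemma row_ok_remove_rule:
  assumes x: "row_ok A R x"
  shows "row_ok A (R - {r}) (val (remove_rule_row_t r x))"
proof -
  obtain M s cs where xe: "x = (M, s, cs)" by (cases x)
  show ?thesis unfolding xe val_remove_rule_row_t
    by (rule nub_map_cands(1)[where A = A and R = R])
      (use x in \<open>auto simp: xe row_ok_def cand_ok_def intro!: state_ok_delete\<close>)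
qed

lemma row_of_remove_rule_row_t:
  assumes x: "row_ok A R x" "row_of x = trunc_row y"
  shows "row_of (val (remove_rule_row_t r x)) = trunc_row (remove_rule_row r y)"
proof -
  obtain M s cs where xe: "x = (M, s, cs)" by (cases x)
  obtain M' \<sigma> CC where ye: "y = (M', \<sigma>, CC)" by (cases y)
  have M: "distinct M" "set M \<subseteq> A" "state_ok R s" "\<And>c. c \<in> set cs \<Longrightarrow> cand_ok A R c"
    using x(1) unfolding xe row_ok_def by auto
  have sim: "set M = M'" "represents s \<sigma>" "cand_of ` set cs = trunc_cand ` CC"
    using x(2) unfolding xe ye row_sim_iff by auto
  let ?cs = "filter (\<lambda>c. map_of (snd c) r = Some \<infinity>) cs"
  let ?f = "\<lambda>(C, \<rho>). (C, val (delete_key_t r \<rho>))"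
  have "cand_of ` {c \<in> set cs. map_of (snd c) r = Some \<infinity>} = trunc_cand ` {c \<in> CC. snd c r = Some \<infinity>}"
    by (rule filter_sim[OF sim(3)]) (auto simp: cand_sim_iff represents_infinity)
  then have "cand_of ` set ?cs = trunc_cand ` {c \<in> CC. snd c r = Some \<infinity>}" by simp
  then have "cand_of ` ?f ` set ?cs =
      trunc_cand ` (\<lambda>(C, \<rho>). (C, \<rho>(r := None))) ` {c \<in> CC. snd c r = Some \<infinity>}"
    by (rule map_cands_sim[where A = A and R = R])
      (use M(4) in \<open>auto simp: cand_sim_iff represents_delete\<close>)
  moreover have "represents (val (delete_key_t r s)) (\<sigma>(r := None))"
    using sim(2) by (rule represents_delete)
  moreover have "row_of (M, val (delete_key_t r s), val (nub_t cand_eq_t (map ?f ?cs))) =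
      (set M, map_of (val (delete_key_t r s)), cand_of ` ?f ` set ?cs)"
    by (rule nub_map_cands(2)[where A = A and R = R and A' = A and R' = "R - {r}"])
      (use M in \<open>auto simp: cand_ok_def intro: state_ok_delete\<close>)
  ultimately show ?thesis
    unfolding xe val_remove_rule_row_t ye remove_rule_row_def
    by (simp add: trunc_row_simp represents_def sim(1))
qed

section \<open>Join nodes\<close>

text \<open>The comprehensions of \<open>join_tables\<close> as unions of sets with at most one
  element, the shape that results from concatenating lists of length at most one.\<close>

definition join_cands ::
  "'a set \<Rightarrow> 'a rule_state \<Rightarrow> ('a set \<times> 'a rule_state) set \<Rightarrow> 'a rule_state
     \<Rightarrow> ('a set \<times> 'a rule_state) set \<Rightarrow> ('a set \<times> 'a rule_state) set" where
  "join_cands M \<sigma>' CC' \<sigma>'' CC'' =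
     (\<Union>c'\<in>CC'. \<Union>c''\<in>CC''. if fst c' = fst c'' then {(fst c', snd c' \<uplus> snd c'')} else {}) \<union>
     (\<Union>c\<in>CC'. if fst c = M then {(M, snd c \<uplus> \<sigma>'')} else {}) \<union>
     (\<Union>c\<in>CC''. if fst c = M then {(M, \<sigma>' \<uplus> snd c)} else {})"

definition join_row :: "'a row \<Rightarrow> 'a row \<Rightarrow> 'a row set" where
  "join_row = (\<lambda>(M', \<sigma>', CC') (M'', \<sigma>'', CC'').
     if M' = M'' then {(M', \<sigma>' \<uplus> \<sigma>'', join_cands M' \<sigma>' CC' \<sigma>'' CC'')} else {})"

lemma join_tables_UN: "join_tables \<tau>' \<tau>'' = (\<Union>y'\<in>\<tau>'. \<Union>y''\<in>\<tau>''. join_row y' y'')"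
proof -
  have c: "{(C, \<rho>' \<uplus> \<rho>'') | C \<rho>' \<rho>''. (C, \<rho>') \<in> CC' \<and> (C, \<rho>'') \<in> CC''} \<union>
       {(M, \<rho> \<uplus> \<sigma>'') | \<rho>. (M, \<rho>) \<in> CC'} \<union> {(M, \<sigma>' \<uplus> \<rho>) | \<rho>. (M, \<rho>) \<in> CC''} =
     join_cands M \<sigma>' CC' \<sigma>'' CC''" for M \<sigma>' \<sigma>'' and CC' CC'' :: "('a set \<times> 'a rule_state) set"
    unfolding join_cands_def by (intro arg_cong2[where f = "(\<union>)"]) force+
  show ?thesis unfolding join_tables_def c
  proof (intro equalityI subsetI)
    fix z assume "z \<in> {(M, \<sigma>' \<uplus> \<sigma>'', join_cands M \<sigma>' CC' \<sigma>'' CC'') | M \<sigma>' CC' \<sigma>'' CC''.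
      (M, \<sigma>', CC') \<in> \<tau>' \<and> (M, \<sigma>'', CC'') \<in> \<tau>''}"
    then obtain M \<sigma>' CC' \<sigma>'' CC'' where
      z: "z = (M, \<sigma>' \<uplus> \<sigma>'', join_cands M \<sigma>' CC' \<sigma>'' CC'')" "(M, \<sigma>', CC') \<in> \<tau>'" "(M, \<sigma>'', CC'') \<in> \<tau>''"
      by blast
    then have "z \<in> join_row (M, \<sigma>', CC') (M, \<sigma>'', CC'')" by (simp add: join_row_def)
    then show "z \<in> (\<Union>y'\<in>\<tau>'. \<Union>y''\<in>\<tau>''. join_row y' y'')" using z by blast
  next
    fix z assume "z \<in> (\<Union>y'\<in>\<tau>'. \<Union>y''\<in>\<tau>''. join_row y' y'')"
    then obtain y' y'' where y: "y' \<in> \<tau>'" "y'' \<in> \<tau>''" "z \<in> join_row y' y''" by blast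
    obtain M' \<sigma>' CC' M'' \<sigma>'' CC'' where e: "y' = (M', \<sigma>', CC')" "y'' = (M'', \<sigma>'', CC'')"
      by (cases y'; cases y'')
    have "M' = M''" "z = (M', \<sigma>' \<uplus> \<sigma>'', join_cands M' \<sigma>' CC' \<sigma>'' CC'')"
      using y(3) unfolding e join_row_def by (auto split: if_splits)
    then show "z \<in> {(M, \<sigma>' \<uplus> \<sigma>'', join_cands M \<sigma>' CC' \<sigma>'' CC'') | M \<sigma>' CC' \<sigma>'' CC''.
      (M, \<sigma>', CC') \<in> \<tau>' \<and> (M, \<sigma>'', CC'') \<in> \<tau>''}"
      using y(1,2) unfolding e by blast
  qed
qed

definition join_row_t ::
  "'a list \<times> 'a state_list \<times> 'a cand_list \<Rightarrow> 'a list \<times> 'a state_list \<times> 'a cand_list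
     \<Rightarrow> 'a row_list timed" where
  "join_row_t = (\<lambda>(M', \<sigma>', cs') (M'', \<sigma>'', cs''). do {
         b \<leftarrow> atoms_eq_t M' M'';
         if b then do {
           \<sigma> \<leftarrow> uplus_t \<sigma>' \<sigma>'';
           cs \<leftarrow> join_cands_t M' \<sigma>' cs' \<sigma>'' cs'';
           prim [(M', \<sigma>, cs)] }
         else prim [] })"

lemma join_t_alt:
  "join_t X = (\<lambda>(seen', \<tau>') (seen'', \<tau>''). do {
     seen \<leftarrow> map_t (\<lambda>(r, w', h'). do {
       e \<leftarrow> lookup_t seen'' r;
       (w, h) \<leftarrow> bag_weight_t X r;
       prim (case e of None \<Rightarrow> (r, w', h') | Some (w'', h'') \<Rightarrow> (r, w' + w'' - w, h' + h'' - h)) }) seen';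
     rss \<leftarrow> map_t (\<lambda>x. do { rss \<leftarrow> map_t (join_row_t x) \<tau>''; concat_t rss }) \<tau>';
     rs \<leftarrow> concat_t rss;
     rs \<leftarrow> nub_t row_eq_t rs;
     prim (seen, rs) })"
proof -
  have "(\<lambda>x. do { rss \<leftarrow> map_t (join_row_t x) \<tau>''; concat_t rss }) = (\<lambda>(M', \<sigma>', cs'). do {
       rss \<leftarrow> map_t (\<lambda>(M'', \<sigma>'', cs''). do {
         b \<leftarrow> atoms_eq_t M' M'';
         if b then do {
           \<sigma> \<leftarrow> uplus_t \<sigma>' \<sigma>'';
           cs \<leftarrow> join_cands_t M' \<sigma>' cs' \<sigma>'' cs'';
           prim [(M', \<sigma>, cs)] }
         else prim [] }) \<tau>'';
       concat_t rss })" for \<tau>'' :: "'a row_list"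
    by (auto simp: fun_eq_iff join_row_t_def)
  then show ?thesis unfolding join_t_def by simp
qed

definition joined_cands ::
  "'a list \<Rightarrow> 'a state_list \<Rightarrow> 'a cand_list \<Rightarrow> 'a state_list \<Rightarrow> 'a cand_list \<Rightarrow> 'a cand_list" where
  "joined_cands M s' cs' s'' cs'' = concat [
     concat (map (\<lambda>c'. concat (map (\<lambda>c''. if set (fst c') = set (fst c'')
       then [(fst c', val (uplus_t (snd c') (snd c'')))] else []) cs'')) cs'),
     concat (map (\<lambda>c. if set (fst c) = set M then [(M, val (uplus_t (snd c) s''))] else []) cs'),
     concat (map (\<lambda>c. if set (fst c) = set M then [(M, val (uplus_t s' (snd c)))] else []) cs'')]"

lemma val_join_cands_t:
  "val (join_cands_t M s' cs' s'' cs'') = val (nub_t cand_eq_t (joined_cands M s' cs' s'' cs''))"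
  by (simp add: join_cands_t_def joined_cands_def split_def val_if if_distrib[of val] cong: if_cong)

lemma set_joined_cands: "set (joined_cands M s' cs' s'' cs'') =
     (\<Union>c'\<in>set cs'. \<Union>c''\<in>set cs''. if set (fst c') = set (fst c'') then {(fst c', val (uplus_t (snd c') (snd c'')))} else {}) \<union>
     (\<Union>c\<in>set cs'. if set (fst c) = set M then {(M, val (uplus_t (snd c) s''))} else {}) \<union>
     (\<Union>c\<in>set cs''. if set (fst c) = set M then {(M, val (uplus_t s' (snd c)))} else {})"
  unfolding joined_cands_def by (auto split: if_splits)

lemma cand_ok_joined:
  assumes "row_ok A R (M, s', cs')" "row_ok A R (M'', s'', cs'')"
    and "c \<in> set (joined_cands M s' cs' s'' cs'')"
  shows "cand_ok A R c"
proof -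
  have M: "distinct M" "set M \<subseteq> A" "state_ok R s'" "state_ok R s''"
    using assms(1,2) by (auto simp: row_ok_def)
  have c': "distinct (fst d) \<and> set (fst d) \<subseteq> A \<and> state_ok R (snd d)" if "d \<in> set cs' \<union> set cs''" for d
    using assms(1,2) that by (cases d) (auto simp: row_ok_def cand_ok_def)
  from assms(3) show ?thesis
    unfolding set_joined_cands Un_iff UN_iff
  proof (elim disjE bexE)
    fix d e assume "d \<in> set cs'" "e \<in> set cs''"
      "c \<in> (if set (fst d) = set (fst e) then {(fst d, val (uplus_t (snd d) (snd e)))} else {})"
    then show ?thesis
      using c'[of d] c'[of e] by (simp add: cand_ok_def state_ok_uplus split: if_splits)
  next
    fix d assume "d \<in> set cs'" "c \<in> (if set (fst d) = set M then {(M, val (uplus_t (snd d) s''))} else {})"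
    then show ?thesis
      using c'[of d] M by (simp add: cand_ok_def state_ok_uplus split: if_splits)
  next
    fix d assume "d \<in> set cs''" "c \<in> (if set (fst d) = set M then {(M, val (uplus_t s' (snd d)))} else {})"
    then show ?thesis
      using c'[of d] M by (simp add: cand_ok_def state_ok_uplus split: if_splits)
  qed
qed

lemma row_ok_join:
  assumes "row_ok A R x'" "row_ok A R x''" "z \<in> set (val (join_row_t x' x''))"
  shows "row_ok A R z"
proof -
  obtain M' s' cs' where x': "x' = (M', s', cs')" by (cases x')
  obtain M'' s'' cs'' where x'': "x'' = (M'', s'', cs'')" by (cases x'')
  have z: "z = (M', val (uplus_t s' s''), val (nub_t cand_eq_t (joined_cands M' s' cs' s'' cs'')))"
    using assms(3) unfolding x' x'' by (auto simp: join_row_t_def val_join_cands_t split: if_splits)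
  show ?thesis unfolding z
    by (rule row_ok_nubI[OF _ _ _ cand_ok_joined[OF assms(1,2)[unfolded x' x'']]])
      (use assms in \<open>auto simp: x' x'' row_ok_def intro: state_ok_uplus\<close>)
qed

lemma row_of_join_row_t:
  assumes x': "row_ok A R x'" "row_of x' = trunc_row y'"
    and x'': "row_ok A R x''" "row_of x'' = trunc_row y''"
  shows "row_of ` set (val (join_row_t x' x'')) = trunc_row ` join_row y' y''"
proof -
  obtain M' s' cs' where xe': "x' = (M', s', cs')" by (cases x')
  obtain M'' s'' cs'' where xe'': "x'' = (M'', s'', cs'')" by (cases x'')
  obtain N' \<sigma>' CC' where ye': "y' = (N', \<sigma>', CC')" by (cases y')
  obtain N'' \<sigma>'' CC'' where ye'': "y'' = (N'', \<sigma>'', CC'')" by (cases y'')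
  have M': "state_ok R s'" "\<And>c. c \<in> set cs' \<Longrightarrow> cand_ok A R c"
    using x'(1) unfolding xe' row_ok_def by auto
  have M'': "state_ok R s''" "\<And>c. c \<in> set cs'' \<Longrightarrow> cand_ok A R c"
    using x''(1) unfolding xe'' row_ok_def by auto
  have sim': "set M' = N'" "represents s' \<sigma>'" "cand_of ` set cs' = trunc_cand ` CC'"
    using x'(2) unfolding xe' ye' row_sim_iff by auto
  have sim'': "set M'' = N''" "represents s'' \<sigma>''" "cand_of ` set cs'' = trunc_cand ` CC''"
    using x''(2) unfolding xe'' ye'' row_sim_iff by auto
  have fs: "set (fst c) = fst d" "represents (snd c) (snd d)" if "cand_of c = trunc_cand d" for c d
    using that by (cases c; cases d; simp add: cand_sim_iff)+
  have st': "state_ok R (snd c)" if "c \<in> set cs'" for c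
    using M'(2)[OF that] by (cases c) (simp add: cand_ok_def)
  have st'': "state_ok R (snd c)" if "c \<in> set cs''" for c
    using M''(2)[OF that] by (cases c) (simp add: cand_ok_def)
  have j: "cand_of ` set (joined_cands M' s' cs' s'' cs'') = trunc_cand ` join_cands N' \<sigma>' CC' \<sigma>'' CC''"
    unfolding set_joined_cands join_cands_def image_Un
  proof (intro arg_cong2[where f = "(\<union>)"] UN_sim[OF sim'(3)] UN_sim[OF sim''(3)])
    fix c' d' c'' d'' assume c: "c' \<in> set cs'" "d' \<in> CC'" "cand_of c' = trunc_cand d'"
      "c'' \<in> set cs''" "d'' \<in> CC''" "cand_of c'' = trunc_cand d''"
    show "cand_of ` (if set (fst c') = set (fst c'') then {(fst c', val (uplus_t (snd c') (snd c'')))} else {}) =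
      trunc_cand ` (if fst d' = fst d'' then {(fst d', snd d' \<uplus> snd d'')} else {})"
      using fs[OF c(3)] fs[OF c(6)] represents_uplus[OF st'[OF c(1)] st''[OF c(4)]]
      by (simp add: cand_sim_iff)
  next
    fix c d assume c: "c \<in> set cs'" "d \<in> CC'" "cand_of c = trunc_cand d"
    show "cand_of ` (if set (fst c) = set M' then {(M', val (uplus_t (snd c) s''))} else {}) =
      trunc_cand ` (if fst d = N' then {(N', snd d \<uplus> \<sigma>'')} else {})"
      using fs[OF c(3)] sim'(1) represents_uplus[OF st'[OF c(1)] M''(1) _ sim''(2)]
      by (simp add: cand_sim_iff)
  next
    fix c d assume c: "c \<in> set cs''" "d \<in> CC''" "cand_of c = trunc_cand d"
    show "cand_of ` (if set (fst c) = set M' then {(M', val (uplus_t s' (snd c)))} else {}) =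
      trunc_cand ` (if fst d = N' then {(N', \<sigma>' \<uplus> snd d)} else {})"
      using fs[OF c(3)] sim'(1) represents_uplus[OF M'(1) st''[OF c(1)] sim'(2)]
      by (simp add: cand_sim_iff)
  qed
  have n: "cand_of ` set (val (nub_t cand_eq_t (joined_cands M' s' cs' s'' cs''))) =
      cand_of ` set (joined_cands M' s' cs' s'' cs'')"
    using x'(1) x''(1) unfolding xe' xe'' by (intro nub_cands(2)[OF cand_ok_joined])
  have "row_of (M', val (uplus_t s' s''), val (nub_t cand_eq_t (joined_cands M' s' cs' s'' cs''))) =
      trunc_row (N', \<sigma>' \<uplus> \<sigma>'', join_cands N' \<sigma>' CC' \<sigma>'' CC'')"
    unfolding row_sim_iff n j
    using sim'(1) represents_uplus[OF M'(1) M''(1) sim'(2) sim''(2)] by simp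
  then show ?thesis
    unfolding xe' xe'' ye' ye'' join_row_t_def join_row_def
    by (simp add: val_if val_join_cands_t sim'(1) sim''(1))
qed

section \<open>The tables are computed correctly\<close>

text \<open>The locale assumption is about \<open>seen'\<close>, since the algorithm first adds the
  weight of \<open>a\<close> to the records and then tests satisfaction.\<close>

lemma table_intro_atom:
  assumes n: "node t X R seen'" and R': "set R' = R" and a: "a \<notin> A"
    and \<tau>: "table_ok A R \<tau>" "row_of ` set \<tau> = trunc_row ` T"
    and seen': "seen' = map (\<lambda>(r, w, h). (r, w + wght r a, h + (if a \<in> heads r then 1 else 0))) seen"
  shows "\<exists>\<tau>'. val (intro_atom_t totals X R' a (seen, \<tau>)) = (seen', \<tau>') \<and>
    table_ok (insert a A) R \<tau>' \<and> row_of ` set \<tau>' = trunc_row ` intro_atom t a T"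
proof -
  let ?rs = "concat (map (\<lambda>x. val (intro_row_t totals seen' X R' a x)) \<tau>)"
  have val: "val (intro_atom_t totals X R' a (seen, \<tau>)) = (seen', val (nub_t row_eq_t ?rs))"
    by (simp add: intro_atom_t_alt seen' split_def)
  have ok: "row_ok (insert a A) R x" if "x \<in> set ?rs" for x
  proof -
    obtain y where y: "y \<in> set \<tau>" "x \<in> set (val (intro_row_t totals seen' X R' a y))"
      using \<open>x \<in> set ?rs\<close> by auto
    then show ?thesis
      using row_ok_intro[OF _ a y(2)] \<tau>(1) unfolding table_ok_def by blast
  qed
  have "row_of ` (\<Union>x\<in>set \<tau>. set (val (intro_row_t totals seen' X R' a x))) = trunc_row ` intro_atom t a T"
    unfolding intro_atom_UN
    by (rule UN_sim[OF \<tau>(2)], rule node.row_of_intro_row_t[OF n _ _ a R'])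
      (use \<tau>(1) in \<open>auto simp: table_ok_def\<close>)
  then show ?thesis
    using nub_rows[of ?rs, OF ok] val by simp
qed

lemma table_intro_rule:
  assumes n: "node t X R seen'" and r: "r \<notin> R0" "R = insert r R0"
    and \<tau>: "table_ok A R0 \<tau>" "row_of ` set \<tau> = trunc_row ` T"
    and seen': "seen' = (r, val (bag_weight_t X r)) # seen"
  shows "\<exists>\<tau>'. val (intro_rule_t totals X r (seen, \<tau>)) = (seen', \<tau>') \<and>
    table_ok A R \<tau>' \<and> row_of ` set \<tau>' = trunc_row ` intro_rule t r T"
proof -
  let ?rs = "map (\<lambda>x. val (intro_rule_row_t totals seen' X r x)) \<tau>"
  have val: "val (intro_rule_t totals X r (seen, \<tau>)) = (seen', val (nub_t row_eq_t ?rs))"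
    by (simp add: intro_rule_t_alt seen')
  have ok: "row_ok A R x" if "x \<in> set ?rs" for x
  proof -
    obtain y where "y \<in> set \<tau>" "x = val (intro_rule_row_t totals seen' X r y)" using \<open>x \<in> set ?rs\<close> by auto
    then show ?thesis using row_ok_intro_rule[of A R0 y r] r \<tau>(1) by (simp add: table_ok_def)
  qed
  have "row_of ` (\<lambda>x. val (intro_rule_row_t totals seen' X r x)) ` set \<tau> = trunc_row ` intro_rule t r T"
    unfolding intro_rule_image
    by (rule image_sim[OF \<tau>(2)], rule node.row_of_intro_rule_row_t[OF n _ _ r])
      (use \<tau>(1) in \<open>auto simp: table_ok_def\<close>)
  then show ?thesis
    using nub_rows[of ?rs, OF ok] val by simp
qed

lemma table_remove_atom:
  assumes R: "R = rules_at t" and \<tau>: "table_ok A R \<tau>" "row_of ` set \<tau> = trunc_row ` T"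
  shows "\<exists>\<tau>'. val (remove_atom_t a (seen, \<tau>)) = (seen, \<tau>') \<and>
    table_ok (A - {a}) R \<tau>' \<and> row_of ` set \<tau>' = trunc_row ` remove_atom t a T"
proof -
  let ?rs = "map (\<lambda>x. val (remove_atom_row_t a x)) \<tau>"
  have val: "val (remove_atom_t a (seen, \<tau>)) = (seen, val (nub_t row_eq_t ?rs))"
    by (simp add: remove_atom_t_alt)
  have ok: "row_ok (A - {a}) R x" if "x \<in> set ?rs" for x
  proof -
    obtain y where "y \<in> set \<tau>" "x = val (remove_atom_row_t a y)" using \<open>x \<in> set ?rs\<close> by auto
    then show ?thesis using row_ok_remove_atom[of A R y a] \<tau>(1) by (simp add: table_ok_def)
  qed
  have "row_of ` (\<lambda>x. val (remove_atom_row_t a x)) ` set \<tau> = trunc_row ` remove_atom t a T"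
    unfolding remove_atom_image
    by (rule image_sim[OF \<tau>(2)], rule row_of_remove_atom_row_t)
      (use \<tau>(1) in \<open>auto simp: table_ok_def R\<close>)
  then show ?thesis
    using nub_rows[of ?rs, OF ok] val by simp
qed

lemma table_remove_rule:
  assumes \<tau>: "table_ok A R \<tau>" "row_of ` set \<tau> = trunc_row ` T"
  shows "\<exists>\<tau>'. val (remove_rule_t r (seen, \<tau>)) = (val (delete_key_t r seen), \<tau>') \<and>
    table_ok A (R - {r}) \<tau>' \<and> row_of ` set \<tau>' = trunc_row ` remove_rule r T"
proof -
  let ?\<tau> = "filter (\<lambda>x. map_of (fst (snd x)) r = Some \<infinity>) \<tau>"
  let ?rs = "map (\<lambda>x. val (remove_rule_row_t r x)) ?\<tau>"
  have val: "val (remove_rule_t r (seen, \<tau>)) = (val (delete_key_t r seen), val (nub_t row_eq_t ?rs))"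
    by (simp add: remove_rule_t_alt split_def)
  have ok: "row_ok A (R - {r}) x" if "x \<in> set ?rs" for x
  proof -
    obtain y where "y \<in> set \<tau>" "x = val (remove_rule_row_t r y)" using \<open>x \<in> set ?rs\<close> by auto
    then show ?thesis using row_ok_remove_rule[of A R y r] \<tau>(1) by (simp add: table_ok_def)
  qed
  have "row_of ` {x \<in> set \<tau>. map_of (fst (snd x)) r = Some \<infinity>} =
      trunc_row ` {y \<in> T. fst (snd y) r = Some \<infinity>}"
    by (rule filter_sim[OF \<tau>(2)]) (auto simp: row_sim_iff represents_infinity)
  then have "row_of ` set ?\<tau> = trunc_row ` {y \<in> T. fst (snd y) r = Some \<infinity>}" by simp
  then have "row_of ` (\<lambda>x. val (remove_rule_row_t r x)) ` set ?\<tau> = trunc_row ` remove_rule r T"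
    unfolding remove_rule_image
    by (rule image_sim, intro row_of_remove_rule_row_t) (use \<tau>(1) in \<open>auto simp: table_ok_def\<close>)
  then show ?thesis
    using nub_rows[of ?rs, OF ok] val by simp
qed

text \<open>Only the rows are treated here. Merging the \<open>seen\<close> records depends on how
  the two subtrees overlap and is left to \<open>node_inv_binary\<close>.\<close>

lemma table_join:
  assumes \<tau>': "table_ok A R \<tau>'" "row_of ` set \<tau>' = trunc_row ` T'"
    and \<tau>'': "table_ok A R \<tau>''" "row_of ` set \<tau>'' = trunc_row ` T''"
  shows "\<exists>\<tau>. snd (val (join_t X (seen', \<tau>') (seen'', \<tau>''))) = \<tau> \<and>
    table_ok A R \<tau> \<and> row_of ` set \<tau> = trunc_row ` join_tables T' T''"
proof -
  let ?rs = "concat (map (\<lambda>x. concat (map (\<lambda>y. val (join_row_t x y)) \<tau>'')) \<tau>')"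
  have val: "snd (val (join_t X (seen', \<tau>') (seen'', \<tau>''))) = val (nub_t row_eq_t ?rs)"
    by (simp add: join_t_alt)
  have ok: "row_ok A R x" if "x \<in> set ?rs" for x
  proof -
    obtain y z where "y \<in> set \<tau>'" "z \<in> set \<tau>''" "x \<in> set (val (join_row_t y z))" using \<open>x \<in> set ?rs\<close> by auto
    then show ?thesis using row_ok_join[of A R y z x] \<tau>'(1) \<tau>''(1) by (simp add: table_ok_def)
  qed
  have "row_of ` (\<Union>x\<in>set \<tau>'. \<Union>y\<in>set \<tau>''. set (val (join_row_t x y))) = trunc_row ` join_tables T' T''"
    unfolding join_tables_UN
    by (rule UN_sim[OF \<tau>'(2)], rule UN_sim[OF \<tau>''(2)], rule row_of_join_row_t)
      (use \<tau>'(1) \<tau>''(1) in \<open>auto simp: table_ok_def\<close>)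
  then show ?thesis
    using nub_rows[of ?rs, OF ok] val by simp
qed

section \<open>Weights and head counts of the atoms below a node\<close>

lemma val_bag_weight_t: "distinct X \<Longrightarrow> val (bag_weight_t X r) = seen_val (set X) r"
proof -
  assume "distinct X"
  moreover have "(\<Sum>a\<in>set X. if a \<in> heads r then 1 else 0) = card (heads r \<inter> set X)"
    by (simp add: sum.If_cases Int_commute)
  ultimately show ?thesis
    by (simp add: bag_weight_t_def seen_val_def wght_set_def sum_list_distinct_conv_sum_set)
qed

lemma seen_ok_Cons:
  assumes "seen_ok B R seen" "r \<notin> R" "v = seen_val B r"
  shows "seen_ok B (insert r R) ((r, v) # seen)"
  using assms by (auto simp: seen_ok_def)

lemma seen_ok_delete: "seen_ok B R seen \<Longrightarrow> seen_ok B (R - {r}) (val (delete_key_t r seen))"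
  by (auto simp: seen_ok_def val_delete_key_t map_of_delete_key distinct_map_filter)

lemma seen_ok_map:
  assumes "seen_ok B R seen" "\<And>r. r \<in> R \<Longrightarrow> g r (seen_val B r) = seen_val B' r"
  shows "seen_ok B' R (map (\<lambda>(r, v). (r, g r v)) seen)"
proof -
  have 1: "map fst (map (\<lambda>(r, v). (r, g r v)) seen) = map fst seen" by (induction seen) auto
  then have 2: "fst ` set (map (\<lambda>(r, v). (r, g r v)) seen) = fst ` set seen"
    by (metis list.set_map)
  show ?thesis using assms unfolding seen_ok_def 1 2 map_of_map_key by simp
qed

lemma seen_val_insert:
  assumes "finite B" "a \<notin> B"
  shows "seen_val (insert a B) r =
    (fst (seen_val B r) + wght r a, snd (seen_val B r) + (if a \<in> heads r then 1 else 0))"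
  using assms by (simp add: seen_val_def wght_set_def Int_insert_right)

text \<open>Inclusion and exclusion. The natural subtraction is exact, because what is subtracted is
  contained in the sum.\<close>

lemma seen_val_join:
  assumes "finite B'" "finite B''"
  shows "seen_val (B' \<union> B'') r = (fst (seen_val B' r) + fst (seen_val B'' r) - fst (seen_val (B' \<inter> B'') r),
    snd (seen_val B' r) + snd (seen_val B'' r) - snd (seen_val (B' \<inter> B'') r))"
proof -
  have "wght_set r (B' \<union> B'') + wght_set r (B' \<inter> B'') = wght_set r B' + wght_set r B''"
    unfolding wght_set_def by (rule sum.union_inter) (use assms in auto)
  moreover have "card (heads r \<inter> (B' \<union> B'')) + card (heads r \<inter> (B' \<inter> B'')) =
      card (heads r \<inter> B') + card (heads r \<inter> B'')"
    using card_Un_Int[of "heads r \<inter> B'" "heads r \<inter> B''"] assms by (simp add: Int_ac Int_Un_distrib)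
  ultimately show ?thesis
    unfolding seen_val_def fst_conv snd_conv by (metis diff_add_inverse2)
qed

text \<open>The last condition is what remains, inside a subtree, of the condition that edges are covered:
  an edge at a vertex that was already removed cannot be covered further up.\<close>

definition good :: "'a rule set \<Rightarrow> 'a vertex set rtree \<Rightarrow> bool" where
  "good \<Pi> t \<longleftrightarrow> program \<Pi> \<and> conn t \<and> all_nodes nice_node t \<and> verts t \<subseteq> fst (incidence_graph \<Pi>) \<and>
     (\<forall>e\<in>snd (incidence_graph \<Pi>). e \<inter> (verts t - label t) \<noteq> {} \<longrightarrow> covers t e)"

text \<open>Let \<open>v\<close> be an end of the edge that lies in the child's subtree but not in
  its bag. By connectedness \<open>v\<close> is not in the parent's bag either, so that bag does not
  cover the edge, and a sibling covering it would share \<open>v\<close>.\<close>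

lemma good_child:
  assumes "good \<Pi> (Node b ts)" "i < length ts"
  shows "good \<Pi> (ts ! i)"
proof -
  have c: "conn (Node b ts)" and cov: "\<And>e. e \<in> snd (incidence_graph \<Pi>) \<Longrightarrow>
      e \<inter> (verts (Node b ts) - b) \<noteq> {} \<Longrightarrow> covers (Node b ts) e"
    using assms(1) by (auto simp: good_def)
  have m: "ts ! i \<in> set ts" using assms(2) by simp
  have "covers (ts ! i) e" if e: "e \<in> snd (incidence_graph \<Pi>)" "e \<inter> (verts (ts ! i) - label (ts ! i)) \<noteq> {}" for e
  proof -
    obtain v where v: "v \<in> e" "v \<in> verts (ts ! i)" "v \<notin> label (ts ! i)" using e by blast
    then have vb: "v \<notin> b" using conn_childD(2)[OF c m] by blast
    moreover have "v \<in> verts (Node b ts)" using v m by auto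
    ultimately have "covers (Node b ts) e" using v by (intro cov[OF e(1)]) auto
    then obtain j where j: "j < length ts" "covers (ts ! j) e"
      using v vb by (auto simp: covers_Node in_set_conv_nth)
    have "v \<in> verts (ts ! j)" using covers_verts[OF j(2)] v by blast
    then have "i = j" using conn_disjointD[OF c assms(2) j(1)] v vb by blast
    then show ?thesis using j by simp
  qed
  moreover have "verts (ts ! i) \<subseteq> verts (Node b ts)" using m by auto
  moreover have "all_nodes nice_node (ts ! i)" using assms(1) m by (simp add: good_def)
  ultimately show ?thesis using assms(1) conn_childD(1)[OF c m] unfolding good_def by blast
qed

lemma atoms_below_verts: "atoms_below t = {a. Atom a \<in> verts t}"
  unfolding atoms_below_def verts_positions ..

lemma finite_incidence: "program \<Pi> \<Longrightarrow> finite (fst (incidence_graph \<Pi>))"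
  by (auto simp: incidence_graph_def program_def wf_rule_def)

lemma good_finite:
  assumes "good \<Pi> t"
  shows "finite (atoms_below t)"
proof -
  have "finite (verts t)"
    using assms finite_incidence by (auto simp: good_def intro: finite_subset)
  moreover have "Atom ` atoms_below t \<subseteq> verts t" by (auto simp: atoms_below_verts)
  ultimately have "finite (Atom ` atoms_below t)" by (rule finite_subset[rotated])
  then show ?thesis by (rule finite_imageD) (simp add: inj_on_def)
qed

lemma good_rules:
  assumes "good \<Pi> t"
  shows "rules_at t \<subseteq> \<Pi>" "r \<in> rules_at t \<Longrightarrow> wf_rule r"
proof -
  show "rules_at t \<subseteq> \<Pi>"
    using assms label_verts[of t] by (auto simp: good_def rules_at_def incidence_graph_def)
  then show "r \<in> rules_at t \<Longrightarrow> wf_rule r" using assms by (auto simp: good_def program_def)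
qed

section \<open>The work at a single node\<close>

lemma split_bag_t_props:
  assumes "val (split_bag_t b) = (X, R)"
  shows "set X = {a. Atom a \<in> set b}" "set R = {r. Rule r \<in> set b}"
    "distinct b \<Longrightarrow> distinct X" "distinct b \<Longrightarrow> distinct R" "length X + length R = length b"
proof -
  have "set X = {a. Atom a \<in> set b} \<and> set R = {r. Rule r \<in> set b} \<and>
    (distinct b \<longrightarrow> distinct X \<and> distinct R) \<and> length X + length R = length b"
    using assms
  proof (induction b arbitrary: X R)
    case (Cons v b)
    obtain X' R' where e: "val (split_bag_t b) = (X', R')" by (cases "val (split_bag_t b)")
    from Cons.IH[OF e] Cons.prems e show ?case by (cases v) auto
  qed simp
  then show "set X = {a. Atom a \<in> set b}" "set R = {r. Rule r \<in> set b}"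
    "distinct b \<Longrightarrow> distinct X" "distinct b \<Longrightarrow> distinct R" "length X + length R = length b" by auto
qed

text \<open>The body of \<open>dp_run\<close> at a node with one child, freed from the recursion, so
  that correctness and cost can be proved for one node at a time.\<close>

definition unary_t ::
  "'a totals \<Rightarrow> 'a vertex list \<Rightarrow> 'a vertex list \<Rightarrow> 'a seen \<times> 'a row_list \<Rightarrow> ('a seen \<times> 'a row_list) timed" where
  "unary_t tot b c s = do {
     (X, R) \<leftarrow> split_bag_t b;
     new \<leftarrow> diff_t b c;
     old \<leftarrow> diff_t c b;
     (case new of
        Atom a # _ \<Rightarrow> intro_atom_t tot X R a s
      | Rule r # _ \<Rightarrow> intro_rule_t tot X r s
      | [] \<Rightarrow> (case old of
          Atom a # _ \<Rightarrow> remove_atom_t a s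
        | Rule r # _ \<Rightarrow> remove_rule_t r s
        | [] \<Rightarrow> ret s)) }"

definition binary_t ::
  "'a vertex list \<Rightarrow> 'a seen \<times> 'a row_list \<Rightarrow> 'a seen \<times> 'a row_list \<Rightarrow> ('a seen \<times> 'a row_list) timed" where
  "binary_t b s' s'' = do { (X, R) \<leftarrow> split_bag_t b; join_t X s' s'' }"

lemma dp_run_unary:
  "val (dp_run tot (Node b [u])) =
     Node (val (unary_t tot b (label u) (label (val (dp_run tot u))))) [val (dp_run tot u)]"
  "steps (dp_run tot (Node b [u])) =
     steps (dp_run tot u) + steps (unary_t tot b (label u) (label (val (dp_run tot u)))) + 1"
  by (simp_all add: unary_t_def split_def)

lemma dp_run_binary:
  "val (dp_run tot (Node b [u, v])) =
     Node (val (binary_t b (label (val (dp_run tot u))) (label (val (dp_run tot v)))))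
       [val (dp_run tot u), val (dp_run tot v)]"
  "steps (dp_run tot (Node b [u, v])) = steps (dp_run tot u) + steps (dp_run tot v) +
     steps (binary_t b (label (val (dp_run tot u))) (label (val (dp_run tot v)))) + 1"
  by (simp_all add: binary_t_def split_def)

definition node_inv :: "'a vertex set rtree \<Rightarrow> 'a seen \<times> 'a row_list \<Rightarrow> bool" where
  "node_inv t = (\<lambda>(seen, \<tau>). seen_ok (atoms_below t) (rules_at t) seen \<and>
     table_ok (atoms_at t) (rules_at t) \<tau> \<and> row_of ` set \<tau> = trunc_row ` dp_table t)"

lemma filter_singleton:
  assumes "distinct xs" "set xs - S = {x}"
  shows "filter (\<lambda>y. y \<notin> S) xs = [x]"
proof -
  have "distinct (filter (\<lambda>y. y \<notin> S) xs)" "set (filter (\<lambda>y. y \<notin> S) xs) = {x}"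
    using assms by auto
  moreover from this have "length (filter (\<lambda>y. y \<notin> S) xs) = 1"
    using distinct_card by fastforce
  then obtain y where "filter (\<lambda>y. y \<notin> S) xs = [y]" by (auto simp: length_Suc_conv)
  ultimately show ?thesis by simp
qed

text \<open>The redundant-looking facts in each case decide the branches: strict inclusion selects
  the branch of \<open>dp_table\<close>, and the differences of bags are what \<open>diff_t\<close>
  computes.\<close>

lemma nice_unary_cases:
  assumes "nice_node (Node B [u])" "finite B" "finite (label u)"
  obtains (Intro) x where "B = insert x (label u)" "x \<notin> label u" "label u \<subset> B" "B - label u = {x}"
  | (Remove) x where "label u = insert x B" "x \<notin> B" "\<not> label u \<subset> B" "label u - B = {x}" "B - label u = {}"
proof -
  consider "label u \<subseteq> B" "card B = card (label u) + 1" | "B \<subseteq> label u" "card (label u) = card B + 1"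
    using assms(1) by auto
  then show thesis
  proof cases
    case 1
    then have "card (B - label u) = 1" using assms by (simp add: card_Diff_subset)
    then obtain x where x: "B - label u = {x}" using card_1_singletonE by blast
    show thesis by (rule Intro[of x]) (use x 1 in auto)
  next
    case 2
    then have "card (label u - B) = 1" using assms by (simp add: card_Diff_subset)
    then obtain x where x: "label u - B = {x}" using card_1_singletonE by blast
    show thesis by (rule Remove[of x]) (use x 2 in auto)
  qed
qed

lemma intro_seen_map:
  "map (\<lambda>(r, w, h). (r, w + wght r a, h + (if a \<in> heads r then 1 else 0))) seen =
   map (\<lambda>(r, v). (r, (\<lambda>r v. (fst v + wght r a, snd v + (if a \<in> heads r then 1 else 0))) r v)) seen"
  by (simp add: split_def)

lemma good_node:
  assumes "good \<Pi> t" "label t = set b" "distinct b" "val (split_bag_t b) = (X, R)"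
    "seen_ok (atoms_below t) (rules_at t) seen"
  shows "node t X (rules_at t) seen"
  using assms good_rules(2)[OF assms(1)] good_finite[OF assms(1)] split_bag_t_props[OF assms(4)]
  by unfold_locales (auto simp: atoms_at_def)

lemma node_inv_unary:
  assumes g: "good \<Pi> (Node (set b) [u])" and d: "distinct b" "distinct c" and c: "label u = set c"
    and inv: "node_inv u s"
  shows "node_inv (Node (set b) [u]) (val (unary_t totals b c s))"
proof -
  let ?t = "Node (set b) [u]"
  obtain seen \<tau> where s: "s = (seen, \<tau>)" by (cases s)
  obtain X R' where XR: "val (split_bag_t b) = (X, R')" by (cases "val (split_bag_t b)")
  note sb = split_bag_t_props[OF XR]
  have inv': "seen_ok (atoms_below u) (rules_at u) seen" "table_ok (atoms_at u) (rules_at u) \<tau>"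
    "row_of ` set \<tau> = trunc_row ` dp_table u"
    using inv by (auto simp: node_inv_def s)
  have R': "set R' = rules_at ?t" using sb(2) by (simp add: rules_at_def)
  have gu: "good \<Pi> u" using good_child[OF g, of 0] by simp
  have conn: "conn ?t" and nice: "nice_node ?t" using g by (auto simp: good_def)
  have vb: "verts u \<inter> set b \<subseteq> label u" using conn by (simp add: conn_single)
  have vt: "verts ?t = set b \<union> verts u" by simp
  have lu: "label u \<subseteq> verts u" by (rule label_verts)
  have fin: "finite (atoms_below u)" by (rule good_finite[OF gu])
  show ?thesis
  proof (cases rule: nice_unary_cases[OF nice])
    case 1 then show ?case by simp
  next
    case 2 then show ?case by (simp add: c)
  next
    case (3 x)
    have new: "filter (\<lambda>y. y \<notin> set c) b = [x]"
      using filter_singleton[OF d(1)] 3(4) c by simp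
    \<comment> \<open>By connectedness the introduced vertex is new to the whole subtree and not
      only to the child's bag.\<close>
    have xv: "x \<notin> verts u" using vb 3 by auto
    show ?thesis
    proof (cases x)
      case (Atom a)
      let ?seen = "map (\<lambda>(r, w, h). (r, w + wght r a, h + (if a \<in> heads r then 1 else 0))) seen"
      have val: "val (unary_t totals b c s) = val (intro_atom_t totals X R' a (seen, \<tau>))"
        by (simp add: unary_t_def XR new s Atom)
      have at: "atoms_at ?t = insert a (atoms_at u)" "rules_at ?t = rules_at u" "a \<notin> atoms_at u"
        using 3 Atom by (auto simp: atoms_at_def rules_at_def)
      have ab: "atoms_below ?t = insert a (atoms_below u)" "a \<notin> atoms_below u"
        using 3 Atom xv lu by (auto simp: atoms_below_verts vt)
      have seen: "seen_ok (atoms_below ?t) (rules_at ?t) ?seen"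
        unfolding ab(1) at(2) intro_seen_map
        by (rule seen_ok_map[OF inv'(1)]) (simp add: seen_val_insert[OF fin ab(2)])
      have n: "node ?t X (rules_at ?t) ?seen"
        by (rule good_node[OF g _ d(1) XR seen]) simp
      have dp: "dp_table ?t = intro_atom ?t a (dp_table u)"
        using 3 Atom by simp
      obtain \<tau>' where "val (intro_atom_t totals X R' a (seen, \<tau>)) = (?seen, \<tau>')"
        "table_ok (insert a (atoms_at u)) (rules_at ?t) \<tau>'"
        "row_of ` set \<tau>' = trunc_row ` intro_atom ?t a (dp_table u)"
        using table_intro_atom[OF n R' at(3) inv'(2)[folded at(2)] inv'(3) refl] by blast
      then show ?thesis
        unfolding node_inv_def val dp at(1) using seen by simp
    next
      case (Rule r)
      let ?seen = "(r, val (bag_weight_t X r)) # seen"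
      have val: "val (unary_t totals b c s) = val (intro_rule_t totals X r (seen, \<tau>))"
        by (simp add: unary_t_def XR new s Rule)
      have at: "atoms_at ?t = atoms_at u" "rules_at ?t = insert r (rules_at u)" "r \<notin> rules_at u"
        using 3 Rule by (auto simp: atoms_at_def rules_at_def)
      have ab: "atoms_below ?t = atoms_below u"
        using 3 Rule xv lu by (auto simp: atoms_below_verts vt)
      have rP: "r \<in> \<Pi>" "wf_rule r" using good_rules[OF g] at by auto
      \<comment> \<open>An atom of \<open>r\<close> below the node but not in its bag would have
        been removed before. The bag does not cover its edge to \<open>r\<close>, so the subtree of
        \<open>u\<close> must; but \<open>r\<close> does not occur there yet. Hence the bag contains
        every atom of \<open>r\<close> below, and its weight is the correct initial record.\<close>
      have out: "a \<notin> at_rule r" if a: "a \<in> atoms_below u" "a \<notin> set X" for a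
      proof
        assume ar: "a \<in> at_rule r"
        let ?e = "{Atom a, Rule r}"
        have "?e \<in> snd (incidence_graph \<Pi>)" using ar rP by (auto simp: incidence_graph_def)
        moreover have "Atom a \<in> verts ?t - label ?t"
          using a sb(1) by (auto simp: atoms_below_verts)
        ultimately have "covers ?t ?e" using g unfolding good_def by blast
        moreover have "\<not> ?e \<subseteq> set b" using a sb(1) by auto
        ultimately have "covers u ?e" by (auto simp: covers_Node)
        then have "Rule r \<in> verts u" using covers_verts by blast
        then show False using xv Rule by simp
      qed
      have "val (bag_weight_t X r) = seen_val (set X) r"
        using val_bag_weight_t sb(3)[OF d(1)] by blast
      also have "\<dots> = seen_val (atoms_below ?t) r"
      proof -
        have sub: "set X \<subseteq> atoms_below ?t"
          using sb(1) by (auto simp: atoms_below_verts vt)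
        have "wght_set r (set X) = wght_set r (atoms_below ?t)"
          unfolding wght_set_def using sub fin out wght_outside[OF rP(2)] unfolding ab
          by (intro sum.mono_neutral_left) auto
        moreover have "heads r \<inter> set X = heads r \<inter> atoms_below ?t"
          using sub out unfolding ab by (auto simp: at_rule_def)
        ultimately show ?thesis by (simp add: seen_val_def)
      qed
      finally have seen: "seen_ok (atoms_below ?t) (rules_at ?t) ?seen"
        unfolding at(2) using inv'(1) at(3) ab by (intro seen_ok_Cons) auto
      have n: "node ?t X (rules_at ?t) ?seen"
        by (rule good_node[OF g _ d(1) XR seen]) simp
      have dp: "dp_table ?t = intro_rule ?t r (dp_table u)"
        using 3 Rule by simp
      obtain \<tau>' where "val (intro_rule_t totals X r (seen, \<tau>)) = (?seen, \<tau>')"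
        "table_ok (atoms_at u) (rules_at ?t) \<tau>'"
        "row_of ` set \<tau>' = trunc_row ` intro_rule ?t r (dp_table u)"
        using table_intro_rule[OF n at(3) at(2) inv'(2) inv'(3) refl] by blast
      then show ?thesis
        unfolding node_inv_def val dp at(1) using seen by simp
    qed
  next
    case (4 x)
    have new: "filter (\<lambda>y. y \<notin> set c) b = []"
      using 4(5) c by (auto simp: filter_empty_conv)
    have old: "filter (\<lambda>y. y \<notin> set b) c = [x]"
      using filter_singleton[OF d(2)] 4(4) c by simp
    have ab: "atoms_below ?t = atoms_below u"
      using 4 lu by (auto simp: atoms_below_verts vt)
    show ?thesis
    proof (cases x)
      case (Atom a)
      have val: "val (unary_t totals b c s) = val (remove_atom_t a (seen, \<tau>))"
        by (simp add: unary_t_def XR new old s Atom)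
      have at: "atoms_at ?t = atoms_at u - {a}" "rules_at u = rules_at ?t"
        using 4 Atom by (auto simp: atoms_at_def rules_at_def)
      have dp: "dp_table ?t = remove_atom ?t a (dp_table u)"
        using 4 Atom by simp
      obtain \<tau>' where "val (remove_atom_t a (seen, \<tau>)) = (seen, \<tau>')"
        "table_ok (atoms_at u - {a}) (rules_at u) \<tau>'"
        "row_of ` set \<tau>' = trunc_row ` remove_atom ?t a (dp_table u)"
        using table_remove_atom[OF at(2) inv'(2,3)] by blast
      then show ?thesis
        unfolding node_inv_def val dp at(1) using inv'(1) ab at(2) by simp
    next
      case (Rule r)
      have val: "val (unary_t totals b c s) = val (remove_rule_t r (seen, \<tau>))"
        by (simp add: unary_t_def XR new old s Rule)
      have at: "atoms_at ?t = atoms_at u" "rules_at ?t = rules_at u - {r}"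
        using 4 Rule by (auto simp: atoms_at_def rules_at_def)
      have dp: "dp_table ?t = remove_rule r (dp_table u)"
        using 4 Rule by simp
      obtain \<tau>' where "val (remove_rule_t r (seen, \<tau>)) = (val (delete_key_t r seen), \<tau>')"
        "table_ok (atoms_at u) (rules_at u - {r}) \<tau>'"
        "row_of ` set \<tau>' = trunc_row ` remove_rule r (dp_table u)"
        using table_remove_rule[OF inv'(2,3)] by blast
      then show ?thesis
        unfolding node_inv_def val dp at using seen_ok_delete[OF inv'(1)] ab by simp
    qed
  qed
qed

lemma node_inv_binary:
  assumes g: "good \<Pi> (Node (set b) [u, v])" and d: "distinct b"
    and inv: "node_inv u s'" "node_inv v s''"
  shows "node_inv (Node (set b) [u, v]) (val (binary_t b s' s''))"
proof -
  let ?t = "Node (set b) [u, v]"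
  obtain seen' \<tau>' where s': "s' = (seen', \<tau>')" by (cases s')
  obtain seen'' \<tau>'' where s'': "s'' = (seen'', \<tau>'')" by (cases s'')
  obtain X R' where XR: "val (split_bag_t b) = (X, R')" by (cases "val (split_bag_t b)")
  note sb = split_bag_t_props[OF XR]
  have inv': "seen_ok (atoms_below u) (rules_at u) seen'" "table_ok (atoms_at u) (rules_at u) \<tau>'"
    "row_of ` set \<tau>' = trunc_row ` dp_table u"
    using inv(1) by (auto simp: node_inv_def s')
  have inv'': "seen_ok (atoms_below v) (rules_at v) seen''" "table_ok (atoms_at v) (rules_at v) \<tau>''"
    "row_of ` set \<tau>'' = trunc_row ` dp_table v"
    using inv(2) by (auto simp: node_inv_def s'')
  have gu: "good \<Pi> u" and gv: "good \<Pi> v"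
    using good_child[OF g, of 0] good_child[OF g, of 1] by auto
  have conn: "conn ?t" and l: "label u = set b" "label v = set b" using g by (auto simp: good_def)
  have at: "atoms_at u = atoms_at ?t" "atoms_at v = atoms_at ?t"
    "rules_at u = rules_at ?t" "rules_at v = rules_at ?t"
    using l by (auto simp: atoms_at_def rules_at_def)
  have disj: "verts u \<inter> verts v \<subseteq> set b"
    using conn_disjointD[OF conn, of 0 1] by simp
  have lu: "set b \<subseteq> verts u" "set b \<subseteq> verts v"
    using label_verts[of u] label_verts[of v] l by auto
  have ab: "atoms_below ?t = atoms_below u \<union> atoms_below v"
    using lu by (auto simp: atoms_below_verts)
  \<comment> \<open>The atoms counted in both subtrees are those of the bag, so one scan of the bag
    yields the amount to subtract.\<close>
  have X: "atoms_below u \<inter> atoms_below v = set X"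
    using disj lu sb(1) by (auto simp: atoms_below_verts)
  let ?seen = "map (\<lambda>(r, w). (r, (\<lambda>r w. case map_of seen'' r of None \<Rightarrow> w
    | Some w'' \<Rightarrow> (fst w + fst w'' - fst (val (bag_weight_t X r)), snd w + snd w'' - snd (val (bag_weight_t X r)))) r w)) seen'"
  have bw: "val (bag_weight_t X r) = seen_val (set X) r" for r
    using val_bag_weight_t sb(3)[OF d] by blast
  have seen: "seen_ok (atoms_below ?t) (rules_at ?t) ?seen"
  proof (rule seen_ok_map)
    show "seen_ok (atoms_below u) (rules_at ?t) seen'" using inv'(1) at by simp
    fix r assume r: "r \<in> rules_at ?t"
    then have "map_of seen'' r = Some (seen_val (atoms_below v) r)"
      using inv''(1) at by (simp add: seen_ok_def)
    then show "(case map_of seen'' r of None \<Rightarrow> seen_val (atoms_below u) r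
    | Some w'' \<Rightarrow> (fst (seen_val (atoms_below u) r) + fst w'' - fst (val (bag_weight_t X r)),
        snd (seen_val (atoms_below u) r) + snd w'' - snd (val (bag_weight_t X r)))) = seen_val (atoms_below ?t) r"
      unfolding ab bw seen_val_join[OF good_finite[OF gu] good_finite[OF gv]] X by simp
  qed
  have "val (join_t X s' s'') = (?seen, snd (val (join_t X s' s'')))"
    unfolding s' s'' join_t_alt by (simp add: split_def split: option.split)
  moreover have "val (binary_t b s' s'') = val (join_t X s' s'')"
    by (simp add: binary_t_def XR)
  moreover obtain \<tau> where "snd (val (join_t X s' s'')) = \<tau>" "table_ok (atoms_at ?t) (rules_at ?t) \<tau>"
    "row_of ` set \<tau> = trunc_row ` join_tables (dp_table u) (dp_table v)"
    using table_join[OF inv'(2)[unfolded at] inv'(3) inv''(2)[unfolded at] inv''(3)] s' s'' by blast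
  ultimately show ?thesis using seen by (simp add: node_inv_def)
qed

lemma node_inv_leaf: "node_inv (Node {} []) ([], [([], [], [])])"
  by (simp add: node_inv_def seen_ok_def table_ok_def row_ok_def state_ok_def atoms_at_def
      rules_at_def row_of_simp trunc_row_simp trunc_state_def)

lemma computed_tables_Node: "computed_tables (Node (seen, \<tau>) ts) = Node (row_of ` set \<tau>) (map computed_tables ts)"
  by (simp add: computed_tables_def)

lemma node_inv_table: "node_inv t s \<Longrightarrow> row_of ` set (snd s) = trunc_row ` dp_table t"
  by (auto simp: node_inv_def)

lemma label_dp_tables: "dp_tables t = Node (dp_table t) (map dp_tables (children t))"
  by (cases t) simp

text \<open>The invariant of the root is what the parent's step consumes; the equation between trees
  of tables accumulates alongside. Niceness excludes nodes with more than two children.\<close>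

lemma dp_run_correct:
  assumes "good \<Pi> (map_rtree set T)" "all_nodes (\<lambda>s. distinct (label s)) T"
  shows "node_inv (map_rtree set T) (label (val (dp_run totals T))) \<and>
    computed_tables (val (dp_run totals T)) = map_rtree ((`) trunc_row) (dp_tables (map_rtree set T))"
  using assms
proof (induction T)
  case (Node b ts)
  let ?m = "map_rtree set" and ?d = "all_nodes (\<lambda>s. distinct (label s))"
  have nice: "nice_node (?m (Node b ts))" using Node.prems by (simp add: good_def)
  have g: "good \<Pi> (?m u)" if "u \<in> set ts" for u
    using that good_child[of \<Pi> "set b" "map ?m ts"] Node.prems(1) by (auto simp: in_set_conv_nth)
  have d: "distinct b" "\<And>u. u \<in> set ts \<Longrightarrow> ?d u"
    using Node.prems(2) by auto
  have dl: "distinct (label u)" if "u \<in> set ts" for u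
    using all_nodes_root[OF d(2)[OF that]] .
  note IH = Node.IH[OF _ g d(2)]
  have dp: "dp_tables (?m u) = Node (dp_table (?m u)) (map dp_tables (children (?m u)))" for u
    by (rule label_dp_tables)
  consider "ts = []" | u where "ts = [u]" | u v where "ts = [u, v]" | u v w us where "ts = u # v # w # us"
    by (cases ts; cases "tl ts"; cases "tl (tl ts)") auto
  then show ?case
  proof cases
    case 1
    then have "b = []" using nice by simp
    then show ?thesis using 1 node_inv_leaf
      by (simp add: computed_tables_Node row_of_simp trunc_row_simp trunc_state_def)
  next
    case (2 u)
    then have u: "u \<in> set ts" by simp
    let ?s = "val (unary_t totals b (label u) (label (val (dp_run totals u))))"
    have inv: "node_inv (Node (set b) [?m u]) ?s"
      using Node.prems(1) 2 d(1) dl[OF u] IH[OF u u u] by (intro node_inv_unary) (auto simp: label_map)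
    have "computed_tables (Node ?s [val (dp_run totals u)]) =
        Node (row_of ` set (snd ?s)) [computed_tables (val (dp_run totals u))]"
      by (cases ?s) (simp add: computed_tables_Node)
    then show ?thesis
      using inv node_inv_table[OF inv] IH[OF u u u] unfolding 2 dp_run_unary by simp
  next
    case (3 u v)
    then have u: "u \<in> set ts" and v: "v \<in> set ts" by auto
    let ?s = "val (binary_t b (label (val (dp_run totals u))) (label (val (dp_run totals v))))"
    have inv: "node_inv (Node (set b) [?m u, ?m v]) ?s"
      using Node.prems(1) 3 d(1) IH[OF u u u] IH[OF v v v] by (intro node_inv_binary) auto
    have "computed_tables (Node ?s [val (dp_run totals u), val (dp_run totals v)]) =
        Node (row_of ` set (snd ?s)) [computed_tables (val (dp_run totals u)), computed_tables (val (dp_run totals v))]"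
      by (cases ?s) (simp add: computed_tables_Node)
    then show ?thesis
      using inv node_inv_table[OF inv] IH[OF u u u] IH[OF v v v] unfolding 3 dp_run_binary by simp
  next
    case (4 u v w us)
    then show ?thesis using nice by simp
  qed
qed

section \<open>The number of rows\<close>

definition state_vals :: "'a rule \<Rightarrow> enat set" where
  "state_vals r = insert \<infinity> (enat ` {..cap r})"

definition states :: "'a rule set \<Rightarrow> 'a rule_state set" where
  "states R = {f. dom f = R \<and> (\<forall>r\<in>R. the (f r) \<in> state_vals r)}"

definition cands :: "'a set \<Rightarrow> 'a rule set \<Rightarrow> ('a set \<times> 'a rule_state) set" where
  "cands A R = Pow A \<times> states R"

lemma finite_state_vals [simp]: "finite (state_vals r)"
  by (simp add: state_vals_def)

lemma card_state_vals: "card (state_vals r) = cap r + 2"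
  by (simp add: state_vals_def card_insert_if card_image inj_on_def image_iff)

text \<open>A state over one more rule is a smaller state and one more value. The inclusion is all
  that an upper bound needs.\<close>

lemma states_insert:
  "states (insert r R) \<subseteq> (\<lambda>(f, v). f(r \<mapsto> v)) ` (states R \<times> state_vals r)" if "r \<notin> R"
proof
  fix f assume f: "f \<in> states (insert r R)"
  then obtain v where v: "f r = Some v" by (auto simp: states_def)
  then have "v \<in> state_vals r" using f by (force simp: states_def)
  moreover have "f(r := None) \<in> states R" using f that by (auto simp: states_def)
  moreover have "f = (f(r := None))(r \<mapsto> v)" using v by auto
  ultimately show "f \<in> (\<lambda>(f, v). f(r \<mapsto> v)) ` (states R \<times> state_vals r)"
    by (intro image_eqI[of _ _ "(f(r := None), v)"]) auto
qed

lemma finite_states: "finite R \<Longrightarrow> finite (states R)"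
proof (induction R rule: finite_induct)
  case empty
  show ?case by (simp add: states_def)
next
  case (insert r R)
  then show ?case by (intro finite_subset[OF states_insert]) auto
qed

lemma card_states:
  "finite R \<Longrightarrow> (\<And>r. r \<in> R \<Longrightarrow> cap r + 2 \<le> m) \<Longrightarrow> card (states R) \<le> m ^ card R"
proof (induction R rule: finite_induct)
  case empty
  show ?case by (simp add: states_def)
next
  case (insert r R)
  have fin: "finite (states R \<times> state_vals r)"
    using finite_states[OF insert(1)] by simp
  have "card (states (insert r R)) \<le> card ((\<lambda>(f, v). f(r \<mapsto> v)) ` (states R \<times> state_vals r))"
    using insert(2) fin by (intro card_mono states_insert) auto
  also have "\<dots> \<le> card (states R \<times> state_vals r)"
    using fin by (rule card_image_le)
  also have "\<dots> = card (states R) * (cap r + 2)"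
    by (simp add: card_cartesian_product card_state_vals)
  also have "\<dots> \<le> m ^ card R * m" using insert by (intro mult_mono) auto
  finally show ?case using insert by (simp add: mult.commute)
qed

lemma map_of_states:
  assumes "state_ok R s"
  shows "map_of s \<in> states R"
proof -
  have d: "dom (map_of s) = R" using assms by (rule state_ok_dom)
  have "the (map_of s r) \<in> state_vals r" if r: "r \<in> R" for r
  proof -
    obtain v where v: "map_of s r = Some v" using d r by auto
    then have "trunc_val r v = v" using assms map_of_SomeD[OF v] by (auto simp: state_ok_def)
    then show ?thesis using v by (auto simp: trunc_val_le state_vals_def)
  qed
  then show ?thesis using d by (simp add: states_def)
qed

lemma state_ok_length: "state_ok R s \<Longrightarrow> length s = card R"
  unfolding state_ok_def by (metis distinct_card length_map list.set_map)

lemma length_le_card_image: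
  assumes "distinct (map f xs)" "f ` set xs \<subseteq> B" "finite B"
  shows "length xs \<le> card B"
proof -
  have "length xs = card (f ` set xs)" using assms(1) by (metis distinct_card length_map list.set_map)
  then show ?thesis using assms card_mono by metis
qed

text \<open>Bags have at most \<open>n\<close> elements and rules at most \<open>m\<close> truncated values. Then \<open>S\<close> bounds the
  number of candidates of a row, \<open>N\<close> the number of rows of a table, and \<open>Q\<close> (up to a constant) the
  cost of updating one rule-state. Neither \<open>S\<close> nor \<open>N\<close> depends on how a bag is split into atoms and
  rules, because an atom contributes a factor \<open>2 \<le> m\<close>.\<close>

locale sizes =
  fixes A :: "'a set" and R :: "'a rule set" and n m S N Q :: nat
  assumes fin: "finite A" "finite R" and AR: "card A + card R \<le> n" and n: "1 \<le> n"
    and m: "2 \<le> m" "\<And>r. r \<in> R \<Longrightarrow> cap r + 2 \<le> m"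
    and S: "S = m ^ n" and N: "N = S * 2 ^ S" and Q: "Q = n * n * n"
begin

lemma card_cands: "finite (cands A R)" "card (cands A R) \<le> S"
proof -
  show "finite (cands A R)" using fin finite_states[OF fin(2)] by (simp add: cands_def)
  have "card (cands A R) = 2 ^ card A * card (states R)"
    using fin by (simp add: cands_def card_cartesian_product card_Pow)
  also have "\<dots> \<le> m ^ card A * m ^ card R"
    using m fin by (intro mult_mono card_states power_mono) auto
  also have "\<dots> = m ^ (card A + card R)" by (simp add: power_add)
  also have "\<dots> \<le> S" unfolding S using AR m by (intro power_increasing) auto
  finally show "card (cands A R) \<le> S" .
qed

lemma length_cands:
  assumes "\<And>c. c \<in> set cs \<Longrightarrow> cand_ok A R c" "distinct (map cand_of cs)"
  shows "length cs \<le> S"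
proof -
  have "cand_of ` set cs \<subseteq> cands A R"
    using assms(1) by (force simp: cand_of_def cand_ok_def cands_def map_of_states)
  then have "length cs \<le> card (cands A R)" using length_le_card_image[OF assms(2)] card_cands by blast
  then show ?thesis using card_cands by linarith
qed

lemma length_rows:
  assumes "table_ok A R \<tau>"
  shows "length \<tau> \<le> N"
proof -
  let ?B = "Pow A \<times> states R \<times> Pow (cands A R)"
  have fB: "finite ?B" using fin finite_states[OF fin(2)] card_cands by (intro finite_cartesian_product) auto
  have "row_of x \<in> ?B" if "x \<in> set \<tau>" for x
  proof -
    obtain M s cs where x: "x = (M, s, cs)" by (cases x)
    have "row_ok A R (M, s, cs)" using assms that x by (auto simp: table_ok_def)
    moreover have "cand_of ` set cs \<subseteq> cands A R"
      using calculation by (force simp: row_ok_def cand_of_def cand_ok_def cands_def map_of_states)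
    ultimately show ?thesis by (auto simp: x row_of_simp row_ok_def map_of_states)
  qed
  then have "row_of ` set \<tau> \<subseteq> ?B" by (rule image_subsetI)
  then have "length \<tau> \<le> card ?B"
    using assms fB length_le_card_image[of row_of \<tau> ?B] unfolding table_ok_def by blast
  \<comment> \<open>The pairs of an atom set and a state range over the same set as the candidates,
    so a table has at most as many rows as there are candidates times sets of candidates.\<close>
  also have "card ?B = card (cands A R) * 2 ^ card (cands A R)"
    using card_cands fin by (simp add: cands_def card_cartesian_product card_Pow)
  also have "\<dots> \<le> N" unfolding N using card_cands by (intro mult_mono power_increasing) auto
  finally show ?thesis .
qed

lemma state_length: "state_ok R s \<Longrightarrow> length s \<le> n"
  using AR by (simp add: state_ok_length)

lemma set_length: "distinct M \<Longrightarrow> set M \<subseteq> A \<Longrightarrow> length M \<le> n"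
  using AR fin card_mono[of A "set M"] by (simp add: distinct_card)

lemma Q_ge: "1 \<le> Q" "n \<le> Q" "n * n \<le> Q"
proof -
  have "n * 1 \<le> n * n" "n * n * 1 \<le> n * n * n" using n by (intro mult_left_mono; simp)+
  then show "1 \<le> Q" "n \<le> Q" "n * n \<le> Q" unfolding Q using n by linarith+
qed

lemma SN_ge: "1 \<le> S" "1 \<le> N"
  using m by (auto simp: S N)

end

section \<open>The number of steps\<close>

lemma steps_mem_le: "length xs \<le> n \<Longrightarrow> steps (mem_t x xs) \<le> 2 * n + 1"
  using steps_mem_t[of x xs] by linarith

lemma steps_any_le:
  assumes "\<And>x. x \<in> set xs \<Longrightarrow> steps (f x) \<le> B" "length xs \<le> L"
  shows "steps (any_t f xs) \<le> L * (B + 1) + 1"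
  using steps_any_t[of xs f B, OF assms(1)] mult_le_mono1[OF assms(2), of "B + 1"] by linarith

lemma steps_sum_le:
  assumes "\<And>x. x \<in> set xs \<Longrightarrow> steps (f x) \<le> B" "length xs \<le> L"
  shows "steps (sum_t f xs) \<le> L * (B + 1) + 1"
  using steps_sum_t[of xs f B, OF assms(1)] mult_le_mono1[OF assms(2), of "B + 1"] by linarith

lemma steps_map_le:
  assumes "\<And>x. x \<in> set xs \<Longrightarrow> steps (f x) \<le> B" "length xs \<le> L"
  shows "steps (map_t f xs) \<le> L * (B + 1) + 1"
  using steps_map_t[of xs f B, OF assms(1)] mult_le_mono1[OF assms(2), of "B + 1"] by linarith

lemma steps_filter_le:
  assumes "\<And>x. x \<in> set xs \<Longrightarrow> steps (f x) \<le> B" "length xs \<le> L"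
  shows "steps (filter_t f xs) \<le> L * (B + 1) + 1"
  using steps_filter_t[of xs f B, OF assms(1)] mult_le_mono1[OF assms(2), of "B + 1"] by linarith

lemma steps_concat_le:
  assumes "\<And>xs. xs \<in> set xss \<Longrightarrow> length xs \<le> B" "length xss \<le> L"
  shows "steps (concat_t xss) \<le> L * (B + 2) + 1"
  using steps_concat_t[of xss B, OF assms(1)] mult_le_mono1[OF assms(2), of "B + 2"] by linarith

lemma steps_hit_t:
  assumes "length X \<le> n" "length M \<le> n"
  shows "steps (hit_t H X M) \<le> n * (2 * n + 3) + 1" "steps (miss_t H X M) \<le> n * (2 * n + 3) + 1"
    "steps (weigh_in_t w H X M) \<le> n * (2 * n + 3) + 1" "steps (weigh_out_t w H X M) \<le> n * (2 * n + 3) + 1"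
proof -
  have s: "steps (mem_t a M) + 1 \<le> 2 * n + 2" for a using steps_mem_le[OF assms(2)] by simp
  have e: "2 * n + 3 = (2 * n + 2) + 1" by simp
  show "steps (hit_t H X M) \<le> n * (2 * n + 3) + 1" "steps (miss_t H X M) \<le> n * (2 * n + 3) + 1"
    unfolding hit_t_def miss_t_def e by (rule steps_any_le[OF _ assms(1)]; use s in simp)+
  show "steps (weigh_in_t w H X M) \<le> n * (2 * n + 3) + 1" "steps (weigh_out_t w H X M) \<le> n * (2 * n + 3) + 1"
    unfolding weigh_in_t_def weigh_out_t_def e by (rule steps_sum_le[OF _ assms(1)]; use s in simp)+
qed

lemma steps_lookup_le: "length xs \<le> n \<Longrightarrow> steps (lookup_t xs k) \<le> n + 1"
  using steps_lookup_t[of xs k] by linarith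

lemma steps_counter_t: "length s \<le> n \<Longrightarrow> steps (counter_t s r) \<le> n + 2"
  using steps_lookup_t[of s r] by (simp add: counter_t_def)

lemma steps_unseen_t: "length s \<le> n \<Longrightarrow> steps (unseen_t tot s r) \<le> n + 2"
  using steps_lookup_t[of s r] by (simp add: unseen_t_def)

lemma steps_diff_le: "length M \<le> n \<Longrightarrow> length C \<le> n \<Longrightarrow> steps (diff_t M C) \<le> n * (2 * n + 3) + 1"
  by (rule order_trans[OF steps_diff_t]) (simp add: mult_mono)

text \<open>The costliest case is a choice rule in the reduct, with four quadratic scans and three
  linear lookups: \<open>8 * (n * n) + 15 * n + 10\<close>, at most \<open>33 * (n * n)\<close>. The
  40 is a round number above it.\<close>

lemma steps_sat_t:
  assumes "length X \<le> n" "length M \<le> n" "length C \<le> n" "length s \<le> n" "length seen \<le> n" "1 \<le> n"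
  shows "steps (sat_state_t tot seen X s M r) \<le> 40 * (n * n)"
    and "steps (sat_reduct_t tot seen X s M C r) \<le> 40 * (n * n)"
proof -
  have l: "length (filter (\<lambda>x. x \<notin> set C) M) \<le> n"
    using assms(2) length_filter_le[of "\<lambda>x. x \<notin> set C" M] by linarith
  \<comment> \<open>Naming the square makes all bounds linear for the arithmetic procedures.\<close>
  define q where "q = n * n"
  have nn: "n \<le> q" "n * (2 * n + 3) + 1 = 2 * q + 3 * n + 1"
    using assms(6) by (auto simp: algebra_simps q_def)
  \<comment> \<open>Entries 1-4, 5-8 and 9-12 bound the four scans against \<open>M\<close>, against
    \<open>C\<close>, and against \<open>M\<close> without \<open>C\<close>; 13-16 bound
    \<open>diff_t\<close>, \<open>lookup_t\<close>, \<open>counter_t\<close> and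
    \<open>unseen_t\<close>.\<close>
  note bounds = steps_hit_t[OF assms(1,2), unfolded nn(2)] steps_hit_t[OF assms(1,3), unfolded nn(2)]
    steps_hit_t[OF assms(1) l, unfolded nn(2)] steps_diff_le[OF assms(2,3), unfolded nn(2)]
    steps_lookup_le[OF assms(4)] steps_counter_t[OF assms(4)] steps_unseen_t[OF assms(5)]
  have 1: "steps (sat_state_t tot seen X s M r) \<le> 40 * q"
  proof (cases r)
    case (Choice H P N)
    then show ?thesis
      using bounds(1)[of N] bounds(2)[of P] bounds(14)[of "constraint_of r"] bounds(16)[of tot r] nn(1) assms(6)
      by (simp add: split_def)
  next
    case (Disj H P N)
    then show ?thesis
      using bounds(1)[of N] bounds(1)[of H] bounds(2)[of P] nn(1) assms(6) by (simp add: split_def)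
  next
    case (Weight H P N w b)
    then show ?thesis
      using bounds(1)[of H] bounds(3)[of w P] bounds(4)[of w N] bounds(15)[of r] bounds(16)[of tot r] nn(1) assms(6)
      by (simp add: split_def)
  qed
  have 2: "steps (sat_reduct_t tot seen X s M C r) \<le> 40 * q"
  proof (cases r)
    case (Choice H P N)
    then show ?thesis
      using bounds(1)[of N] bounds(6)[of P] bounds(9)[of H] bounds(13) bounds(14)[of "constraint_of r"] bounds(15)[of r] bounds(16)[of tot r]
        nn(1) assms(6)
      by (simp add: split_def)
  next
    case (Disj H P N)
    then show ?thesis
      using bounds(1)[of N] bounds(5)[of H] bounds(6)[of P] nn(1) assms(6) by (simp add: split_def)
  next
    case (Weight H P N w b)
    then show ?thesis
      using bounds(5)[of H] bounds(7)[of w P] bounds(4)[of w N] bounds(15)[of r] bounds(16)[of tot r] nn(1) assms(6)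
      by (simp add: split_def)
  qed
  show "steps (sat_state_t tot seen X s M r) \<le> 40 * (n * n)"
    "steps (sat_reduct_t tot seen X s M C r) \<le> 40 * (n * n)"
    using 1 2 by (simp_all add: q_def)
qed

lemma steps_mark_t:
  assumes "\<And>r. steps (f r) \<le> B" "length s \<le> n" "length R \<le> n"
  shows "steps (mark_t f R s) \<le> n * (2 * n + B + 3) + 1"
proof -
  have "steps (mem_t r R) + steps (f r) \<le> 2 * n + B + 1" "steps (mem_t r R) \<le> 2 * n + B + 1" for r
    using steps_mem_le[OF assms(3), of r] assms(1)[of r] by simp_all
  then have "steps (case x of (r, v) \<Rightarrow> do { i \<leftarrow> mem_t r R;
     if i then do { b \<leftarrow> f r; prim (r, if b then \<infinity> else v) } else prim (r, v) }) \<le> 2 * n + B + 2" for x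
    by (cases x) (simp add: steps_if)
  note inner = this
  have e: "2 * n + B + 3 = (2 * n + B + 2) + 1" by simp
  show ?thesis unfolding mark_t_def e by (rule steps_map_le[OF inner assms(2)])
qed

lemma steps_bag_weight_t: "length X \<le> n \<Longrightarrow> steps (bag_weight_t X r) \<le> 4 * n + 3"
  using steps_sum_le[of X "\<lambda>a. prim (wght r a)" 1 n] steps_sum_le[of X "\<lambda>a. prim (if a \<in> heads r then 1 else 0)" 1 n]
  by (simp add: bag_weight_t_def)

lemma steps_atoms_eq_t:
  "length C \<le> n \<Longrightarrow> length C' \<le> n \<Longrightarrow> steps (atoms_eq_t C C') \<le> 4 * (n * n) + 4 * n + 3"
  unfolding atoms_eq_t_def
  by (rule order_trans[OF steps_set_eq_t[where B = 1 and L = n]]) (auto simp: algebra_simps)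

lemma steps_state_eq_t:
  "length C \<le> n \<Longrightarrow> length C' \<le> n \<Longrightarrow> steps (state_eq_t C C') \<le> 4 * (n * n) + 4 * n + 3"
  unfolding state_eq_t_def
  by (rule order_trans[OF steps_set_eq_t[where B = 1 and L = n]]) (auto simp: algebra_simps)

lemma steps_uplus_t:
  assumes "length s \<le> n" "length s' \<le> n"
  shows "steps (uplus_t s s') \<le> 2 * (n * n) + 7 * n + 3"
proof -
  have "steps (map_t (\<lambda>(r, v). do {
       u \<leftarrow> lookup_t s' r;
       prim (r, case u of None \<Rightarrow> v | Some u \<Rightarrow> trunc_val r (v + u)) }) s) \<le> n * ((n + 2) + 1) + 1"
    by (rule steps_map_le) (use assms steps_lookup_le[OF assms(2)] in auto)
  moreover have "steps (filter_t (\<lambda>(r, v). do { u \<leftarrow> lookup_t s r; prim (u = None) }) s') \<le> n * ((n + 2) + 1) + 1"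
    by (rule steps_filter_le) (use assms steps_lookup_le[OF assms(1)] in auto)
  ultimately show ?thesis
    using assms unfolding uplus_t_def by (simp add: steps_append_t algebra_simps)
qed

lemma steps_updt_t:
  "length s \<le> n \<Longrightarrow> length M \<le> n \<Longrightarrow> length C \<le> n \<Longrightarrow> steps (updt_t a M C s) \<le> 6 * n + 3"
  using steps_mem_le[of M n a] steps_mem_le[of C n a]
    steps_map_le[of s "\<lambda>(r, v). prim (r, trunc_val r (v + enat (contribution a (a \<in> set M) (a \<in> set C) r)))" 1 n]
  by (auto simp: updt_t_def)

lemma steps_delete_t: "length xs \<le> n \<Longrightarrow> steps (delete_t x xs) \<le> 2 * n + 1"
  unfolding delete_t_def by (rule order_trans[OF steps_filter_le[where B = 1]]) auto

lemma steps_delete_key_t: "length xs \<le> n \<Longrightarrow> steps (delete_key_t x xs) \<le> 2 * n + 1"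
  unfolding delete_key_t_def by (rule order_trans[OF steps_filter_le[where B = 1]]) auto

section \<open>Costs of rule-states, candidates and rows\<close>

context sizes
begin

lemma steps_rs_update:
  assumes "length X \<le> n" "length M \<le> n" "length s \<le> n" "length seen \<le> n" "length R' \<le> n"
  shows "steps (rs_update_t tot seen X s M R') \<le> 46 * Q"
    and "length C \<le> n \<Longrightarrow> steps (rs_update_reduct_t tot seen X s M C R') \<le> 46 * Q"
proof -
  have e: "n * (2 * n + 40 * (n * n) + 3) + 1 \<le> 46 * Q"
  proof -
    have "n * (2 * n + 40 * (n * n) + 3) + 1 = 2 * (n * n) + 40 * Q + 3 * n + 1"
      by (simp add: Q algebra_simps)
    then show ?thesis using Q_ge by linarith
  qed
  show "steps (rs_update_t tot seen X s M R') \<le> 46 * Q"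
    unfolding rs_update_t_def
    by (rule order_trans[OF steps_mark_t e], rule steps_sat_t(1)[where C = "[]"]) (use assms n in auto)
  show "steps (rs_update_reduct_t tot seen X s M C R') \<le> 46 * Q" if "length C \<le> n"
    unfolding rs_update_reduct_t_def
    by (rule order_trans[OF steps_mark_t e], rule steps_sat_t(2)) (use assms n that in auto)
qed

lemma cand_lengths: "cand_ok A R c \<Longrightarrow> length (fst c) \<le> n \<and> length (snd c) \<le> n"
  by (auto simp: cand_ok_def set_length state_length)

lemma row_lengths:
  assumes "row_ok A R (M, s, cs)"
  shows "length M \<le> n" "length s \<le> n" "length cs \<le> S"
  using assms by (auto simp: row_ok_def set_length state_length length_cands)

lemma steps_cand_eq: "cand_ok A R x \<Longrightarrow> cand_ok A R y \<Longrightarrow> steps (cand_eq_t x y) \<le> 23 * Q"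
proof -
  assume "cand_ok A R x" "cand_ok A R y"
  then have "length (fst x) \<le> n" "length (snd x) \<le> n" "length (fst y) \<le> n" "length (snd y) \<le> n"
    using cand_lengths by auto
  then have "steps (cand_eq_t x y) \<le> 8 * (n * n) + 8 * n + 7"
    using steps_atoms_eq_t[of "fst x" n "fst y"] steps_state_eq_t[of "snd x" n "snd y"]
    by (simp add: cand_eq_t_def split_def)
  then show ?thesis using Q_ge by linarith
qed

lemma SQ: "Q \<le> S * Q" "S \<le> S * Q" "S * Q \<le> S * S * Q" "S * S \<le> S * S * Q" "1 \<le> S * S * Q"
  using SN_ge Q_ge by auto

lemma steps_row_eq: "row_ok A R x \<Longrightarrow> row_ok A R y \<Longrightarrow> steps (row_eq_t x y) \<le> 80 * (S * S * Q)"
proof -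
  assume xy: "row_ok A R x" "row_ok A R y"
  obtain M s cs where x: "x = (M, s, cs)" by (cases x)
  obtain M' s' cs' where y: "y = (M', s', cs')" by (cases y)
  note l = row_lengths[OF xy(1)[unfolded x]] row_lengths[OF xy(2)[unfolded y]]
  have "steps (set_eq_t cand_eq_t cs cs') \<le> 2 * (S * (S * (23 * Q + 1) + 2)) + 3"
    by (rule steps_set_eq_t) (use xy l in \<open>auto simp: x y row_ok_def intro!: steps_cand_eq\<close>)
  also have "\<dots> = 46 * (S * S * Q) + 2 * (S * S) + 4 * S + 3" by (simp add: algebra_simps)
  finally have "steps (set_eq_t cand_eq_t cs cs') \<le> 46 * (S * S * Q) + 2 * (S * S) + 4 * S + 3" .
  then have "steps (row_eq_t x y) \<le> 46 * (S * S * Q) + 2 * (S * S) + 4 * S + 8 * (n * n) + 8 * n + 10"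
    using steps_atoms_eq_t[OF l(1,4)] steps_state_eq_t[OF l(2,5)]
    by (simp add: x y row_eq_t_def)
  then show ?thesis using SQ Q_ge by linarith
qed

lemma steps_nub_cands:
  assumes "\<And>c. c \<in> set cs \<Longrightarrow> cand_ok A R c" "length cs \<le> L"
  shows "steps (nub_t cand_eq_t cs) \<le> 26 * (L * (S * Q)) + 1"
proof -
  have "length (val (nub_t cand_eq_t cs)) \<le> S"
    by (rule length_cands) (use nub_cands[of cs A R] assms in auto)
  then have "steps (nub_t cand_eq_t cs) \<le> length cs * (S * (23 * Q + 1) + 2) + 1"
    using assms by (intro steps_nub_t steps_cand_eq) auto
  also have "\<dots> \<le> L * (26 * (S * Q)) + 1"
  proof (intro add_mono mult_mono assms(2))
    have "S * (23 * Q + 1) + 2 = 23 * (S * Q) + S + 2" by (simp add: algebra_simps)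
    then show "S * (23 * Q + 1) + 2 \<le> 26 * (S * Q)" using SQ(1,2) SN_ge(1) by linarith
  qed auto
  finally show ?thesis by simp
qed

lemma steps_nub_rows:
  assumes "\<And>x. x \<in> set \<tau> \<Longrightarrow> row_ok A R x" "length \<tau> \<le> L"
  shows "steps (nub_t row_eq_t \<tau>) \<le> 83 * (L * (N * (S * S * Q))) + 1"
proof -
  have "length (val (nub_t row_eq_t \<tau>)) \<le> N"
    by (rule length_rows) (use nub_rows[of \<tau> A R] assms in auto)
  then have "steps (nub_t row_eq_t \<tau>) \<le> length \<tau> * (N * (80 * (S * S * Q) + 1) + 2) + 1"
    using assms by (intro steps_nub_t steps_row_eq) auto
  also have "\<dots> \<le> L * (83 * (N * (S * S * Q))) + 1"
  proof (intro add_mono mult_mono assms(2))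
    have 1: "N * 1 \<le> N * (S * S * Q)" using SQ(5) by (intro mult_mono) auto
    have "N * (80 * (S * S * Q) + 1) + 2 = 80 * (N * (S * S * Q)) + N + 2" by (simp add: algebra_simps)
    then show "N * (80 * (S * S * Q) + 1) + 2 \<le> 83 * (N * (S * S * Q))" using 1 SN_ge(2) by linarith
  qed auto
  finally show ?thesis by simp
qed

end

text \<open>Accounts for a loop of \<open>x\<close> rounds of cost \<open>c * y + d\<close> with
  overhead \<open>e\<close>: lower order terms are folded into the coefficient, so that each nesting
  level just multiplies by one factor.\<close>

lemma scale: "1 \<le> x \<Longrightarrow> 1 \<le> y \<Longrightarrow> x * (c * y + d) + e \<le> (c + d + e) * (x * y)" for x y :: nat
proof -
  assume "1 \<le> x" "1 \<le> y"
  then have "x \<le> x * y" "1 \<le> x * y" by auto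
  then have le: "d * x + e * 1 \<le> d * (x * y) + e * (x * y)" by (intro add_mono mult_left_mono) auto
  have eq: "x * (c * y + d) + e = c * (x * y) + (d * x + e * 1)"
    "(c + d + e) * (x * y) = c * (x * y) + (d * (x * y) + e * (x * y))"
    by (simp_all add: algebra_simps)
  show ?thesis unfolding eq using le by (rule add_left_mono)
qed

lemma cand_ok_mono: "cand_ok A R c \<Longrightarrow> A \<subseteq> A' \<Longrightarrow> cand_ok A' R c"
  by (auto simp: cand_ok_def)

section \<open>A ladder of cost levels for nested loops\<close>

context sizes
begin

text \<open>Each level adds one loop. \<open>P1\<close> is a pass over the candidates of a row;
  \<open>P2\<close> and \<open>P3\<close> are the deletion of duplicates among a multiple of
  \<open>S\<close>, respectively \<open>S * S\<close>, candidates. \<open>N1\<close> is a pass over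
  the rows with work \<open>P3\<close> each; \<open>N2\<close> and \<open>N3\<close> are the
  deletion of duplicates among a multiple of \<open>N\<close>, respectively \<open>N * N\<close>,
  rows.\<close>

definition "P1 = S * Q"
definition "P2 = S * P1"
definition "P3 = S * P2"
definition "N1 = N * P3"
definition "N2 = N * N1"
definition "N3 = N * N2"

lemma P_chain: "1 \<le> Q" "n \<le> Q" "n * n \<le> Q" "Q \<le> P1" "P1 \<le> P2" "P2 \<le> P3" "P3 \<le> N1" "N1 \<le> N2" "N2 \<le> N3"
  "S \<le> P1" "S * S \<le> P2" "N \<le> N1" "N * N \<le> N2"
  using SN_ge Q_ge by (auto simp: P1_def P2_def P3_def N1_def N2_def N3_def)

lemma P_pos: "1 \<le> P1" "1 \<le> P2" "1 \<le> P3" "1 \<le> N1" "1 \<le> N2" "1 \<le> N3"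
  using P_chain by linarith+

lemma scaled:
  "S * (c * Q + d) + e \<le> (c + d + e) * P1"
  "S * (c * P1 + d) + e \<le> (c + d + e) * P2"
  "S * (c * P2 + d) + e \<le> (c + d + e) * P3"
  "N * (c * P3 + d) + e \<le> (c + d + e) * N1"
  "N * (c * N1 + d) + e \<le> (c + d + e) * N2"
  using scale SN_ge P_chain(1) P_pos unfolding P1_def P2_def P3_def N1_def N2_def by blast+

lemma steps_atoms_eq: "length C \<le> n \<Longrightarrow> length C' \<le> n \<Longrightarrow> steps (atoms_eq_t C C') \<le> 11 * Q"
  using steps_atoms_eq_t[of C n C'] P_chain(1-3) by linarith

lemma steps_uplus: "length s \<le> n \<Longrightarrow> length s' \<le> n \<Longrightarrow> steps (uplus_t s s') \<le> 12 * Q"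
  using steps_uplus_t[of s n s'] P_chain(1-3) by linarith

text \<open>The factor 3 covers both origins of long lists: introducing an atom yields
  \<open>2 * S + 1\<close> candidates at most, and a join yields \<open>S * S + 2 * S\<close> at
  most.\<close>

lemma nub_cands_steps:
  assumes "\<And>c. c \<in> set cs \<Longrightarrow> cand_ok A R c"
  shows "length cs \<le> 3 * S \<Longrightarrow> steps (nub_t cand_eq_t cs) \<le> 79 * P2"
    "length cs \<le> 3 * (S * S) \<Longrightarrow> steps (nub_t cand_eq_t cs) \<le> 79 * P3"
proof -
  show "steps (nub_t cand_eq_t cs) \<le> 79 * P2" if "length cs \<le> 3 * S"
  proof -
    have "steps (nub_t cand_eq_t cs) \<le> 26 * (3 * S * (S * Q)) + 1"
      by (rule steps_nub_cands[OF assms that])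
    also have "\<dots> = 78 * P2 + 1" by (simp add: P1_def P2_def)
    finally show ?thesis using P_pos by linarith
  qed
  show "steps (nub_t cand_eq_t cs) \<le> 79 * P3" if "length cs \<le> 3 * (S * S)"
  proof -
    have "steps (nub_t cand_eq_t cs) \<le> 26 * (3 * (S * S) * (S * Q)) + 1"
      by (rule steps_nub_cands[OF assms that])
    also have "\<dots> = 78 * P3 + 1" by (simp add: P1_def P2_def P3_def)
    finally show ?thesis using P_pos by linarith
  qed
qed

text \<open>The length \<open>2 * N\<close> occurs when an atom is introduced, with two new rows per
  old one, and \<open>N * N\<close> at a join.\<close>

lemma nub_rows_steps:
  assumes "\<And>x. x \<in> set \<tau> \<Longrightarrow> row_ok A R x"
  shows "length \<tau> \<le> 2 * N \<Longrightarrow> steps (nub_t row_eq_t \<tau>) \<le> 167 * N2"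
    "length \<tau> \<le> N * N \<Longrightarrow> steps (nub_t row_eq_t \<tau>) \<le> 84 * N3"
proof -
  have e: "N * (S * S * Q) \<le> N1"
    using P_chain(6) by (simp add: N1_def P1_def P2_def)
  show "steps (nub_t row_eq_t \<tau>) \<le> 167 * N2" if "length \<tau> \<le> 2 * N"
  proof -
    have "steps (nub_t row_eq_t \<tau>) \<le> 83 * (2 * N * (N * (S * S * Q))) + 1"
      by (rule steps_nub_rows[OF assms that])
    also have "\<dots> \<le> 83 * (2 * N * N1) + 1"
      using e by (intro add_mono mult_left_mono) auto
    also have "\<dots> = 166 * N2 + 1" by (simp add: N2_def)
    finally show ?thesis using P_pos by linarith
  qed
  show "steps (nub_t row_eq_t \<tau>) \<le> 84 * N3" if "length \<tau> \<le> N * N"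
  proof -
    have "steps (nub_t row_eq_t \<tau>) \<le> 83 * (N * N * (N * (S * S * Q))) + 1"
      by (rule steps_nub_rows[OF assms that])
    also have "\<dots> \<le> 83 * (N * N * N1) + 1"
      using e by (intro add_mono mult_left_mono) auto
    also have "\<dots> = 83 * N3 + 1" by (simp add: N2_def N3_def)
    finally show ?thesis using P_pos by linarith
  qed
qed

lemma steps_map_cands:
  assumes "\<And>c. c \<in> set cs \<Longrightarrow> steps (f c) \<le> k * Q" "length cs \<le> S"
  shows "steps (map_t f cs) \<le> (k + 2) * P1"
proof -
  have "steps (map_t f cs) \<le> S * (k * Q + 1) + 1" by (rule steps_map_le[OF assms])
  also have "\<dots> \<le> (k + 1 + 1) * P1" by (rule scaled(1))
  finally show ?thesis by simp
qed

text \<open>The parameters of the locale belong to the new bag, whereas \<open>x\<close> is a row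
  over the smaller bag of the child. This is why the number of its candidates is bounded by an
  assumption.\<close>

lemma steps_intro_row:
  assumes x: "row_ok A0 R x" "length (snd (snd x)) \<le> S" and A: "A = insert a A0" "a \<notin> A0"
    and l: "length X \<le> n" "length seen \<le> n" "length R' \<le> n"
  shows "steps (intro_row_t tot seen X R' a x) \<le> 500 * P2"
proof -
  obtain M s cs where xe: "x = (M, s, cs)" by (cases x)
  have M: "distinct M" "set M \<subseteq> A0" "state_ok R s" "\<And>c. c \<in> set cs \<Longrightarrow> cand_ok A0 R c" "length cs \<le> S"
    using x unfolding xe row_ok_def by auto
  have la: "length (a # C) \<le> n" "length C \<le> n" if "distinct C" "set C \<subseteq> A0" for C
    using that A set_length[of "a # C"] set_length[of C] by auto
  note lM = la[OF M(1,2)] and ls = state_length[OF M(3)]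
  have lc: "length (a # fst c) \<le> n" "length (fst c) \<le> n" "length (snd c) \<le> n" if "c \<in> set cs" for c
    using M(4)[OF that] la[of "fst c"] by (auto simp: cand_ok_def state_length)
  define f where "f = (\<lambda>N (C, \<rho>). do {
         \<rho> \<leftarrow> rs_update_reduct_t tot seen X \<rho> N C R'; prim (C :: 'a list, \<rho>) })"
  define f' where "f' = (\<lambda>(C, \<rho>). do {
         \<rho> \<leftarrow> rs_update_reduct_t tot seen X \<rho> (a # M) (a # C) R'; prim (a # C, \<rho>) })"
  have sf: "steps (map_t (f K) cs) \<le> 49 * P1" if "length K \<le> n" for K
  proof -
    have "steps (f K c) \<le> 47 * Q" if "c \<in> set cs" for c
      using steps_rs_update(2)[OF l(1) \<open>length K \<le> n\<close> lc(3)[OF that] l(2,3) lc(2)[OF that], of tot] P_chain(1)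
      by (simp add: f_def split_def)
    from steps_map_cands[OF this M(5)] show ?thesis by simp
  qed
  have sf': "steps (map_t f' cs) \<le> 49 * P1"
  proof -
    have "steps (f' c) \<le> 47 * Q" if "c \<in> set cs" for c
      using steps_rs_update(2)[OF l(1) lM(1) lc(3)[OF that] l(2,3) lc(1)[OF that], of tot] P_chain(1)
      by (simp add: f'_def split_def)
    from steps_map_cands[OF this M(5)] show ?thesis by simp
  qed
  let ?l = "(M, val (rs_update_reduct_t tot seen X s (a # M) M R')) # val (map_t f' cs) @ val (map_t (f (a # M)) cs)"
  have ok1: "cand_ok A R (val (f' c))" if "c \<in> set cs" for c
    using M(4)[OF that] A by (cases c) (auto simp: f'_def cand_ok_def state_ok_rs_update_reduct)
  have ok2: "cand_ok A R (val (f K c))" if "c \<in> set cs" for c K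
    using M(4)[OF that] A by (cases c) (auto simp: f_def cand_ok_def state_ok_rs_update_reduct)
  have ok0: "cand_ok A R (M, val (rs_update_reduct_t tot seen X s (a # M) M R'))"
    using M A by (auto simp: cand_ok_def state_ok_rs_update_reduct)
  have n1: "steps (nub_t cand_eq_t ?l) \<le> 79 * P2"
    by (rule nub_cands_steps(1)[OF _]) (use ok0 ok1 ok2 M(5) SN_ge in auto)
  have n2: "steps (nub_t cand_eq_t (val (map_t (f M) cs))) \<le> 79 * P2"
    by (rule nub_cands_steps(1)[OF _]) (use ok2 M(5) in auto)
  have ap: "steps (append_t (val (map_t f' cs)) ys) \<le> P1 + 1" for ys
    using M(5) P_chain by (simp add: steps_append_t)
  have "steps (intro_row_t tot seen X R' a x) =
      steps (rs_update_t tot seen X s (a # M) R') +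
      steps (rs_update_reduct_t tot seen X s (a # M) M R') + steps (map_t f' cs) + steps (map_t (f (a # M)) cs) +
      steps (append_t (val (map_t f' cs)) (val (map_t (f (a # M)) cs))) + steps (nub_t cand_eq_t ?l) +
      steps (rs_update_t tot seen X s M R') + steps (map_t (f M) cs) +
      steps (nub_t cand_eq_t (val (map_t (f M) cs))) + 1"
    unfolding xe intro_row_t_def f_def f'_def by (simp del: nub_t.simps)
  then show ?thesis
    using steps_rs_update(1)[OF l(1) lM(1) ls l(2,3), of tot] steps_rs_update(2)[OF l(1) lM(1) ls l(2,3) lM(2), of tot]
      steps_rs_update(1)[OF l(1) lM(2) ls l(2,3), of tot] sf[OF lM(1)] sf[OF lM(2)] sf' n1 n2
      ap[of "val (map_t (f (a # M)) cs)"] P_chain P_pos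
    by linarith
qed

lemma steps_intro_rule_row:
  assumes x: "row_ok A R0 x" "length (snd (snd x)) \<le> S" and R: "R = insert r R0" "r \<notin> R0"
    and l: "length X \<le> n" "length seen \<le> n"
  shows "steps (intro_rule_row_t tot seen X r x) \<le> 500 * P2"
proof -
  obtain M s cs where xe: "x = (M, s, cs)" by (cases x)
  have M: "distinct M" "set M \<subseteq> A" "state_ok R0 s" "\<And>c. c \<in> set cs \<Longrightarrow> cand_ok A R0 c" "length cs \<le> S"
    using x unfolding xe row_ok_def by auto
  have lr: "length [r] \<le> n" using n by simp
  have ok: "state_ok R ((r, 0) # s')" if "state_ok R0 s'" for s'
    using state_ok_Cons[OF that R(2)] R by simp
  note lM = set_length[OF M(1,2)] and ls = state_length[OF ok[OF M(3)]]
  have lc: "length (fst c) \<le> n" "length ((r, 0) # snd c) \<le> n" if "c \<in> set cs" for c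
    using M(4)[OF that] set_length state_length[OF ok] by (auto simp: cand_ok_def split_def)
  define f where "f = (\<lambda>(C, \<rho>). do {
         \<rho> \<leftarrow> rs_update_reduct_t tot seen X ((r, 0) # \<rho>) M C [r]; prim (C :: 'a list, \<rho>) })"
  have "steps (f c) \<le> 47 * Q" if "c \<in> set cs" for c
    using steps_rs_update(2)[OF l(1) lM lc(2)[OF that] l(2) lr lc(1)[OF that], of tot] P_chain(1)
    by (simp add: f_def split_def)
  from steps_map_cands[OF this M(5)] have sf: "steps (map_t f cs) \<le> 49 * P1" by simp
  have okf: "cand_ok A R (val (f c))" if "c \<in> set cs" for c
    using M(4)[OF that] ok by (cases c) (auto simp: f_def cand_ok_def intro!: state_ok_rs_update_reduct)
  have n2: "steps (nub_t cand_eq_t (val (map_t f cs))) \<le> 79 * P2"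
    by (rule nub_cands_steps(1)[OF _]) (use okf M(5) in auto)
  have "steps (intro_rule_row_t tot seen X r x) =
      steps (rs_update_t tot seen X ((r, 0) # s) M [r]) + steps (map_t f cs) +
      steps (nub_t cand_eq_t (val (map_t f cs))) + 1"
    unfolding xe intro_rule_row_t_def f_def by simp
  then show ?thesis
    using steps_rs_update(1)[OF l(1) lM ls l(2) lr, of tot] sf n2 P_chain P_pos by linarith
qed

lemma steps_remove_atom_row:
  assumes x: "row_ok A R x"
  shows "steps (remove_atom_row_t a x) \<le> 500 * P2"
proof -
  obtain M s cs where xe: "x = (M, s, cs)" by (cases x)
  have M: "distinct M" "set M \<subseteq> A" "state_ok R s" "\<And>c. c \<in> set cs \<Longrightarrow> cand_ok A R c"
    using x unfolding xe row_ok_def by auto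
  note l = row_lengths[OF x[unfolded xe]]
  define f where "f = (\<lambda>(C, \<rho>). do {
         C' \<leftarrow> delete_t a C; \<rho> \<leftarrow> updt_t a M C \<rho>; prim (C', \<rho>) })"
  have "steps (f c) \<le> 20 * Q" if "c \<in> set cs" for c
    using cand_lengths[OF M(4)[OF that]] steps_delete_t[of "fst c" n a] steps_updt_t[of "snd c" n M "fst c" a] l P_chain(1,2)
    by (simp add: f_def split_def)
  from steps_map_cands[OF this l(3)] have sf: "steps (map_t f cs) \<le> 22 * P1" by simp
  have okf: "cand_ok A R (val (f c))" if "c \<in> set cs" for c
    using M(4)[OF that] by (cases c) (auto simp: f_def cand_ok_def val_delete_t intro!: state_ok_updt)
  have n2: "steps (nub_t cand_eq_t (val (map_t f cs))) \<le> 79 * P2"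
    by (rule nub_cands_steps(1)[OF _]) (use okf l(3) in auto)
  have "steps (remove_atom_row_t a x) = steps (delete_t a M) + steps (updt_t a M M s) + steps (map_t f cs) +
      steps (nub_t cand_eq_t (val (map_t f cs))) + 1"
    unfolding xe remove_atom_row_t_def f_def by simp
  then show ?thesis
    using steps_delete_t[OF l(1), of a] steps_updt_t[OF l(2,1,1), of a] sf n2 P_chain P_pos by linarith
qed

text \<open>Here the locale describes the larger bag of the child. The result lives over
  \<open>R - {r}\<close>, and a second instance bounds the number of distinct candidates
  there.\<close>

lemma steps_remove_rule_row:
  assumes x: "row_ok A R x" and R0: "sizes A (R - {r}) n m S N Q"
  shows "steps (remove_rule_row_t r x) \<le> 500 * P2"
proof -
  obtain M s cs where xe: "x = (M, s, cs)" by (cases x)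
  have M: "distinct M" "set M \<subseteq> A" "state_ok R s" "\<And>c. c \<in> set cs \<Longrightarrow> cand_ok A R c"
    using x unfolding xe row_ok_def by auto
  note l = row_lengths[OF x[unfolded xe]]
  define g where "g = (\<lambda>(C :: 'a list, \<rho> :: 'a state_list). do { v \<leftarrow> lookup_t \<rho> r; prim (v = Some \<infinity>) })"
  define f where "f = (\<lambda>(C :: 'a list, \<rho> :: 'a state_list). do { \<rho> \<leftarrow> delete_key_t r \<rho>; prim (C, \<rho>) })"
  let ?cs = "val (filter_t g cs)"
  have sub: "set ?cs \<subseteq> set cs" "length ?cs \<le> S"
    using order_trans[OF length_filter_le[of "\<lambda>c. val (g c)" cs] l(3)] by auto
  have "steps (f c) \<le> 4 * Q" if "c \<in> set ?cs" for c
    using cand_lengths[OF M(4)[of c]] sub that steps_delete_key_t[of "snd c" n r] P_chain(1,2)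
    by (auto simp: f_def split_def)
  from steps_map_cands[OF this sub(2)] have sf: "steps (map_t f ?cs) \<le> 6 * P1" by simp
  have "steps (g c) \<le> 3 * Q" if "c \<in> set cs" for c
    using cand_lengths[OF M(4)[OF that]] steps_lookup_le[of "snd c" n r] P_chain(1,2)
    by (simp add: g_def split_def)
  from steps_filter_le[of cs g, OF this l(3)] scaled(1)[of 3 1 1] have sg: "steps (filter_t g cs) \<le> 5 * P1" by simp
  have okf: "cand_ok A (R - {r}) (val (f c))" if "c \<in> set cs" for c
    using M(4)[OF that] by (cases c) (auto simp: f_def cand_ok_def intro!: state_ok_delete)
  have n2: "steps (nub_t cand_eq_t (val (map_t f ?cs))) \<le> 79 * P2"
    \<comment> \<open>The levels depend on \<open>S\<close> and \<open>Q\<close> only, so after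
      unfolding they are the same for both instances.\<close>
    unfolding P1_def P2_def
    by (rule sizes.nub_cands_steps(1)[OF R0, unfolded sizes.P1_def[OF R0] sizes.P2_def[OF R0]]) (use okf sub in auto)
  have "steps (remove_rule_row_t r x) = steps (delete_key_t r s) + steps (filter_t g cs) + steps (map_t f ?cs) +
      steps (nub_t cand_eq_t (val (map_t f ?cs))) + 1"
    unfolding xe remove_rule_row_t_def f_def g_def by simp
  then show ?thesis
    using steps_delete_key_t[OF l(2), of r] sf sg n2 P_chain P_pos by linarith
qed

text \<open>Forming all pairs stays within a multiple of \<open>P2\<close>. The order
  \<open>P3\<close> arises when up to \<open>3 * (S * S)\<close> results are reduced to at most
  \<open>S\<close> distinct ones.\<close>

lemma steps_join_cands:
  assumes x: "row_ok A R (M, s', cs')" "row_ok A R (M'', s'', cs'')"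
  shows "steps (join_cands_t M s' cs' s'' cs'') \<le> 300 * P3"
proof -
  note l' = row_lengths[OF x(1)] and l'' = row_lengths[OF x(2)]
  have lc': "length (fst c) \<le> n \<and> length (snd c) \<le> n" if "c \<in> set cs'" for c
    using x(1) that by (intro cand_lengths) (auto simp: row_ok_def)
  have lc'': "length (fst c) \<le> n \<and> length (snd c) \<le> n" if "c \<in> set cs''" for c
    using x(2) that by (intro cand_lengths) (auto simp: row_ok_def)
  define f where "f = (\<lambda>(C', \<rho>' :: 'a state_list) (C'', \<rho>''). do {
         b \<leftarrow> atoms_eq_t C' C'';
         if b then do { \<rho> \<leftarrow> uplus_t \<rho>' \<rho>''; prim [(C' :: 'a list, \<rho>)] } else prim [] })"
  define g where "g = (\<lambda>c. do { css \<leftarrow> map_t (f c) cs''; concat_t css })"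
  define h' where "h' = (\<lambda>(C, \<rho>). do {
       b \<leftarrow> atoms_eq_t C M;
       if b then do { \<rho> \<leftarrow> uplus_t \<rho> s''; prim [(M, \<rho>)] } else prim [] })"
  define h'' where "h'' = (\<lambda>(C, \<rho>). do {
       b \<leftarrow> atoms_eq_t C M;
       if b then do { \<rho> \<leftarrow> uplus_t s' \<rho>; prim [(M, \<rho>)] } else prim [] })"
  have lf: "length (val (f c d)) \<le> 1" for c d by (simp add: f_def split_def val_if)
  have lh: "length (val (h' c)) \<le> 1" "length (val (h'' c)) \<le> 1" for c
    by (simp_all add: h'_def h''_def split_def val_if)
  have concat1: "steps (concat_t (map k ys)) \<le> 4 * P1" "length (concat (map k ys)) \<le> S"
    if "\<And>y. length (k y) \<le> 1" "length ys \<le> S" for k :: "'b \<Rightarrow> 'c list" and ys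
  proof -
    have "steps (concat_t (map k ys)) \<le> S * (1 + 2) + 1"
      by (rule steps_concat_le) (use that in auto)
    then show "steps (concat_t (map k ys)) \<le> 4 * P1" using P_chain(10) P_pos(1) by simp
    have "length (concat (map k ys)) \<le> length (map k ys) * 1"
      by (rule length_concat_le) (use that in auto)
    then show "length (concat (map k ys)) \<le> S" using that by simp
  qed
  have sf: "steps (f c d) \<le> 24 * Q" if "c \<in> set cs'" "d \<in> set cs''" for c d
    using steps_atoms_eq[of "fst c" "fst d"] steps_uplus[of "snd c" "snd d"] lc'[OF that(1)] lc''[OF that(2)] P_chain(1)
    by (simp add: f_def split_def steps_if)
  have sg: "steps (g c) \<le> 30 * P1" if "c \<in> set cs'" for c
    using steps_map_cands[of cs'' "f c" 24, OF sf[OF that] l''(3)]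
      concat1(1)[of "\<lambda>d. val (f c d)" cs'', OF lf l''(3)]
    by (simp add: g_def)
  have s1: "steps (map_t g cs') \<le> 32 * P2"
    using steps_map_le[of cs' g, OF sg l'(3)] scaled(2)[of 30 1 1] by simp
  have lg: "length (val (g c)) \<le> S" for c
    using concat1(2)[of "\<lambda>d. val (f c d)" cs'', OF lf l''(3)] by (simp add: g_def)
  have s2: "steps (concat_t (val (map_t g cs'))) \<le> 4 * P2"
  proof -
    have "steps (concat_t (val (map_t g cs'))) \<le> S * (S + 2) + 1"
      by (rule steps_concat_le) (use lg l'(3) in auto)
    also have "S * (S + 2) + 1 = S * S + 2 * S + 1" by (simp add: algebra_simps)
    finally show ?thesis using P_chain(5,10,11) P_pos(2) by linarith
  qed
  have l1: "length (concat (val (map_t g cs'))) \<le> S * S"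
  proof -
    have "length (concat (val (map_t g cs'))) \<le> length (val (map_t g cs')) * S"
      by (rule length_concat_le) (use lg in auto)
    also have "\<dots> \<le> S * S" using l'(3) by simp
    finally show ?thesis .
  qed
  have "steps (h' c) \<le> 24 * Q" if "c \<in> set cs'" for c
    using steps_atoms_eq[of "fst c" M] steps_uplus[of "snd c" s''] lc'[OF that] l'(1) l''(2) P_chain(1)
    by (simp add: h'_def split_def steps_if)
  from steps_map_cands[OF this l'(3)] have s3: "steps (map_t h' cs') \<le> 26 * P1" by simp
  have "steps (h'' c) \<le> 24 * Q" if "c \<in> set cs''" for c
    using steps_atoms_eq[of "fst c" M] steps_uplus[of s' "snd c"] lc''[OF that] l'(1,2) P_chain(1)
    by (simp add: h''_def split_def steps_if)
  from steps_map_cands[OF this l''(3)] have s4: "steps (map_t h'' cs'') \<le> 26 * P1" by simp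
  note c3 = concat1[of "\<lambda>c. val (h' c)" cs', OF lh(1) l'(3)] and c4 = concat1[of "\<lambda>c. val (h'' c)" cs'', OF lh(2) l''(3)]
  let ?ll = "[concat (val (map_t g cs')), concat (val (map_t h' cs')), concat (val (map_t h'' cs''))]"
  have SS: "S \<le> S * S" using SN_ge by simp
  have s5: "steps (concat_t ?ll) \<le> 10 * P2"
  proof -
    have "steps (concat_t ?ll) \<le> 3 * (S * S + 2) + 1"
      by (rule steps_concat_le) (use l1 order_trans[OF c3(2) SS] order_trans[OF c4(2) SS] in auto)
    then show ?thesis using P_chain(11) P_pos(2) by simp
  qed
  \<comment> \<open>Identifies the intermediate list of the timed program with the one whose entries
    are known to be well-formed.\<close>
  have j: "concat ?ll = joined_cands M s' cs' s'' cs''"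
    by (simp add: joined_cands_def g_def f_def h'_def h''_def split_def val_if if_distrib[of val] cong: if_cong)
  have s6: "steps (nub_t cand_eq_t (concat ?ll)) \<le> 79 * P3"
  proof (rule nub_cands_steps(2))
    show "\<And>c. c \<in> set (concat ?ll) \<Longrightarrow> cand_ok A R c"
      unfolding j by (rule cand_ok_joined[OF x])
    show "length (concat ?ll) \<le> 3 * (S * S)" using l1 order_trans[OF c3(2) SS] order_trans[OF c4(2) SS] by simp
  qed
  have "steps (join_cands_t M s' cs' s'' cs'') = steps (map_t g cs') + steps (concat_t (val (map_t g cs'))) +
      steps (map_t h' cs') + steps (concat_t (val (map_t h' cs'))) +
      steps (map_t h'' cs'') + steps (concat_t (val (map_t h'' cs''))) +
      steps (concat_t ?ll) + steps (nub_t cand_eq_t (concat ?ll))"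
  proof -
    have g: "(\<lambda>(C', \<rho>'). do {
       css \<leftarrow> map_t (\<lambda>(C'', \<rho>''). do {
         b \<leftarrow> atoms_eq_t C' C'';
         if b then do { \<rho> \<leftarrow> uplus_t \<rho>' \<rho>''; prim [(C', \<rho>)] } else prim [] }) cs'';
       concat_t css }) = g"
      by (auto simp: fun_eq_iff g_def f_def)
    show ?thesis
      unfolding join_cands_t_def g h'_def h''_def by (simp del: concat_t.simps)
  qed
  then show ?thesis
    using s1 s2 s3 s4 s5 s6 c3(1) c4(1) P_chain P_pos by simp
qed

lemma steps_join_row:
  assumes x: "row_ok A R x'" "row_ok A R x''"
  shows "steps (join_row_t x' x'') \<le> 330 * P3"
proof -
  obtain M' s' cs' M'' s'' cs'' where e: "x' = (M', s', cs')" "x'' = (M'', s'', cs'')"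
    by (cases x'; cases x'')
  note l' = row_lengths[OF x(1)[unfolded e]] and l'' = row_lengths[OF x(2)[unfolded e]]
  have "steps (join_row_t x' x'') \<le>
    steps (atoms_eq_t M' M'') + steps (uplus_t s' s'') + steps (join_cands_t M' s' cs' s'' cs'') + 1"
    unfolding e by (simp add: join_row_t_def steps_if)
  then show ?thesis
    using steps_atoms_eq[OF l'(1) l''(1)] steps_uplus[OF l'(2) l''(2)]
      steps_join_cands[OF x[unfolded e]] P_chain P_pos by linarith
qed

end

lemma row_ok_mono: "row_ok A R x \<Longrightarrow> A \<subseteq> A' \<Longrightarrow> row_ok A' R x"
  by (auto simp: row_ok_def cand_ok_mono)

lemma seen_ok_length: "seen_ok B R seen \<Longrightarrow> length seen = card R"
  unfolding seen_ok_def by (metis distinct_card length_map list.set_map)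

section \<open>Costs of the table operations\<close>

context sizes
begin

lemma steps_map_rows:
  assumes "\<And>x. x \<in> set \<tau> \<Longrightarrow> steps (f x) \<le> k * P3" "length \<tau> \<le> N"
  shows "steps (map_t f \<tau>) \<le> (k + 2) * N1"
proof -
  have "steps (map_t f \<tau>) \<le> N * (k * P3 + 1) + 1" by (rule steps_map_le[OF assms])
  also have "\<dots> \<le> (k + 1 + 1) * N1" by (rule scaled(4))
  finally show ?thesis by simp
qed

lemma steps_intro_atom_t:
  assumes \<tau>: "table_ok A0 R \<tau>" "sizes A0 R n m S N Q" and A: "A = insert a A0" "a \<notin> A0"
    and l: "length X \<le> n" "length seen \<le> n" "length R' \<le> n"
  shows "steps (intro_atom_t tot X R' a (seen, \<tau>)) \<le> 1000 * N3"
proof -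
  have x: "row_ok A0 R x" "length (snd (snd x)) \<le> S" if "x \<in> set \<tau>" for x
  proof -
    show *: "row_ok A0 R x" using \<tau>(1) that by (simp add: table_ok_def)
    show "length (snd (snd x)) \<le> S"
      using sizes.row_lengths(3)[OF \<tau>(2), of "fst x" "fst (snd x)" "snd (snd x)"] * by simp
  qed
  have lt: "length \<tau> \<le> N" by (rule sizes.length_rows[OF \<tau>(2,1)])
  define g where "g = (\<lambda>(r, w, h). prim (r :: 'a rule, w + wght r a, h + (if a \<in> heads r then 1 else (0::nat))))"
  have "steps (g x) \<le> 1" for x by (simp add: g_def split_def)
  from steps_map_le[of seen g, OF this l(2)] have s0: "steps (map_t g seen) \<le> n * 2 + 1" by simp
  let ?seen = "val (map_t g seen)"
  let ?f = "intro_row_t tot ?seen X R' a"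
  have "steps (?f x) \<le> 500 * P3" if "x \<in> set \<tau>" for x
    using steps_intro_row[OF x[OF that] A l(1) _ l(3), of ?seen tot] l(2) P_chain(6) by simp
  from steps_map_rows[OF this lt] have s1: "steps (map_t ?f \<tau>) \<le> 502 * N1" by simp
  have l2: "length xs \<le> 2" if "xs \<in> set (val (map_t ?f \<tau>))" for xs
    using that by (auto simp: intro_row_t_def split_def)
  have "steps (concat_t (val (map_t ?f \<tau>))) \<le> N * (2 + 2) + 1"
    by (rule steps_concat_le) (use l2 lt in auto)
  then have s2: "steps (concat_t (val (map_t ?f \<tau>))) \<le> 5 * N1" using P_chain(12) P_pos(4) by simp
  let ?rs = "concat (val (map_t ?f \<tau>))"
  have "length ?rs \<le> length (val (map_t ?f \<tau>)) * 2" by (rule length_concat_le[OF l2])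
  then have lrs: "length ?rs \<le> 2 * N" using lt by simp
  have ok: "row_ok A R z" if "z \<in> set ?rs" for z
  proof -
    obtain y where "y \<in> set \<tau>" "z \<in> set (val (?f y))" using \<open>z \<in> set ?rs\<close> by auto
    then show ?thesis using row_ok_intro[OF x(1) A(2)] A(1) by blast
  qed
  have s3: "steps (nub_t row_eq_t ?rs) \<le> 167 * N2" by (rule nub_rows_steps(1)[OF ok lrs])
  have "steps (intro_atom_t tot X R' a (seen, \<tau>)) = steps (map_t g seen) + steps (map_t ?f \<tau>) +
      steps (concat_t (val (map_t ?f \<tau>))) + steps (nub_t row_eq_t ?rs) + 1"
    unfolding intro_atom_t_alt g_def by simp
  then show ?thesis using s0 s1 s2 s3 P_chain P_pos by linarith
qed

text \<open>The strict bound on \<open>length seen\<close> leaves room for the record of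
  \<open>r\<close>, which is added before the rows are processed.\<close>

lemma steps_intro_rule_t:
  assumes \<tau>: "table_ok A R0 \<tau>" "sizes A R0 n m S N Q" and R: "R = insert r R0" "r \<notin> R0"
    and l: "length X \<le> n" "length seen < n"
  shows "steps (intro_rule_t tot X r (seen, \<tau>)) \<le> 1000 * N3"
proof -
  have x: "row_ok A R0 x" "length (snd (snd x)) \<le> S" if "x \<in> set \<tau>" for x
  proof -
    show *: "row_ok A R0 x" using \<tau>(1) that by (simp add: table_ok_def)
    show "length (snd (snd x)) \<le> S"
      using sizes.row_lengths(3)[OF \<tau>(2), of "fst x" "fst (snd x)" "snd (snd x)"] * by simp
  qed
  have lt: "length \<tau> \<le> N" by (rule sizes.length_rows[OF \<tau>(2,1)])
  let ?seen = "(r, val (bag_weight_t X r)) # seen"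
  let ?f = "intro_rule_row_t tot ?seen X r"
  have "steps (?f x) \<le> 500 * P3" if "x \<in> set \<tau>" for x
    using steps_intro_rule_row[OF x[OF that] R l(1), of ?seen tot] l(2) P_chain(6) by simp
  from steps_map_rows[OF this lt] have s1: "steps (map_t ?f \<tau>) \<le> 502 * N1" by simp
  let ?rs = "val (map_t ?f \<tau>)"
  have ok: "row_ok A R z" if "z \<in> set ?rs" for z
    using that row_ok_intro_rule[OF x(1) R(2)] R(1) by auto
  have s3: "steps (nub_t row_eq_t ?rs) \<le> 167 * N2" by (rule nub_rows_steps(1)[OF ok]) (use lt in auto)
  have "steps (intro_rule_t tot X r (seen, \<tau>)) = steps (bag_weight_t X r) + steps (map_t ?f \<tau>) +
      steps (nub_t row_eq_t ?rs) + 2"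
    unfolding intro_rule_t_alt by simp
  then show ?thesis using steps_bag_weight_t[OF l(1), of r] s1 s3 P_chain P_pos by linarith
qed

lemma steps_remove_atom_t:
  assumes \<tau>: "table_ok A R \<tau>"
  shows "steps (remove_atom_t a (seen, \<tau>)) \<le> 1000 * N3"
proof -
  have x: "row_ok A R x" if "x \<in> set \<tau>" for x using \<tau>(1) that by (simp add: table_ok_def)
  have lt: "length \<tau> \<le> N" by (rule length_rows[OF \<tau>])
  let ?f = "remove_atom_row_t a"
  have "steps (?f x) \<le> 500 * P3" if "x \<in> set \<tau>" for x
    using steps_remove_atom_row[OF x[OF that], of a] P_chain(6) by simp
  from steps_map_rows[OF this lt] have s1: "steps (map_t ?f \<tau>) \<le> 502 * N1" by simp
  let ?rs = "val (map_t ?f \<tau>)"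
  have ok: "row_ok A R z" if "z \<in> set ?rs" for z
  proof -
    obtain y where y: "y \<in> set \<tau>" "z = val (?f y)" using \<open>z \<in> set ?rs\<close> by auto
    show ?thesis unfolding y(2) using row_ok_mono[OF row_ok_remove_atom[OF x[OF y(1)]]] by blast
  qed
  have s3: "steps (nub_t row_eq_t ?rs) \<le> 167 * N2" by (rule nub_rows_steps(1)[OF ok]) (use lt in auto)
  have "steps (remove_atom_t a (seen, \<tau>)) = steps (map_t ?f \<tau>) + steps (nub_t row_eq_t ?rs) + 1"
    unfolding remove_atom_t_alt by simp
  then show ?thesis using s1 s3 P_chain P_pos by linarith
qed

lemma steps_remove_rule_t:
  assumes \<tau>: "table_ok A R \<tau>" and R0: "sizes A (R - {r}) n m S N Q" and l: "length seen \<le> n"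
  shows "steps (remove_rule_t r (seen, \<tau>)) \<le> 1000 * N3"
proof -
  have x: "row_ok A R x" if "x \<in> set \<tau>" for x using \<tau>(1) that by (simp add: table_ok_def)
  have lt: "length \<tau> \<le> N" by (rule length_rows[OF \<tau>])
  define g where "g = (\<lambda>(M :: 'a list, \<sigma>, cs :: 'a cand_list). do { v \<leftarrow> lookup_t \<sigma> r; prim (v = Some (\<infinity> :: enat)) })"
  let ?\<tau> = "val (filter_t g \<tau>)"
  have sub: "set ?\<tau> \<subseteq> set \<tau>" "length ?\<tau> \<le> N"
    using order_trans[OF length_filter_le[of "\<lambda>x. val (g x)" \<tau>] lt] by auto
  have "steps (g y) \<le> 3 * P3" if "y \<in> set \<tau>" for y
  proof -
    obtain M s cs where y: "y = (M, s, cs)" by (cases y)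
    show ?thesis
      using steps_lookup_le[OF row_lengths(2)[OF x[OF that, unfolded y]], of r] P_chain P_pos by (simp add: g_def y)
  qed
  from steps_filter_le[of \<tau> g, OF this lt] scaled(4)[of 3 1 1]
  have s0: "steps (filter_t g \<tau>) \<le> 5 * N1" by simp
  let ?f = "remove_rule_row_t r"
  have "steps (?f y) \<le> 500 * P3" if "y \<in> set ?\<tau>" for y
    using steps_remove_rule_row[OF x R0, of y] sub(1) that P_chain(6) by fastforce
  from steps_map_rows[OF this sub(2)] have s1: "steps (map_t ?f ?\<tau>) \<le> 502 * N1" by simp
  let ?rs = "val (map_t ?f ?\<tau>)"
  have ok: "row_ok A (R - {r}) z" if "z \<in> set ?rs" for z
    using that row_ok_remove_rule[OF x] by auto
  have s3: "steps (nub_t row_eq_t ?rs) \<le> 167 * N2"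
    unfolding N2_def N1_def P3_def P2_def P1_def
    by (rule sizes.nub_rows_steps(1)[OF R0 ok, unfolded sizes.N2_def[OF R0] sizes.N1_def[OF R0]
          sizes.P3_def[OF R0] sizes.P2_def[OF R0] sizes.P1_def[OF R0]]) (use sub in auto)
  have "steps (remove_rule_t r (seen, \<tau>)) = steps (delete_key_t r seen) + steps (filter_t g \<tau>) +
      steps (map_t ?f ?\<tau>) + steps (nub_t row_eq_t ?rs) + 1"
    unfolding remove_rule_t_alt g_def by simp
  then show ?thesis using steps_delete_key_t[OF l, of r] s0 s1 s3 P_chain P_pos by linarith
qed

text \<open>Joining all pairs of rows is of order \<open>N2\<close>. Deleting duplicates among
  \<open>N * N\<close> rows is of order \<open>N3\<close>, the dominant cost of the whole
  algorithm.\<close>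

lemma steps_join_t:
  assumes \<tau>: "table_ok A R \<tau>'" "table_ok A R \<tau>''"
    and l: "length X \<le> n" "length seen' \<le> n" "length seen'' \<le> n"
  shows "steps (join_t X (seen', \<tau>') (seen'', \<tau>'')) \<le> 1000 * N3"
proof -
  have x: "row_ok A R x" if "x \<in> set \<tau>' \<union> set \<tau>''" for x using \<tau> that by (auto simp: table_ok_def)
  have lt: "length \<tau>' \<le> N" "length \<tau>'' \<le> N" using length_rows \<tau> by auto
  define k where "k = (\<lambda>(r, w', h'). do {
       e \<leftarrow> lookup_t seen'' r;
       (w, h) \<leftarrow> bag_weight_t X r;
       prim (case e of None \<Rightarrow> (r, w', h') | Some (w'', h'') \<Rightarrow> (r, w' + w'' - w, h' + h'' - h)) })"
  have "steps (k y) \<le> 5 * n + 5" for y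
    using steps_lookup_le[OF l(3), of "fst y"] steps_bag_weight_t[OF l(1), of "fst y"]
    by (simp add: k_def split_def)
  from steps_map_le[of seen' k, OF this l(2)]
  have "steps (map_t k seen') \<le> n * (5 * n + 5 + 1) + 1" .
  also have "\<dots> = 5 * (n * n) + 6 * n + 1" by (simp add: algebra_simps)
  finally have s0: "steps (map_t k seen') \<le> 12 * Q" using P_chain(1-3) by linarith
  define g where "g = (\<lambda>x. do { rss \<leftarrow> map_t (join_row_t x) \<tau>''; concat_t rss })"
  have lj: "length (val (join_row_t y z)) \<le> 1" for y z
    by (simp add: join_row_t_def split_def val_if)
  have sg: "steps (g y) \<le> 336 * N1" if "y \<in> set \<tau>'" for y
  proof -
    have "steps (join_row_t y z) \<le> 330 * P3" if "z \<in> set \<tau>''" for z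
      using \<open>y \<in> set \<tau>'\<close> that by (intro steps_join_row x) auto
    from steps_map_rows[of \<tau>'' "join_row_t y", OF this lt(2)]
    have "steps (map_t (join_row_t y) \<tau>'') \<le> 332 * N1" by simp
    moreover have "steps (concat_t (val (map_t (join_row_t y) \<tau>''))) \<le> N * (1 + 2) + 1"
      by (rule steps_concat_le) (use lj[of y] lt in auto)
    ultimately show ?thesis using P_chain(12) P_pos by (simp add: g_def)
  qed
  have s1: "steps (map_t g \<tau>') \<le> 338 * N2"
    using steps_map_le[of \<tau>' g, OF sg lt(1)] scaled(5)[of 336 1 1] by simp
  have lg: "length (val (g y)) \<le> N" for y
  proof -
    have "length (concat (val (map_t (join_row_t y) \<tau>''))) \<le> length (val (map_t (join_row_t y) \<tau>'')) * 1"
      by (rule length_concat_le) (use lj[of y] in auto)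
    then show ?thesis using lt by (simp add: g_def)
  qed
  have s2: "steps (concat_t (val (map_t g \<tau>'))) \<le> 4 * N2"
  proof -
    have "steps (concat_t (val (map_t g \<tau>'))) \<le> N * (N + 2) + 1"
      by (rule steps_concat_le) (use lg lt in auto)
    also have "N * (N + 2) + 1 = N * N + 2 * N + 1" by (simp add: algebra_simps)
    finally show ?thesis using P_chain(8,12,13) P_pos(5) by linarith
  qed
  let ?rs = "concat (val (map_t g \<tau>'))"
  have "length ?rs \<le> length (val (map_t g \<tau>')) * N"
    by (rule length_concat_le) (use lg in auto)
  also have "\<dots> \<le> N * N" using lt(1) by simp
  finally have lrs: "length ?rs \<le> N * N" .
  have ok: "row_ok A R z" if "z \<in> set ?rs" for z
  proof -
    obtain u v where "u \<in> set \<tau>'" "v \<in> set \<tau>''" "z \<in> set (val (join_row_t u v))"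
      using \<open>z \<in> set ?rs\<close> by (auto simp: g_def)
    then show ?thesis using row_ok_join[OF x x] by blast
  qed
  have s3: "steps (nub_t row_eq_t ?rs) \<le> 84 * N3" by (rule nub_rows_steps(2)[OF ok lrs])
  have "steps (join_t X (seen', \<tau>') (seen'', \<tau>'')) = steps (map_t k seen') + steps (map_t g \<tau>') +
      steps (concat_t (val (map_t g \<tau>'))) + steps (nub_t row_eq_t ?rs) + 1"
    unfolding join_t_alt g_def k_def by simp
  then show ?thesis using s0 s1 s2 s3 P_chain P_pos by linarith
qed

end

section \<open>Cost of one node and of the whole run\<close>

lemma steps_split_bag_t: "steps (split_bag_t b) = length b + 1"
  by (induction b) (auto simp: split_def split: vertex.split)

text \<open>Splitting a list that enumerates the bag already counts atoms and rules
  separately.\<close>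

lemma card_bag:
  assumes "finite (label t)"
  shows "card (atoms_at t) + card (rules_at t) = card (label t)" "finite (atoms_at t)" "finite (rules_at t)"
proof -
  obtain b where b: "set b = label t" "distinct b" using finite_distinct_list[OF assms] by blast
  obtain X R where XR: "val (split_bag_t b) = (X, R)" by (cases "val (split_bag_t b)")
  note sb = split_bag_t_props[OF XR]
  have e: "atoms_at t = set X" "rules_at t = set R" using sb(1,2) b(1) by (auto simp: atoms_at_def rules_at_def)
  show "card (atoms_at t) + card (rules_at t) = card (label t)"
    unfolding e b(1)[symmetric] using sb(3-5) b(2) by (simp add: distinct_card)
  show "finite (atoms_at t)" "finite (rules_at t)" unfolding e by auto
qed

lemma good_sizes:
  assumes "good \<Pi> t" "finite (label t)" "card (label t) \<le> n" "1 \<le> n"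
    and "2 \<le> m" "\<And>r. r \<in> \<Pi> \<Longrightarrow> cap r + 2 \<le> m"
  shows "sizes (atoms_at t) (rules_at t) n m (m ^ n) (m ^ n * 2 ^ (m ^ n)) (n * n * n)"
  using assms card_bag[OF assms(2)] good_rules(1)[OF assms(1)] by unfold_locales auto

text \<open>This is \<open>N^3 * S^3 * Q\<close> for \<open>S = m^n\<close>: the factor
  \<open>N^3\<close> contributes \<open>S^3\<close> and \<open>2^(3 * S)\<close>.\<close>

definition node_cost :: "nat \<Rightarrow> nat \<Rightarrow> nat" where
  "node_cost n m = (m ^ n) ^ 6 * 2 ^ (3 * m ^ n) * n ^ 3"

lemma (in sizes) N3_node_cost: "N3 = node_cost n m"
proof -
  have "(x * e) * ((x * e) * ((x * e) * (x * (x * (x * (n * n * n)))))) = x ^ 6 * e ^ 3 * n ^ 3" for x e :: nat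
    by (simp add: power_numeral_reduce ac_simps)
  then have "N * (N * (N * (S * (S * (S * Q))))) = S ^ 6 * (2 ^ S) ^ 3 * n ^ 3"
    unfolding N Q .
  moreover have "N3 = N * (N * (N * (S * (S * (S * Q)))))"
    by (simp only: N3_def N2_def N1_def P3_def P2_def P1_def)
  moreover have "S ^ 6 * (2 ^ S) ^ 3 * n ^ 3 = node_cost n m"
    unfolding node_cost_def S by (simp only: power_mult[symmetric] mult.commute[of 3])
  ultimately show ?thesis by simp
qed

lemma steps_unary:
  assumes g: "good \<Pi> (Node (set b) [u])" and d: "distinct b" "distinct c" and c: "label u = set c"
    and inv: "node_inv u s" and n: "length b \<le> n" "length c \<le> n" "1 \<le> n"
    and m: "2 \<le> m" "\<And>r. r \<in> \<Pi> \<Longrightarrow> cap r + 2 \<le> m"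
  shows "steps (unary_t totals b c s) \<le> 1020 * node_cost n m"
proof -
  let ?t = "Node (set b) [u]"
  obtain seen \<tau> where s: "s = (seen, \<tau>)" by (cases s)
  obtain X R' where XR: "val (split_bag_t b) = (X, R')" by (cases "val (split_bag_t b)")
  note sb = split_bag_t_props[OF XR]
  have inv': "seen_ok (atoms_below u) (rules_at u) seen" "table_ok (atoms_at u) (rules_at u) \<tau>"
    using inv by (auto simp: node_inv_def s)
  have gu: "good \<Pi> u" using good_child[OF g, of 0] by simp
  have nice: "nice_node ?t" using g by (auto simp: good_def)
  \<comment> \<open>Two instances with the same numbers. An introduction is charged over the bag of
    the node and a removal over the bag of the child, in each case the larger one.\<close>
  interpret t: sizes "atoms_at ?t" "rules_at ?t" n m "m ^ n" "m ^ n * 2 ^ (m ^ n)" "n * n * n"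
    by (rule good_sizes[OF g _ _ n(3) m]) (use n d in \<open>auto simp: distinct_card\<close>)
  interpret u: sizes "atoms_at u" "rules_at u" n m "m ^ n" "m ^ n * 2 ^ (m ^ n)" "n * n * n"
    by (rule good_sizes[OF gu _ _ n(3) m]) (use n d in \<open>auto simp: c distinct_card\<close>)
  have lX: "length X \<le> n" "length R' \<le> n" using sb(5) n(1) by linarith+
  have lseen: "length seen = card (rules_at u)" using seen_ok_length[OF inv'(1)] .
  then have lseen': "length seen \<le> n" using u.AR by linarith
  let ?new = "filter (\<lambda>y. y \<notin> set c) b" and ?old = "filter (\<lambda>y. y \<notin> set b) c"
  let ?op = "case ?new of
        Atom a # _ \<Rightarrow> intro_atom_t totals X R' a s
      | Rule r # _ \<Rightarrow> intro_rule_t totals X r s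
      | [] \<Rightarrow> (case ?old of
          Atom a # _ \<Rightarrow> remove_atom_t a s
        | Rule r # _ \<Rightarrow> remove_rule_t r s
        | [] \<Rightarrow> ret s)"
  have "steps ?op \<le> 1000 * t.N3"
  proof (cases rule: nice_unary_cases[OF nice])
    case 1 then show ?case by simp
  next
    case 2 then show ?case by (simp add: c)
  next
    case (3 x)
    have new: "?new = [x]" using filter_singleton[OF d(1)] 3(4) c by simp
    show ?thesis
    proof (cases x)
      case (Atom a)
      have at: "atoms_at ?t = insert a (atoms_at u)" "rules_at ?t = rules_at u" "a \<notin> atoms_at u"
        using 3 Atom by (auto simp: atoms_at_def rules_at_def)
      show ?thesis
        unfolding new Atom s using t.steps_intro_atom_t[OF inv'(2)[folded at(2)] u.sizes_axioms[folded at(2)] at(1,3) lX(1) lseen' lX(2)]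
        by simp
    next
      case (Rule r)
      have at: "atoms_at ?t = atoms_at u" "rules_at ?t = insert r (rules_at u)" "r \<notin> rules_at u"
        using 3 Rule by (auto simp: atoms_at_def rules_at_def)
      have "length seen < n" using t.AR at(2,3) u.fin(2) lseen by simp
      then show ?thesis
        unfolding new Rule s using t.steps_intro_rule_t[OF inv'(2)[folded at(1)] u.sizes_axioms[folded at(1)] at(2,3) lX(1)]
        by simp
    qed
  next
    case (4 x)
    have new: "?new = []" using 4(5) c by (auto simp: filter_empty_conv)
    have old: "?old = [x]" using filter_singleton[OF d(2)] 4(4) c by simp
    show ?thesis
    proof (cases x)
      case (Atom a)
      show ?thesis
        unfolding new old Atom s using u.steps_remove_atom_t[OF inv'(2)] by simp
    next
      case (Rule r)
      have at: "atoms_at ?t = atoms_at u" "rules_at ?t = rules_at u - {r}"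
        using 4 Rule by (auto simp: atoms_at_def rules_at_def)
      show ?thesis
        unfolding new old Rule s using u.steps_remove_rule_t[OF inv'(2) t.sizes_axioms[unfolded at] lseen'] by simp
    qed
  qed
  moreover have "steps (unary_t totals b c s) =
      steps (split_bag_t b) + steps (diff_t b c) + steps (diff_t c b) + steps ?op"
    unfolding unary_t_def by (simp add: XR cong del: list.case_cong_weak)
  moreover have "n * (2 * n + 3) + 1 = 2 * (n * n) + 3 * n + 1" by (simp add: algebra_simps)
  ultimately have "steps (unary_t totals b c s) \<le> 1020 * t.N3"
    using steps_split_bag_t[of b] n(1) steps_diff_le[OF n(1,2)] steps_diff_le[OF n(2,1)] t.P_chain t.P_pos
    by linarith
  then show ?thesis unfolding t.N3_node_cost .
qed

lemma steps_binary:
  assumes g: "good \<Pi> (Node (set b) [u, v])" and d: "distinct b"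
    and inv: "node_inv u s'" "node_inv v s''" and n: "length b \<le> n" "1 \<le> n"
    and m: "2 \<le> m" "\<And>r. r \<in> \<Pi> \<Longrightarrow> cap r + 2 \<le> m"
  shows "steps (binary_t b s' s'') \<le> 1020 * node_cost n m"
proof -
  let ?t = "Node (set b) [u, v]"
  obtain seen' \<tau>' where s': "s' = (seen', \<tau>')" by (cases s')
  obtain seen'' \<tau>'' where s'': "s'' = (seen'', \<tau>'')" by (cases s'')
  obtain X R' where XR: "val (split_bag_t b) = (X, R')" by (cases "val (split_bag_t b)")
  note sb = split_bag_t_props[OF XR]
  have inv': "seen_ok (atoms_below u) (rules_at u) seen'" "table_ok (atoms_at u) (rules_at u) \<tau>'"
    using inv(1) by (auto simp: node_inv_def s')
  have inv'': "seen_ok (atoms_below v) (rules_at v) seen''" "table_ok (atoms_at v) (rules_at v) \<tau>''"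
    using inv(2) by (auto simp: node_inv_def s'')
  have l: "label u = set b" "label v = set b" using g by (auto simp: good_def)
  have at: "atoms_at u = atoms_at ?t" "atoms_at v = atoms_at ?t"
    "rules_at u = rules_at ?t" "rules_at v = rules_at ?t"
    using l by (auto simp: atoms_at_def rules_at_def)
  interpret t: sizes "atoms_at ?t" "rules_at ?t" n m "m ^ n" "m ^ n * 2 ^ (m ^ n)" "n * n * n"
    by (rule good_sizes[OF g _ _ n(2) m]) (use n d in \<open>auto simp: distinct_card\<close>)
  have lX: "length X \<le> n" using sb(5) n(1) by linarith
  have ls: "length seen' \<le> n" "length seen'' \<le> n"
    using seen_ok_length[OF inv'(1)] seen_ok_length[OF inv''(1)] at t.AR by auto
  have "steps (join_t X s' s'') \<le> 1000 * t.N3"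
    unfolding s' s'' by (rule t.steps_join_t[OF inv'(2)[unfolded at] inv''(2)[unfolded at] lX ls])
  moreover have "steps (binary_t b s' s'') = steps (split_bag_t b) + steps (join_t X s' s'')"
    by (simp add: binary_t_def XR)
  ultimately have "steps (binary_t b s' s'') \<le> 1020 * t.N3"
    using steps_split_bag_t[of b] n(1) t.P_chain t.P_pos by linarith
  then show ?thesis unfolding t.N3_node_cost .
qed

lemma node_cost_pos: "2 \<le> m \<Longrightarrow> 1 \<le> n \<Longrightarrow> 1 \<le> node_cost n m"
  by (simp add: node_cost_def)

text \<open>At an inner node the operation with the preparation of the bags costs at most 1020
  units, and building the result node adds one step.\<close>

lemma steps_dp_run:
  assumes "good \<Pi> (map_rtree set T)" "all_nodes (\<lambda>s. distinct (label s) \<and> length (label s) \<le> n) T"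
    and n: "1 \<le> n" and m: "2 \<le> m" "\<And>r. r \<in> \<Pi> \<Longrightarrow> cap r + 2 \<le> m"
  shows "steps (dp_run totals T) \<le> nodes T * (1021 * node_cost n m)"
  using assms(1,2)
proof (induction T)
  case (Node b ts)
  let ?m = "map_rtree set" and ?d = "all_nodes (\<lambda>s. distinct (label s) \<and> length (label s) \<le> n)"
  have nice: "nice_node (?m (Node b ts))" using Node.prems by (simp add: good_def)
  have g: "good \<Pi> (?m u)" if "u \<in> set ts" for u
    using that good_child[of \<Pi> "set b" "map ?m ts"] Node.prems(1) by (auto simp: in_set_conv_nth)
  have d: "distinct b" "length b \<le> n" "\<And>u. u \<in> set ts \<Longrightarrow> ?d u"
    using Node.prems(2) by auto
  have dl: "distinct (label u)" "length (label u) \<le> n" if "u \<in> set ts" for u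
    using all_nodes_root[OF d(3)[OF that]] by auto
  have da: "all_nodes (\<lambda>s. distinct (label s)) u" if "u \<in> set ts" for u
    by (rule all_nodes_mono[OF d(3)[OF that]]) simp
  note IH = Node.IH[OF _ g d(3)]
  have inv: "node_inv (?m u) (label (val (dp_run totals u)))" if "u \<in> set ts" for u
    using dp_run_correct[OF g[OF that] da[OF that]] by blast
  note c = node_cost_pos[OF m(1) n]
  consider "ts = []" | u where "ts = [u]" | u v where "ts = [u, v]" | u v w us where "ts = u # v # w # us"
    by (cases ts; cases "tl ts"; cases "tl (tl ts)") auto
  then show ?case
  proof cases
    case 1
    then show ?thesis using c by simp
  next
    case (2 u)
    then have u: "u \<in> set ts" by simp
    have "steps (unary_t totals b (label u) (label (val (dp_run totals u)))) \<le> 1020 * node_cost n m"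
      using Node.prems(1) 2 d(1,2) dl[OF u] inv[OF u] n m by (intro steps_unary) (auto simp: label_map)
    then show ?thesis
      using IH[OF u u u] c unfolding 2 dp_run_unary by (simp add: algebra_simps)
  next
    case (3 u v)
    then have u: "u \<in> set ts" and v: "v \<in> set ts" by auto
    have "steps (binary_t b (label (val (dp_run totals u))) (label (val (dp_run totals v)))) \<le> 1020 * node_cost n m"
      using Node.prems(1) 3 d(1,2) inv[OF u] inv[OF v] n m by (intro steps_binary) auto
    then show ?thesis
      using IH[OF u u u] IH[OF v v v] c unfolding 3 dp_run_binary by (simp add: algebra_simps)
  next
    case (4 u v w us)
    then show ?thesis using nice by simp
  qed
qed

section \<open>The exponential bound\<close>

text \<open>Divide the exponent into \<open>d\<close> equal parts: with \<open>q = x div d\<close>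
  one has \<open>x <= d * (q + 1) <= d * 2^q\<close>, and the claim is the \<open>d\<close>-th power
  of this.\<close>

lemma power_le_const_exp: "\<exists>C\<ge>1. \<forall>x. x ^ d \<le> C * 2 ^ x" if "1 \<le> d" for d :: nat
proof (intro exI[of _ "d ^ d"] conjI allI)
  show "1 \<le> d ^ d" using that by simp
  fix x :: nat
  define q where "q = x div d"
  have "x mod d < d" using that by simp
  moreover have "x = d * q + x mod d" by (simp add: q_def)
  ultimately have "x \<le> d * q + d" by linarith
  then have "x \<le> d * (q + 1)" by simp
  also have "\<dots> \<le> d * 2 ^ q" by (intro mult_left_mono) (simp_all add: Suc_le_eq)
  finally have "x ^ d \<le> (d * 2 ^ q) ^ d" by (rule power_mono) simp
  also have "\<dots> = d ^ d * 2 ^ (q * d)" by (simp add: power_mult_distrib power_mult)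
  also have "\<dots> \<le> d ^ d * 2 ^ x" by (intro mult_left_mono power_increasing) (simp_all add: q_def)
  finally show "x ^ d \<le> d ^ d * 2 ^ x" .
qed

text \<open>The exponent has a slack of one fifth of \<open>S\<close> to absorb the polynomial. To
  stay within the natural numbers, fifth powers are compared: \<open>S^50\<close> costs one more
  \<open>S\<close> in the exponent, and 15 becomes 16.\<close>

lemma exp_absorb:
  fixes S Y e C :: nat
  assumes C: "1 \<le> C" "S ^ 50 \<le> C * 2 ^ S" and le: "16 * S \<le> 10 * Y + 5 * e"
  shows "S ^ 10 * 2 ^ (3 * S) \<le> C * 2 ^ e * 2 ^ (2 * Y)"
proof -
  have "(S ^ 10 * 2 ^ (3 * S)) ^ 5 = S ^ 50 * 2 ^ (15 * S)"
    by (simp add: power_mult_distrib flip: power_mult)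
  also have "\<dots> \<le> C * 2 ^ S * 2 ^ (15 * S)" using C(2) by (rule mult_right_mono) simp
  also have "\<dots> = C * 2 ^ (16 * S)" by (simp flip: power_add)
  also have "\<dots> \<le> C * 2 ^ (10 * Y + 5 * e)" using le by (intro mult_left_mono power_increasing) auto
  also have "\<dots> \<le> C ^ 5 * 2 ^ (10 * Y + 5 * e)"
    using C(1) by (intro mult_right_mono self_le_power) auto
  also have "\<dots> = (C * 2 ^ e * 2 ^ (2 * Y)) ^ 5"
    by (simp add: power_mult_distrib power_add mult.commute flip: power_mult)
  finally have "(S ^ 10 * 2 ^ (3 * S)) ^ Suc 4 \<le> (C * 2 ^ e * 2 ^ (2 * Y)) ^ Suc 4" by simp
  then show ?thesis by (rule power_le_imp_le_base) simp
qed

text \<open>Each rule has at most \<open>l + 2\<close> truncated values, and \<open>(l + 2) / (2 l) \<le> 5 / 6\<close>. The cube of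
  \<open>5 / 6\<close> is less than \<open>5 / 8\<close>; smaller exponents are covered by the additive constant.\<close>

lemma state_count_le:
  fixes l n :: nat
  assumes "3 \<le> l" "1 \<le> n"
  shows "16 * (l + 2) ^ n \<le> 10 * (2 * l) ^ n + 1600"
proof -
  consider "n = 1" | "n = 2" | "3 \<le> n" using assms(2) by linarith
  then show ?thesis
  proof cases
    case 1 then show ?thesis by simp
  next
    case 2
    have "3 * l \<le> l * l" using assms(1) by (rule mult_right_mono) simp
    moreover have "16 * (l + 2) ^ n = 16 * (l * l) + 64 * l + 64" "10 * (2 * l) ^ n = 40 * (l * l)"
      unfolding 2 by (simp_all add: power2_eq_square algebra_simps)
    ultimately show ?thesis by linarith
  next
    case 3
    then obtain j where j: "n = 3 + j" using le_Suc_ex by blast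
    have "(6 * (l + 2)) ^ 3 \<le> (5 * (2 * l)) ^ 3" using assms(1) by (intro power_mono) auto
    then have "216 * (l + 2) ^ 3 \<le> 125 * (2 * l) ^ 3" by (simp only: power_mult_distrib) simp
    then have "16 * (l + 2) ^ 3 \<le> 10 * (2 * l) ^ 3" by linarith
    moreover have "(l + 2) ^ j \<le> (2 * l) ^ j" using assms(1) by (intro power_mono) auto
    ultimately have "16 * (l + 2) ^ 3 * (l + 2) ^ j \<le> 10 * (2 * l) ^ 3 * (2 * l) ^ j" by (rule mult_mono) auto
    then show ?thesis unfolding j power_add mult.assoc[symmetric] by (rule trans_le_add1)
  qed
qed

lemma node_cost_bound:
  "\<exists>K. \<forall>k l. 3 \<le> l \<longrightarrow> (k + 1) * node_cost (k + 1) (l + 2) \<le> K * 2 ^ (2 ^ (k + 2) * l ^ (k + 1))"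
proof -
  obtain C :: nat where C: "1 \<le> C" "\<And>x. x ^ 50 \<le> C * 2 ^ x" using power_le_const_exp[of 50] by auto
  \<comment> \<open>The 320 is one fifth of the additive constant 1600 of
    \<open>state_count_le\<close>, because \<open>exp_absorb\<close> works with fifth
    powers.\<close>
  show ?thesis
  proof (intro exI[of _ "C * 2 ^ 320"] allI impI)
    fix k l :: nat assume l: "3 \<le> l"
    define n where "n = k + 1"
    define S where "S = (l + 2) ^ n"
    have "n < 2 ^ n" by simp
    also have "2 ^ n \<le> S" unfolding S_def by (intro power_mono) auto
    finally have nS: "n \<le> S" by simp
    \<comment> \<open>The factor \<open>n = k + 1\<close> stands for the number of nodes per unit of
      graph size. It joins \<open>n^3\<close>, and \<open>n <= S\<close> turns both into
      \<open>S^4\<close>.\<close>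
    have "n * node_cost n (l + 2) = S ^ 6 * 2 ^ (3 * S) * n ^ 4"
      by (simp add: node_cost_def S_def power_numeral_reduce)
    also have "\<dots> \<le> S ^ 6 * 2 ^ (3 * S) * S ^ 4" using nS by (intro mult_left_mono power_mono) auto
    also have "\<dots> = S ^ 10 * 2 ^ (3 * S)" by (simp add: mult.commute mult.left_commute flip: power_add)
    also have "\<dots> \<le> C * 2 ^ 320 * 2 ^ (2 * (2 * l) ^ n)"
    proof (rule exp_absorb[OF C])
      show "16 * S \<le> 10 * (2 * l) ^ n + 5 * 320"
        using state_count_le[OF l, of n] by (simp add: S_def n_def)
    qed
    also have "2 * (2 * l) ^ n = 2 ^ (k + 2) * l ^ (k + 1)"
      by (simp add: n_def power_mult_distrib)
    finally show "(k + 1) * node_cost (k + 1) (l + 2) \<le> C * 2 ^ 320 * 2 ^ (2 ^ (k + 2) * l ^ (k + 1))"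
      by (simp add: n_def)
  qed
qed

text \<open>One unit per rule counts rule vertices, and one unit per atom occurrence counts edges,
  because an edge determines its atom and its rule.\<close>

lemma steps_totals_le:
  assumes "program \<Pi>"
  shows "(\<Sum>r\<in>\<Pi>. Suc (card (at_rule r))) \<le> graph_size (incidence_graph \<Pi>)"
proof -
  have fin: "finite \<Pi>" "\<And>r. r \<in> \<Pi> \<Longrightarrow> finite (at_rule r)"
    using assms by (auto simp: program_def wf_rule_def)
  have "card \<Pi> = card (Rule ` \<Pi>)" by (simp add: card_image inj_on_def)
  also have "\<dots> \<le> card (fst (incidence_graph \<Pi>))"
    using finite_incidence[OF assms] by (intro card_mono) (auto simp: incidence_graph_def)
  finally have 1: "card \<Pi> \<le> card (fst (incidence_graph \<Pi>))" .
  have "snd (incidence_graph \<Pi>) = (\<lambda>(r, a). {Atom a, Rule r}) ` (SIGMA r:\<Pi>. at_rule r)"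
    by (force simp: incidence_graph_def)
  moreover have "inj_on (\<lambda>(r, a). {Atom a, Rule r}) (SIGMA r:\<Pi>. at_rule r)"
    by (auto simp: inj_on_def doubleton_eq_iff)
  ultimately have "card (snd (incidence_graph \<Pi>)) = (\<Sum>r\<in>\<Pi>. card (at_rule r))"
    using fin by (simp add: card_image card_SigmaI)
  then show ?thesis using 1 by (simp add: graph_size_def sum_Suc)
qed

text \<open>For choice and disjunctive rules, whose caps are 1 and 0, the bound comes from the 3
  included in \<open>max_bound\<close>.\<close>

lemma cap_le_max_bound:
  assumes "program \<Pi>" "r \<in> \<Pi>"
  shows "cap r + 2 \<le> max_bound \<Pi> + 2" "3 \<le> max_bound \<Pi>"
proof -
  let ?B = "{3} \<union> {bnd r | r. r \<in> \<Pi> \<and> is_Weight r}"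
  have "finite ?B" using assms(1) by (auto simp: program_def)
  then have B: "b \<le> max_bound \<Pi>" if "b \<in> ?B" for b
    unfolding max_bound_def using that by (rule Max_ge)
  show 3: "3 \<le> max_bound \<Pi>" by (rule B) simp
  show "cap r + 2 \<le> max_bound \<Pi> + 2"
  proof (cases "is_Weight r")
    case True
    then have "bnd r \<le> max_bound \<Pi>" using assms(2) by (intro B) auto
    then show ?thesis using True by (cases r) auto
  next
    case False
    then show ?thesis using 3 by (cases r) auto
  qed
qed

section \<open>From optimal decompositions to the running time\<close>

lemma optimal_nice_td_good:
  assumes "program \<Pi>" "optimal_nice_td \<Pi> T"
  shows "good \<Pi> (map_rtree set T)"
    "all_nodes (\<lambda>s. distinct (label s) \<and> length (label s) \<le> treewidth (incidence_graph \<Pi>) + 1) T"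
proof -
  let ?G = "incidence_graph \<Pi>"
  have T: "tree_decomposition ?G (map_rtree set T)" "nice (map_rtree set T)"
    "width (map_rtree set T) = treewidth ?G" and d: "all_nodes (\<lambda>s. distinct (label s)) T"
    using assms(2) all_nodes_positions[of T "\<lambda>s. distinct (label s)"] by (auto simp: optimal_nice_td_def)
  show "good \<Pi> (map_rtree set T)"
    using assms(1) T by (auto simp: good_def tree_decomposition_iff nice_iff)
  have fin: "all_nodes (\<lambda>s. finite (label s)) (map_rtree set T)"
    unfolding all_nodes_map label_map by (rule all_nodes_mono[OF d]) simp
  have "bounded_bags (Suc (treewidth ?G)) (map_rtree set T)"
    using width_le_iff[OF fin, of "treewidth ?G"] T(3) by simp
  then have "all_nodes (\<lambda>s. card (set (label s)) \<le> Suc (treewidth ?G)) T"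
    unfolding bounded_bags_def all_nodes_map label_map by (rule all_nodes_mono) simp
  with d have "all_nodes (\<lambda>s. distinct (label s) \<and> card (set (label s)) \<le> Suc (treewidth ?G)) T"
    by (simp add: all_nodes_conj)
  then show "all_nodes (\<lambda>s. distinct (label s) \<and> length (label s) \<le> treewidth ?G + 1) T"
    by (rule all_nodes_mono) (metis distinct_card Suc_eq_plus1)
qed

theorem theorem4:
  shows "(\<exists>c::nat. \<forall>\<Pi> :: 'a rule set. program \<Pi> \<and> \<Pi> \<noteq> {} \<longrightarrow>
            (\<exists>T. optimal_nice_td \<Pi> T \<and>
                 card (positions T) \<le>
                   c * (treewidth (incidence_graph \<Pi>) + 1) * graph_size (incidence_graph \<Pi>)))
       \<and> (\<forall>c::nat. \<exists>K::nat. \<forall>(\<Pi> :: 'a rule set) T k l.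
            program \<Pi> \<longrightarrow> optimal_nice_td \<Pi> T \<longrightarrow>
            k = treewidth (incidence_graph \<Pi>) \<longrightarrow> l = max_bound \<Pi> \<longrightarrow>
            card (positions T) \<le> c * (k + 1) * graph_size (incidence_graph \<Pi>) \<longrightarrow>
            computed_tables (val (dp_inc \<Pi> T))
              = map_rtree ((`) trunc_row) (dp_tables (map_rtree set T)) \<and>
            steps (dp_inc \<Pi> T)
              \<le> K * 2 ^ (2 ^ (k + 2) * l ^ (k + 1)) * graph_size (incidence_graph \<Pi>))"
proof (intro conjI allI, goal_cases)
  case 1
  show ?case using ex_optimal_nice_td by blast
next
  case (2 c)
  obtain K where K: "\<And>k l. 3 \<le> l \<Longrightarrow>
      (k + 1) * node_cost (k + 1) (l + 2) \<le> K * 2 ^ (2 ^ (k + 2) * l ^ (k + 1))"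
    using node_cost_bound by blast
  show ?case
  \<comment> \<open>The summand 1 pays for the preprocessing; in the other one, \<open>c\<close>
    bounds the nodes, 1021 is the constant per node, and \<open>K\<close> comes from the exponential
    estimate.\<close>
  proof (intro exI[of _ "1 + c * 1021 * K"] allI impI conjI)
    fix \<Pi> :: "'a rule set" and T k l
    let ?G = "graph_size (incidence_graph \<Pi>)"
    assume \<Pi>: "program \<Pi>" and T: "optimal_nice_td \<Pi> T"
      and k: "k = treewidth (incidence_graph \<Pi>)" and l: "l = max_bound \<Pi>"
      and p: "card (positions T) \<le> c * (k + 1) * ?G"
    note g = optimal_nice_td_good[OF \<Pi> T, folded k]
    have tot: "val (totals_t \<Pi>) = totals" "steps (totals_t \<Pi>) \<le> ?G"
      using steps_totals_le[OF \<Pi>] by (simp_all add: totals_t_def totals_def)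
    have da: "all_nodes (\<lambda>s. distinct (label s)) T"
      by (rule all_nodes_mono[OF g(2)]) simp
    show "computed_tables (val (dp_inc \<Pi> T)) = map_rtree ((`) trunc_row) (dp_tables (map_rtree set T))"
      using dp_run_correct[OF g(1) da] by (simp add: dp_inc_def tot(1))
    have "nodes T \<le> c * (k + 1) * ?G" using p by (simp add: card_positions)
    moreover have "1 \<le> nodes T" by (cases T) simp
    \<comment> \<open>A tree has at least one node, so the bound on the number of nodes excludes the
      empty graph. Then there is a rule, as \<open>cap_le_max_bound\<close> requires for
      \<open>3 <= l\<close>.\<close>
    ultimately have "?G \<noteq> 0" by (cases "?G = 0") simp_all
    then have "\<Pi> \<noteq> {}" by (auto simp: graph_size_def incidence_graph_def)
    then have l3: "3 \<le> l" using cap_le_max_bound(2)[OF \<Pi>] by (auto simp: l)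
    let ?E = "2 ^ (2 ^ (k + 2) * l ^ (k + 1)) :: nat"
    have "steps (dp_run totals T) \<le> nodes T * (1021 * node_cost (k + 1) (l + 2))"
      by (rule steps_dp_run[OF g]) (use cap_le_max_bound(1)[OF \<Pi>] in \<open>auto simp: l\<close>)
    also have "\<dots> \<le> c * (k + 1) * ?G * (1021 * node_cost (k + 1) (l + 2))"
      using p by (intro mult_right_mono) (simp_all add: card_positions)
    also have "\<dots> = c * 1021 * ((k + 1) * node_cost (k + 1) (l + 2)) * ?G" by (simp only: ac_simps)
    also have "\<dots> \<le> c * 1021 * (K * ?E) * ?G" by (intro mult_right_mono mult_left_mono K l3) auto
    finally have "steps (dp_inc \<Pi> T) \<le> ?G + c * 1021 * (K * ?E) * ?G"
      using tot by (simp add: dp_inc_def)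
    also have "?G \<le> ?E * ?G" by simp
    then have "?G + c * 1021 * (K * ?E) * ?G \<le> ?E * ?G + c * 1021 * (K * ?E) * ?G" by simp
    also have "\<dots> = (1 + c * 1021 * K) * ?E * ?G" by (simp only: algebra_simps)
    finally show "steps (dp_inc \<Pi> T) \<le> (1 + c * 1021 * K) * ?E * ?G" .
  qed
qed

end
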